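(* Let $(n,N,\tau)$ be one of the following triples: $(2,2k,2k-1)$ with $k\ge 1$; $(2,2k+1,2k)$ with $k\ge 1$; $(n,N,1)$ with $2\le N\le n$; $(n,n+1,2)$; $(n,2n,3)$; $(5,16,3)$; $(6,27,4)$; $(7,56,5)$; $(21,112,3)$; $(21,162,3)$; $(22,100,3)$; $(22,275,4)$; $(22,891,5)$; $(23,552,5)$; $(23,4600,7)$. Let $C\subset\mathbb{S}^{n-1}$ be a sharp code with these parameters, i.e. a spherical $\tau$-design with $|C|=N$ such that the set $\{x\cdot y: x,y\in C,\ x\neq y\}$ has exactly $\lfloor(\tau+1)/2\rfloor$ elements. Write $\tau=2k-1+\epsilon$ with $k\in\mathbb{N}$, $\epsilon\in\{0,1\}$, and let $\{\alpha_i\}_{i=1-\epsilon}^{k}$ and $\{\rho_i\}_{i=1-\epsilon}^{k}$ be the nodes and weights defined in the context. Then there exists a point $\widetilde{x}\in\mathbb{S}^{n-1}$ such that $\{\widetilde{x}\cdot y: y\in C\}=\{\alpha_i\}_{i=1-\epsilon}^k$ and, for each $i$, exactly $N\rho_i$ points $y\in C$ satisfy $\widetilde{x}\cdot y=\alpha_i$. Consequently, for every function $h:[-1,1]\to[0,+\infty]$ that is continuous on $[-1,1]$, finite on $(-1,1)$, and whose derivative $h^{(\tau+1)}$ exists and satisfies $h^{(\tau+1)}\ge 0$ on $(-1,1)$, one has $$\inf_{x\in\mathbb{S}^{n-1}}\sum_{y\in C}h(x\cdot y)=N\sum_{i=1-\epsilon}^{k}\rho_i h(\alpha_i),$$ the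 infimum being attained at $\widetilde{x}$.
   Context: $\mathbb{S}^{n-1}$ is the unit sphere in $\mathbb{R}^n$. A spherical $\tau$-design is a finite $C\subset\mathbb{S}^{n-1}$ such that the average over $C$ of every polynomial of degree at most $\tau$ in $n$ variables equals its average over $\mathbb{S}^{n-1}$ with respect to surface measure. Let $d\mu_n(t)=\gamma_n(1-t^2)^{(n-3)/2}dt$ on $[-1,1]$, with $\gamma_n$ chosen so that $\mu_n$ is a probability measure. For $a,b\in\{0,1\}$, $P_j^{(a,b)}(t)$ denotes the Jacobi polynomial of degree $j$ with parameters $\alpha=a+(n-3)/2$, $\beta=b+(n-3)/2$ (orthogonal on $[-1,1]$ with respect to $(1-t)^\alpha(1+t)^\beta$), normalized by $P_j^{(a,b)}(1)=1$. The nodes $\alpha_{1-\epsilon}<\dots<\alpha_k$ are the zeros of the polynomial $(1+t)^{\epsilon}P_k^{(0,\epsilon)}(t)$ (so $\alpha_0=-1$ when $\epsilon=1$), and $\rho_i=\int_{-1}^1\ell_i(t)\,d\mu_n(t)$, where $\ell_i$ are the Lagrange basis polynomials for these nodes ($\ell_i(\alpha_j)=\delta_{ij}$). *)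

theory Defs
  imports "HOL-Analysis.Analysis" "HOL-Computational_Algebra.Polynomial"
begin

definition monomial_fun :: "('n::finite \<Rightarrow> nat) \<Rightarrow> real^'n \<Rightarrow> real" where
  "monomial_fun a x = (\<Prod>i\<in>UNIV. (x $ i) ^ a i)"

definition total_degree :: "('n::finite \<Rightarrow> nat) \<Rightarrow> nat" where
  "total_degree a = (\<Sum>i\<in>UNIV. a i)"

definition poly_funs_upto :: "nat \<Rightarrow> (real^'n::finite \<Rightarrow> real) set" where
  "poly_funs_upto d = {p. \<exists>(A :: ('n \<Rightarrow> nat) set) c. finite A \<and>
       (\<forall>a\<in>A. total_degree a \<le> d) \<and> p = (\<lambda>x. \<Sum>a\<in>A. c a * monomial_fun a x)}"

text \<open>Normalized surface measure on the sphere realised as the cone measure: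
  the average of f over the sphere is the average over the unit ball of f(x/|x|).\<close>
definition sphere_avg :: "(real^'n::finite \<Rightarrow> real) \<Rightarrow> real" where
  "sphere_avg f = integral (ball 0 1) (\<lambda>x. f (x /\<^sub>R norm x)) / measure lebesgue (ball (0::real^'n) 1)"

definition spherical_design :: "nat \<Rightarrow> (real^'n::finite) set \<Rightarrow> bool" where
  "spherical_design \<tau> C \<longleftrightarrow> finite C \<and> C \<noteq> {} \<and> C \<subseteq> sphere 0 1 \<and>
     (\<forall>p\<in>poly_funs_upto \<tau>. (\<Sum>y\<in>C. p y) / real (card C) = sphere_avg p)"

definition sharp_code :: "nat \<Rightarrow> nat \<Rightarrow> (real^'n::finite) set \<Rightarrow> bool" where
  "sharp_code N \<tau> C \<longleftrightarrow> spherical_design \<tau> C \<and> card C = N \<and>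
     card {x \<bullet> y | x y. x \<in> C \<and> y \<in> C \<and> x \<noteq> y} = (\<tau> + 1) div 2"

definition jacobi_weight :: "real \<Rightarrow> real \<Rightarrow> real \<Rightarrow> real" where
  "jacobi_weight \<alpha> \<beta> t = (1 - t) powr \<alpha> * (1 + t) powr \<beta>"

definition jacobi_poly :: "real \<Rightarrow> real \<Rightarrow> nat \<Rightarrow> real poly" where
  "jacobi_poly \<alpha> \<beta> j = (THE p. degree p = j \<and> poly p 1 = 1 \<and>
     (\<forall>q :: real poly. degree q < j \<longrightarrow>
        integral {-1..1} (\<lambda>t. jacobi_weight \<alpha> \<beta> t * poly p t * poly q t) = 0))"

definition jacobiP :: "nat \<Rightarrow> nat \<Rightarrow> nat \<Rightarrow> nat \<Rightarrow> real poly" where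
  "jacobiP n a b j = jacobi_poly (real a + (real n - 3) / 2) (real b + (real n - 3) / 2) j"

text \<open>tau = 2k - 1 + eps with eps in {0,1}.\<close>
definition tau_k :: "nat \<Rightarrow> nat" where "tau_k \<tau> = (\<tau> + 1) div 2"
definition tau_eps :: "nat \<Rightarrow> nat" where "tau_eps \<tau> = (\<tau> + 1) mod 2"

definition sharp_nodes :: "nat \<Rightarrow> nat \<Rightarrow> real set" where
  "sharp_nodes n \<tau> = {t. poly ([:1, 1:] ^ tau_eps \<tau> * jacobiP n 0 (tau_eps \<tau>) (tau_k \<tau>)) t = 0}"

definition lagrange_basis :: "real set \<Rightarrow> real \<Rightarrow> real \<Rightarrow> real" where
  "lagrange_basis Z a t = (\<Prod>b\<in>Z - {a}. (t - b) / (a - b))"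

definition mu_int :: "nat \<Rightarrow> (real \<Rightarrow> real) \<Rightarrow> real" where
  "mu_int n f = integral {-1..1} (\<lambda>t. (1 - t^2) powr ((real n - 3) / 2) * f t)
               / integral {-1..1} (\<lambda>t. (1 - t^2) powr ((real n - 3) / 2))"

definition sharp_weight :: "nat \<Rightarrow> nat \<Rightarrow> real \<Rightarrow> real" where
  "sharp_weight n \<tau> a = mu_int n (lagrange_basis (sharp_nodes n \<tau>) a)"

end

theory Submission
  imports Defs
begin

text \<open>
  Averaging over a spherical design reproduces the quadrature formula of the measure
  \<open>(1 - t\<^sup>2) powr ((n - 3) / 2)\<close>. Hence if a point \<open>x\<close> has only \<open>k\<close> inner products with the
  points of \<open>C\<close> (only \<open>k + 1\<close>, one of them \<open>-1\<close>, if \<open>\<tau>\<close> is even), then these are the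
  Gauss (Gauss--Radau) nodes, their frequencies are \<open>N\<close> times the weights, and the Hermite
  interpolant of \<open>h\<close> at the nodes is a minorant of \<open>h\<close> whose sum over \<open>C\<close> does not depend on the
  point of the sphere.

  It remains to find such an \<open>x\<close>. The moments of the design determine the inner products of \<open>C\<close>
  from the parameters. If \<open>\<tau>\<close> is even, the antipode of a code point works. For cross polytopes
  and the codes with 4600, 162 and 100 points, \<open>x\<close> is a shortest characteristic vector of the
  integral lattice spanned by a multiple of \<open>C\<close>. In a suitable multiple of the codes with 112, 891
  and 552 points all inner products are congruent modulo 1 to the norm \<open>s / q\<close> of the points, and
  the combinations with coefficient sum divisible by \<open>q\<close> form an even lattice: if no shortest vector
  of a coset of it had few inner products with \<open>C\<close>, then the norms of these vectors would contradict
  the phase of the Gauss sum in Milgram's formula.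
\<close>

section \<open>Quadratic Gauss sums\<close>

text \<open>Only the parameters of the code are given. No coordinates and no uniqueness theorem
  enter, so the point must be forced by the moments and the Gram matrix alone. A shortest vector
  \<open>x\<close> of a class closed under moves by \<open>b - a\<close> satisfies
  \<open>x \<bullet> a - x \<bullet> b \<le> |a - b|^2 / 2\<close>, which bounds the spread of its
  inner products. Antipodality, or the vanishing of the first and third moments, centres them, so
  that only few extreme values remain, equally many of either sign; the norm equation then excludes
  them, or, for 112 points, restricts the norm. For 112, 891 and 552 points the obstacle is that no
  particular class is visibly good (the shortest vector may even be 0); only the phase of the Gauss
  sum shows that not all classes are bad. The scalings are those that make the Gram matrix integral
  or constant modulo 1. The remaining codes of odd strength need no lattice: a vector orthogonal to
  a 1-design of at most \<open>n\<close> points, a half step away from a vertex of an even polygon,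
  and the sum or difference of two points of the codes with 16 and 56 points.\<close>

definition gauss_sum :: "nat \<Rightarrow> complex" where
  "gauss_sum a = (\<Sum>j<a. cis (pi * real j ^ 2 / real a))"

lemma cis_2pi_int: "cis (2 * pi * of_int k) = 1"
  by (simp add: cis_multiple_2pi)

lemma cis_eq_one_imp_int:
  assumes "cis (2 * pi * x) = 1"
  shows "x \<in> \<int>"
proof -
  have "cos (2 * pi * x) = 1"
    using assms by (metis cis.sel(1) one_complex.sel(1))
  then obtain k :: int where "2 * pi * x = of_int k * 2 * pi"
    by (metis cos_one_2pi_int)
  then have "x = of_int k" by simp
  then show ?thesis by simp
qed

lemma sum_roots_of_unity:
  fixes u t :: nat
  assumes "t > 0"
  shows "(\<Sum>v<t. cis (2 * pi * real u * real v / real t)) = (if t dvd u then of_nat t else 0)"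
proof -
  define z where "z = cis (2 * pi * (real u / real t))"
  have pw: "cis (2 * pi * real u * real v / real t) = z ^ v" for v
  proof -
    have "2 * pi * real u * real v / real t = real v * (2 * pi * (real u / real t))" by simp
    then show ?thesis by (simp only: z_def Complex.DeMoivre)
  qed
  then have eq: "(\<Sum>v<t. cis (2 * pi * real u * real v / real t)) = (\<Sum>v<t. z ^ v)"
    by simp
  show ?thesis
  proof (cases "t dvd u")
    case True
    then obtain k where "u = t * k" by blast
    then have "z = 1"
      using assms cis_2pi_int[of "int k"] by (simp add: z_def)
    with True eq show ?thesis by simp
  next
    case False
    have "z \<noteq> 1"
    proof
      assume "z = 1"
      then have "real u / real t \<in> \<int>"
        unfolding z_def by (rule cis_eq_one_imp_int)
      then obtain k :: int where "real u / real t = of_int k" by (auto elim: Ints_cases)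
      then have "real_of_int (int u) = real_of_int (k * int t)"
        using assms by (simp add: field_simps)
      then have "int u = k * int t" by linarith
      then have "int t dvd int u" by simp
      then show False using False by simp
    qed
    moreover have "z ^ t = 1"
    proof -
      have "2 * pi * real u * real t / real t = 2 * pi * of_int (int u)" using assms by simp
      then show ?thesis using pw[of t] cis_2pi_int[of "int u"] by metis
    qed
    ultimately show ?thesis
      using False eq by (simp add: geometric_sum)
  qed
qed

text \<open>Splitting the index as \<open>v * (t * a) + u\<close> splits the phase into that of
  \<open>u\<close>, the character \<open>2 * pi * u * v / t\<close>, and
  \<open>pi * a * v^2\<close>, a multiple of \<open>2 * pi\<close> because \<open>a\<close> is even.
  Orthogonality of characters leaves \<open>u = w * t\<close>, whose phases are those of
  \<open>gauss_sum a\<close>. So \<open>gauss_sum a / sqrt a\<close> is unchanged when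
  \<open>a\<close> is multiplied by a square.\<close>

lemma gauss_sum_scale:
  fixes a t :: nat
  assumes "even a" "a > 0" "t > 0"
  shows "gauss_sum (t\<^sup>2 * a) = of_nat t * gauss_sum a"
proof -
  let ?f = "\<lambda>j. cis (pi * real j ^ 2 / real (t\<^sup>2 * a))"
  have "gauss_sum (t\<^sup>2 * a) = (\<Sum>j<t * (t * a). ?f j)"
    unfolding gauss_sum_def by (simp add: power2_eq_square mult.assoc)
  also have "\<dots> = (\<Sum>v<t. sum ?f {v * (t * a)..<v * (t * a) + t * a})"
    by (rule sum.nat_group[symmetric])
  also have "\<dots> = (\<Sum>v<t. \<Sum>u<t * a. ?f (v * (t * a) + u))"
  proof (rule sum.cong[OF refl])
    fix v
    show "sum ?f {v * (t * a)..<v * (t * a) + t * a} = (\<Sum>u<t * a. ?f (v * (t * a) + u))"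
      by (rule sum.reindex_bij_witness[of _ "\<lambda>u. v * (t * a) + u" "\<lambda>j. j - v * (t * a)"]) auto
  qed
  also have "\<dots> = (\<Sum>v<t. \<Sum>u<t * a. ?f u * cis (2 * pi * real u * real v / real t))"
  proof (intro sum.cong refl)
    fix v u
    obtain m where m: "a = 2 * m" using assms(1) by blast
    have "pi * real (v * (t * a) + u) ^ 2 / real (t\<^sup>2 * a)
        = pi * real u ^ 2 / real (t\<^sup>2 * a) + 2 * pi * real u * real v / real t + 2 * pi * of_int (int (m * v ^ 2))"
      using assms m by (simp add: field_simps power2_eq_square)
    then show "?f (v * (t * a) + u) = ?f u * cis (2 * pi * real u * real v / real t)"
      using cis_2pi_int[of "int (m * v ^ 2)"] by (simp only: cis_mult[symmetric]) simp
  qed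
  also have "\<dots> = (\<Sum>u<t * a. ?f u * (\<Sum>v<t. cis (2 * pi * real u * real v / real t)))"
    by (subst sum.swap) (simp add: sum_distrib_left)
  also have "\<dots> = (\<Sum>u<a * t. if t dvd u then of_nat t * ?f u else 0)"
  proof (rule sum.cong)
    fix u assume "u \<in> {..<a * t}"
    show "?f u * (\<Sum>v<t. cis (2 * pi * real u * real v / real t)) = (if t dvd u then of_nat t * ?f u else 0)"
      unfolding sum_roots_of_unity[OF assms(3)] by (cases "t dvd u") simp_all
  qed (simp add: mult.commute)
  also have "\<dots> = (\<Sum>w<a. \<Sum>u\<in>{w * t..<w * t + t}. if t dvd u then of_nat t * ?f u else 0)"
    by (rule sum.nat_group[symmetric])
  also have "\<dots> = (\<Sum>w<a. of_nat t * ?f (w * t))"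
  proof (intro sum.cong refl)
    fix w
    have "(\<Sum>u\<in>{w * t..<w * t + t}. if t dvd u then of_nat t * ?f u else 0)
        = (\<Sum>u\<in>{w * t}. if t dvd u then of_nat t * ?f u else 0)"
    proof (rule sum.mono_neutral_right)
      show "\<forall>i\<in>{w * t..<w * t + t} - {w * t}. (if t dvd i then of_nat t * ?f i else 0) = 0"
      proof
        fix i assume i: "i \<in> {w * t..<w * t + t} - {w * t}"
        have "\<not> t dvd i"
        proof
          assume "t dvd i"
          then obtain k where "i = t * k" by blast
          with i have "w * t < k * t" "k * t < Suc w * t" by (auto simp: mult.commute)
          then have "w < k" "k < Suc w" using mult_less_cancel2 by blast+
          then show False by simp
        qed
        then show "(if t dvd i then of_nat t * ?f i else 0) = 0" by simp
      qed
    qed (use assms in auto)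
    then show "(\<Sum>u\<in>{w * t..<w * t + t}. if t dvd u then of_nat t * ?f u else 0) = of_nat t * ?f (w * t)"
      by simp
  qed
  also have "\<dots> = of_nat t * gauss_sum a"
  proof -
    have "pi * real (w * t) ^ 2 / real (t\<^sup>2 * a) = pi * real w ^ 2 / real a" for w
      using assms by (simp add: field_simps power2_eq_square)
    then show ?thesis
      by (simp add: gauss_sum_def sum_distrib_left del: of_nat_mult)
  qed
  finally show ?thesis .
qed

lemma gauss_sum_2: "gauss_sum 2 = 1 + \<i>"
  by (simp add: gauss_sum_def numeral_2_eq_2 cis_pi_half)

text \<open>The reflection \<open>j -> 2 * c - j\<close> changes the phase by a multiple of
  \<open>2 * pi\<close>, so both halves agree up to the terms at \<open>0\<close> and
  \<open>c\<close>. On half the range consecutive phases differ by less than \<open>pi\<close>, as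
  \<open>gauss_sum_tail\<close> requires.\<close>

lemma gauss_sum_half:
  assumes "c > 0"
  shows "norm (gauss_sum (2 * c) - 2 * (\<Sum>j<c. cis (pi * real j ^ 2 / real (2 * c)))) \<le> 2"
proof -
  let ?e = "\<lambda>j. cis (pi * real j ^ 2 / real (2 * c))"
  have "(\<Sum>j\<in>{c..<2 * c}. ?e j) = (\<Sum>j\<in>{1..c}. ?e j)"
  proof (rule sum.reindex_bij_witness[of _ "\<lambda>j. 2 * c - j" "\<lambda>j. 2 * c - j"])
    fix j assume j: "j \<in> {c..<2 * c}"
    then have r: "real (2 * c - j) = 2 * real c - real j" by (simp add: of_nat_diff)
    have "pi * real j ^ 2 / real (2 * c)
        = pi * real (2 * c - j) ^ 2 / real (2 * c) + 2 * pi * of_int (int j - int c)"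
      unfolding r using assms by (simp add: field_simps power2_eq_square)
    then show "?e (2 * c - j) = ?e j"
      using cis_2pi_int[of "int j - int c"] by (simp only: cis_mult[symmetric]) simp
  qed auto
  moreover have "{1..c} = {..<c} - {0} \<union> {c}" using assms by auto
  then have "(\<Sum>j\<in>{1..c}. ?e j) = (\<Sum>j<c. ?e j) - ?e 0 + ?e c"
    using assms by (subst \<open>{1..c} = _\<close>, subst sum.union_disjoint) (auto simp: sum_diff1)
  moreover have "gauss_sum (2 * c) = (\<Sum>j<c. ?e j) + (\<Sum>j\<in>{c..<2 * c}. ?e j)"
    unfolding gauss_sum_def by (subst sum.union_disjoint[symmetric]) (auto intro!: sum.cong)
  ultimately have "gauss_sum (2 * c) - 2 * (\<Sum>j<c. ?e j) = ?e c - ?e 0"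
    by simp
  also have "norm \<dots> \<le> 2"
    using norm_triangle_ineq4[of "?e c" "?e 0"] by simp
  finally show ?thesis .
qed

section \<open>Summation by parts for the tail of a Gauss sum\<close>

definition cot_weight :: "real \<Rightarrow> complex" where
  "cot_weight x = Complex (-1/2) (- cot x / 2)"

text \<open>So \<open>cot_weight x\<close> is the inverse of \<open>cis (2 * x) - 1\<close>. Its
  real part is constant, hence the variation of such weights is that of a cotangent, which is
  monotone.\<close>

lemma cot_weight:
  assumes "sin x \<noteq> 0"
  shows "(cis (2 * x) - 1) * cot_weight x = 1"
proof -
  have "cos x * cos x = 1 - sin x * sin x"
    by (metis add_diff_cancel_right' power2_eq_square sin_cos_squared_add2)
  then have "cos (2 * x) = 1 - 2 * (sin x * sin x)"
    by (simp add: cos_double power2_eq_square)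
  moreover have "cos x * (cos x * sin x) = (1 - sin x * sin x) * sin x"
    using \<open>cos x * cos x = _\<close> by (metis mult.assoc)
  ultimately show ?thesis
    using assms
    by (simp only: cot_weight_def complex_eq_iff cot_def sin_double times_complex.sel minus_complex.sel
        cis.sel one_complex.sel complex.sel) (simp add: field_simps)
qed

lemma cot_decreasing:
  assumes "0 < x" "x \<le> y" "y \<le> pi / 2"
  shows "cot y \<le> cot x"
proof (cases "y = pi / 2")
  case True
  then have "cot y = 0" using cos_pi_half by (simp only: cot_def)
  moreover have "cot x \<ge> 0" using assms by (auto simp: cot_def intro!: divide_nonneg_nonneg cos_ge_zero sin_ge_zero)
  ultimately show ?thesis by simp
next
  case False
  then have "0 < tan x" "tan x \<le> tan y" using assms by (auto simp: tan_gt_zero tan_mono_le)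
  then show ?thesis by (simp add: cot_altdef frac_le inverse_le_iff_le)
qed

lemma cot_le_inverse:
  assumes "0 < x" "x < pi / 2"
  shows "cot x \<le> 1 / x"
proof -
  have "x \<le> tan x" using abs_tan_ge[of x] assms tan_gt_zero[of x] by simp
  then show ?thesis using assms by (simp add: cot_altdef inverse_eq_divide frac_le)
qed

lemma norm_cot_weight_diff: "norm (cot_weight x - cot_weight y) = \<bar>cot x - cot y\<bar> / 2"
proof -
  have "cot_weight x - cot_weight y = Complex 0 ((cot y - cot x) / 2)"
    by (simp add: cot_weight_def complex_eq_iff diff_divide_distrib)
  then show ?thesis
    by (simp add: cmod_def real_sqrt_abs[unfolded power2_eq_square] flip: abs_minus_commute)
qed

lemma norm_cot_weight_le: "cot x \<ge> 0 \<Longrightarrow> norm (cot_weight x) \<le> (1 + cot x) / 2"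
  using cmod_le[of "cot_weight x"] by (simp add: cot_weight_def add_divide_distrib)

text \<open>With \<open>d j\<close> half the phase increment,
  \<open>e (Suc j) = e j * cis (2 * d j)\<close>, so \<open>e j = (e (Suc j) - e j) * w j\<close>
  and the sum can be summed by parts. The variation of \<open>w\<close> telescopes because the
  cotangent decreases, and what is left is governed by the largest weight, the one at
  \<open>J\<close>.\<close>

lemma gauss_sum_tail:
  fixes c J :: nat
  assumes J: "0 < J" "J < c"
  shows "norm (\<Sum>j\<in>{J..<c}. cis (pi * real j ^ 2 / real (2 * c))) \<le> 1 + 2 * c / J"
proof -
  define e where "e j = cis (pi * real j ^ 2 / real (2 * c))" for j
  define d where "d j = pi * (2 * real j + 1) / (4 * real c)" for j
  define w where "w j = cot_weight (d j)" for j
  have d: "0 < d j" "d j < pi / 2" if "j < c" for j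
  proof -
    have "real (2 * j + 1) < real (2 * c)" using that by linarith
    then have "pi * (2 * real j + 1) < pi * (2 * real c)" by (intro mult_strict_left_mono) auto
    then show "d j < pi / 2" using that by (simp add: d_def field_simps)
    show "0 < d j" using that by (auto simp: d_def intro!: mult_pos_pos divide_pos_pos)
  qed
  have d_mono: "d i \<le> d j" if "i \<le> j" for i j
    using that J pi_gt_zero by (auto simp: d_def field_simps)
  have cotpos: "0 \<le> cot (d j)" if "j < c" for j
    using d[OF that] by (auto simp: cot_def intro!: divide_nonneg_nonneg cos_ge_zero sin_ge_zero)
  have step: "(e (Suc j) - e j) * w j = e j" if "j < c" for j
  proof -
    have "pi * real (Suc j) ^ 2 / real (2 * c) = pi * real j ^ 2 / real (2 * c) + 2 * d j"
      using J by (simp add: d_def field_simps power2_eq_square)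
    then have "e (Suc j) = e j * cis (2 * d j)"
      unfolding e_def by (simp only: cis_mult[symmetric])
    then have "(e (Suc j) - e j) * w j = e j * ((cis (2 * d j) - 1) * w j)" by (simp only:) (simp add: algebra_simps)
    moreover have "sin (d j) \<noteq> 0" using d[OF that] sin_gt_zero[of "d j"] by auto
    then have "(cis (2 * d j) - 1) * w j = 1" unfolding w_def by (rule cot_weight)
    ultimately show ?thesis by simp
  qed
  \<comment> \<open>Once the two boundary terms are removed, only the variation of \<open>w\<close>
    between \<open>J\<close> and \<open>m - 1\<close> remains.\<close>
  have main: "norm ((\<Sum>j\<in>{J..<m}. e j) - e m * w (m - 1) + e J * w J) \<le> (cot (d J) - cot (d (m - 1))) / 2"
    if "J < m" "m \<le> c" for m
    using that
  proof (induction m)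
    case (Suc m)
    show ?case
    proof (cases "m = J")
      case True
      then show ?thesis using step[of J] J by (simp add: algebra_simps)
    next
      case False
      with Suc have m: "J < m" "m < c" by auto
      have "(\<Sum>j\<in>{J..<Suc m}. e j) - e (Suc m) * w (Suc m - 1) + e J * w J
         = ((\<Sum>j\<in>{J..<m}. e j) - e m * w (m - 1) + e J * w J) + e m * (w (m - 1) - w m)"
        using m step[of m] by (simp add: algebra_simps)
      also have "norm \<dots> \<le> (cot (d J) - cot (d (m - 1))) / 2 + norm (e m * (w (m - 1) - w m))"
        using Suc.IH m by (intro norm_triangle_le) auto
      also have "norm (e m * (w (m - 1) - w m)) = (cot (d (m - 1)) - cot (d m)) / 2"
        using cot_decreasing[of "d (m - 1)" "d m"] d[of m] d[of "m - 1"] d_mono[of "m - 1" m] m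
        by (simp add: norm_mult w_def norm_cot_weight_diff e_def)
      finally show ?thesis by (simp add: field_simps)
    qed
  qed simp
  have J': "J < c" "J \<le> c - 1" "c - 1 < c" using J by auto
  have dec: "cot (d (c - 1)) \<le> cot (d J)"
    using cot_decreasing d_mono d J' by (meson less_eq_real_def)
  have ne: "norm (e j) = 1" for j by (simp add: e_def)
  have eq: "(\<Sum>j\<in>{J..<c}. e j) = ((\<Sum>j\<in>{J..<c}. e j) - e c * w (c - 1) + e J * w J) + (e c * w (c - 1) - e J * w J)"
    by simp
  have "norm (\<Sum>j\<in>{J..<c}. e j) \<le> (cot (d J) - cot (d (c - 1))) / 2 + norm (e c * w (c - 1) - e J * w J)"
    by (subst eq, rule norm_triangle_le, use main[of c] J in auto)
  also have "norm (e c * w (c - 1) - e J * w J) \<le> norm (w (c - 1)) + norm (w J)"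
    using norm_triangle_ineq4[of "e c * w (c - 1)" "e J * w J"] by (simp add: norm_mult ne)
  also have "\<dots> \<le> (1 + cot (d (c - 1))) / 2 + (1 + cot (d J)) / 2"
    unfolding w_def using J' by (intro add_mono norm_cot_weight_le cotpos) auto
  also have "(cot (d J) - cot (d (c - 1))) / 2 + ((1 + cot (d (c - 1))) / 2 + (1 + cot (d J)) / 2) = 1 + cot (d J)"
    by (simp add: field_simps)
  also have "cot (d J) \<le> 1 / d J" using d J' by (intro cot_le_inverse) auto
  also have "1 / d J \<le> 2 * c / J"
  proof -
    have "2 * real J \<le> pi * (2 * real J + 1)"
      using pi_gt3 by (smt (verit) mult_le_cancel_right1 mult_nonneg_nonneg of_nat_0_le_iff)
    then have "4 * real c * real J \<le> 2 * real c * (pi * (2 * real J + 1))"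
      using mult_left_mono[of "2 * real J" "pi * (2 * real J + 1)" "2 * real c"] by (simp add: mult_ac)
    moreover have "pi * (2 * real J + 1) > 0" by (intro mult_pos_pos) auto
    ultimately show ?thesis using J by (simp add: d_def divide_simps mult_ac)
  qed
  finally show ?thesis by (simp add: e_def)
qed

section \<open>Comparison of normalised Gauss sums with the Fresnel integral\<close>

definition chirp :: "real \<Rightarrow> complex" where
  "chirp u = cis (pi * u\<^sup>2)"

lemma norm_cis_diff_le: "norm (cis x - cis y) \<le> \<bar>x - y\<bar>"
proof -
  have "(norm (cis x - cis y))\<^sup>2 = (2 * sin ((x - y) / 2))\<^sup>2"
  proof -
    have "cos x * cos y + sin x * sin y = 1 - 2 * (sin ((x - y) / 2))\<^sup>2"
      using cos_diff[of x y] cos_double_sin[of "(x - y) / 2"] by (simp only: times_divide_eq_right nonzero_mult_div_cancel_left)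
    moreover have "(cos x - cos y)\<^sup>2 + (sin x - sin y)\<^sup>2
        = ((sin x)\<^sup>2 + (cos x)\<^sup>2) + ((sin y)\<^sup>2 + (cos y)\<^sup>2) - 2 * (cos x * cos y + sin x * sin y)"
      by (simp only: power2_eq_square left_diff_distrib right_diff_distrib) simp
    ultimately have "(cos x - cos y)\<^sup>2 + (sin x - sin y)\<^sup>2 = (2 * sin ((x - y) / 2))\<^sup>2"
      by (simp only: sin_cos_squared_add power_mult_distrib) simp
    then show ?thesis by (simp add: cmod_power2)
  qed
  then have "norm (cis x - cis y) = \<bar>2 * sin ((x - y) / 2)\<bar>"
    by (metis abs_norm_cancel real_sqrt_abs)
  also have "\<dots> \<le> \<bar>x - y\<bar>"
    using abs_sin_x_le_abs_x[of "(x - y) / 2"] by (simp add: abs_mult)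
  finally show ?thesis .
qed

lemma continuous_on_chirp: "continuous_on S chirp"
  unfolding chirp_def by (intro continuous_intros)

lemma chirp_lipschitz:
  assumes "0 \<le> u" "u \<le> K" "0 \<le> v" "v \<le> K"
  shows "norm (chirp u - chirp v) \<le> 2 * pi * K * \<bar>u - v\<bar>"
proof -
  have "norm (chirp u - chirp v) \<le> \<bar>pi * u\<^sup>2 - pi * v\<^sup>2\<bar>"
    unfolding chirp_def by (rule norm_cis_diff_le)
  also have "\<dots> = pi * ((u + v) * \<bar>u - v\<bar>)"
  proof -
    have "pi * u\<^sup>2 - pi * v\<^sup>2 = pi * ((u + v) * (u - v))" by (simp add: algebra_simps power2_eq_square)
    then show ?thesis using assms by (simp add: abs_mult)
  qed
  also have "\<dots> \<le> pi * ((2 * K) * \<bar>u - v\<bar>)"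
    using assms by (intro mult_left_mono mult_right_mono) auto
  finally show ?thesis by simp
qed

text \<open>On a cell of length \<open>h\<close> the chirp deviates from its left value by at most
  the Lipschitz constant \<open>2 * pi * K\<close> times \<open>h\<close>; integration adds one more
  factor \<open>h\<close> per cell.\<close>

lemma chirp_riemann:
  fixes J :: nat
  assumes "h > 0" "real J * h \<le> K"
  shows "norm (h *\<^sub>R (\<Sum>j<J. chirp (real j * h)) - integral {0..real J * h} chirp) \<le> real J * (2 * pi * K * h\<^sup>2)"
  using assms(2)
proof (induction J)
  case (Suc J)
  let ?a = "real J * h" and ?b = "real (Suc J) * h"
  have K: "?a \<le> ?b" "?b \<le> K" "0 \<le> ?a" "?b - ?a = h" using Suc.prems assms(1) by (auto simp: algebra_simps)
  have int: "chirp integrable_on {x..y}" for x y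
    by (intro integrable_continuous_real continuous_on_chirp)
  have split: "integral {0..?b} chirp = integral {0..?a} chirp + integral {?a..?b} chirp"
    using K by (intro Henstock_Kurzweil_Integration.integral_combine[symmetric] int) auto
  have "norm (integral {?a..?b} (\<lambda>u. chirp ?a - chirp u)) \<le> (2 * pi * K * h) * (?b - ?a)"
  proof (rule integral_bound)
    fix t assume t: "t \<in> {?a..?b}"
    have "0 \<le> ?a" using assms(1) by simp
    then have t0: "0 \<le> t" using t unfolding atLeastAtMost_iff by (blast intro: order_trans)
    have "norm (chirp ?a - chirp t) \<le> 2 * pi * K * \<bar>?a - t\<bar>"
      by (rule chirp_lipschitz[OF _ _ t0]) (use assms(1) t K in \<open>auto simp del: of_nat_Suc\<close>)
    also have "\<dots> \<le> 2 * pi * K * h"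
    proof (rule mult_left_mono)
      have "0 \<le> K" using t0 t K(2) unfolding atLeastAtMost_iff by linarith
      then show "0 \<le> 2 * pi * K" by simp
    qed (use t K in auto)
    finally show "norm (chirp ?a - chirp t) \<le> 2 * pi * K * h" .
  qed (use K in \<open>auto intro!: continuous_intros continuous_on_chirp\<close>)
  moreover have "integral {?a..?b} (\<lambda>u. chirp ?a - chirp u) = h *\<^sub>R chirp ?a - integral {?a..?b} chirp"
    using K by (subst Henstock_Kurzweil_Integration.integral_diff) (auto intro!: int)
  ultimately have 1: "norm (h *\<^sub>R chirp ?a - integral {?a..?b} chirp) \<le> 2 * pi * K * h\<^sup>2"
    using K by (simp add: power2_eq_square)
  have "h *\<^sub>R (\<Sum>j<Suc J. chirp (real j * h)) - integral {0..?b} chirp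
     = (h *\<^sub>R (\<Sum>j<J. chirp (real j * h)) - integral {0..?a} chirp) + (h *\<^sub>R chirp ?a - integral {?a..?b} chirp)"
    unfolding split by (simp add: scaleR_add_right)
  also have "norm \<dots> \<le> real J * (2 * pi * K * h\<^sup>2) + 2 * pi * K * h\<^sup>2"
    using Suc K by (intro norm_triangle_mono 1) auto
  finally show ?case by (simp add: algebra_simps)
qed simp

text \<open>By \<open>gauss_sum_scale\<close>, \<open>a\<close> may be replaced by
  \<open>b = t^2 * a\<close> with \<open>t\<close> arbitrarily large. In half of that sum the terms
  with \<open>j < J\<close>, \<open>J\<close> about \<open>K / h\<close>, form a Riemann sum over
  \<open>{0..K}\<close>, and the others are controlled by \<open>gauss_sum_tail\<close>. As
  \<open>t\<close> grows every error dies out except the contribution \<open>4 / K\<close> of the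
  tail.\<close>

lemma gauss_sum_chirp:
  fixes a :: nat
  assumes "even a" "a > 0" "K \<ge> (1::real)"
  shows "norm (gauss_sum a /\<^sub>R sqrt a - 2 *\<^sub>R integral {0..K} chirp) \<le> 4 / K"
proof -
  define X where "X = norm (gauss_sum a /\<^sub>R sqrt a - 2 *\<^sub>R integral {0..K} chirp)"
  \<comment> \<open>Collects the errors of order \<open>1 / t\<close>: halving the sum, the constant
    term of the tail bound and rounding \<open>K / h\<close> give 6, the Riemann sum gives
    \<open>4 * pi * K * K\<close>.\<close>
  define D where "D = (6 + 4 * pi * K * K) / sqrt a"
  have bound: "X \<le> D / real t + 4 / K" if t: "real t \<ge> 2 * K" for t :: nat
  proof -
    from that assms have t0: "t > 0" by (cases t) auto
    obtain c0 where c0: "a = 2 * c0" using assms(1) by blast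
    define b where "b = t\<^sup>2 * a"
    define c where "c = t\<^sup>2 * c0"
    have bc: "b = 2 * c" by (simp add: b_def c_def c0)
    \<comment> \<open>The step size for which \<open>pi * j^2 / b\<close> becomes
      \<open>pi * (j * h)^2\<close>.\<close>
    define h where "h = 1 / (real t * sqrt a)"
    have sa: "sqrt a \<ge> 1" using assms by simp
    have h: "h > 0" using t0 assms by (simp add: h_def)
    have hb: "real b * h\<^sup>2 = 1" using t0 assms by (simp add: h_def b_def field_simps)
    have hK: "h * (2 * K) \<le> 1"
    proof -
      have "2 * K \<le> real t * sqrt a" using t sa assms by (smt (verit) mult_left_le mult_le_cancel_left1)
      then show ?thesis using t0 assms by (simp add: h_def field_simps)
    qed
    define J where "J = nat \<lfloor>K / h\<rfloor>"
    have Kh: "K / h \<ge> 2 * K * K" 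
      using hK h assms by (simp add: field_simps)
    have KK: "K * K \<ge> 1" using assms by (simp add: mult_ge1_I)
    have J1: "real J \<le> K / h" "K / h < real J + 1" using h assms by (auto simp: J_def)
    have J2: "real J \<ge> K / (2 * h)" using J1 Kh KK by (simp add: field_simps)
    have Jpos: "J > 0" using J1 Kh KK by (cases J) auto
    have "2 * real J \<le> real b"
    proof -
      have "2 * real J \<le> 2 * (K / h)" using J1 by simp
      also have "\<dots> = (h * (2 * K)) * (1 / h\<^sup>2)" using h by (simp add: power2_eq_square)
      also have "\<dots> \<le> 1 * (1 / h\<^sup>2)" using hK by (intro mult_right_mono) auto
      also have "\<dots> = real b" using hb h by (simp add: field_simps)
      finally show ?thesis .
    qed
    then have Jc: "J \<le> c" by (simp add: bc)
    let ?e = "\<lambda>j. cis (pi * real j ^ 2 / real (2 * c))"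
    have e: "?e j = chirp (real j * h)" for j
    proof -
      have "real (2 * c) = 1 / h\<^sup>2" using hb h by (simp add: bc field_simps)
      then show ?thesis by (simp add: chirp_def power_mult_distrib mult_ac)
    qed
    have "c > 0" using Jc Jpos by linarith
    have tail: "norm (\<Sum>j\<in>{J..<c}. ?e j) \<le> 1 + 2 * c / J"
    proof (cases "J = c")
      case False
      then show ?thesis using gauss_sum_tail[of J c] Jpos Jc by simp
    qed simp
    have sp: "(\<Sum>j<c. ?e j) = (\<Sum>j<J. ?e j) + (\<Sum>j\<in>{J..<c}. ?e j)"
      using Jc by (subst sum.union_disjoint[symmetric]) (auto intro!: sum.cong)
    have g: "gauss_sum a /\<^sub>R sqrt a = h *\<^sub>R gauss_sum b"
      using gauss_sum_scale[of a t] assms t0 by (simp add: b_def h_def scaleR_conv_of_real field_simps)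
    have int: "chirp integrable_on {x..y}" for x y
      by (intro integrable_continuous_real continuous_on_chirp)
    have Jh: "real J * h \<le> K" "K \<le> real J * h + h" using J1 h by (auto simp: field_simps)
    have "gauss_sum a /\<^sub>R sqrt a - 2 *\<^sub>R integral {0..K} chirp
      = h *\<^sub>R (gauss_sum (2 * c) - 2 * (\<Sum>j<c. ?e j)) + (2 * h) *\<^sub>R (\<Sum>j\<in>{J..<c}. ?e j)
      + 2 *\<^sub>R (h *\<^sub>R (\<Sum>j<J. chirp (real j * h)) - integral {0..real J * h} chirp)
      - 2 *\<^sub>R integral {real J * h..K} chirp"
    proof -
      have "integral {0..K} chirp = integral {0..real J * h} chirp + integral {real J * h..K} chirp"
        using Jh h by (intro Henstock_Kurzweil_Integration.integral_combine[symmetric] int) auto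
      moreover have "(\<Sum>j<c. ?e j) = (\<Sum>j<J. chirp (real j * h)) + (\<Sum>j\<in>{J..<c}. ?e j)"
        using sp e by simp
      ultimately show ?thesis unfolding g bc
        by (simp only: scaleR_conv_of_real) (simp add: algebra_simps del: sum_distrib_left)
    qed
    also have "norm \<dots> \<le> h * 2 + (2 * h) * (1 + 2 * c / J) + 2 * (real J * (2 * pi * K * h\<^sup>2)) + 2 * h"
    proof (intro order_trans[OF norm_triangle_ineq4] add_mono order_trans[OF norm_triangle_ineq])
      show "norm (h *\<^sub>R (gauss_sum (2 * c) - 2 * (\<Sum>j<c. ?e j))) \<le> h * 2"
        using gauss_sum_half[OF \<open>c > 0\<close>] h by simp
      show "norm ((2 * h) *\<^sub>R (\<Sum>j\<in>{J..<c}. ?e j)) \<le> (2 * h) * (1 + 2 * c / J)"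
        using tail h by simp
      show "norm (2 *\<^sub>R (h *\<^sub>R (\<Sum>j<J. chirp (real j * h)) - integral {0..real J * h} chirp))
          \<le> 2 * (real J * (2 * pi * K * h\<^sup>2))"
        unfolding norm_scaleR using chirp_riemann[OF h Jh(1)] by (intro mult_mono) auto
      have "norm (integral {real J * h..K} chirp) \<le> 1 * (K - real J * h)"
        using Jh by (intro integral_bound continuous_on_chirp) (auto simp: chirp_def)
      then show "norm (2 *\<^sub>R integral {real J * h..K} chirp) \<le> 2 * h"
        using Jh by simp
    qed
    also have "\<dots> = 6 * h + 2 * (real b * h / J) + 4 * pi * K * h * (real J * h)"
      by (simp add: bc field_simps power2_eq_square)
    also have "\<dots> \<le> 6 * h + 2 * (2 / K) + 4 * pi * K * h * K"
    proof (intro add_mono mult_left_mono order_refl)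
      have "real b * h / J \<le> real b * h / (K / (2 * h))"
        using J2 Jpos h assms by (intro divide_left_mono) auto
      also have "\<dots> = 2 * (real b * h\<^sup>2) / K" using h assms by (simp add: field_simps power2_eq_square)
      finally show "real b * h / J \<le> 2 / K" using hb by simp
    qed (use Jh h assms in auto)
    also have "\<dots> = D / real t + 4 / K"
      using t0 assms by (simp add: D_def h_def field_simps)
    finally show ?thesis by (simp add: X_def)
  qed
  have "(\<lambda>t. D / real t + 4 / K) \<longlonglongrightarrow> 0 + 4 / K"
    by (intro tendsto_intros lim_const_over_n)
  moreover have "\<exists>N. \<forall>t\<ge>N. X \<le> D / real t + 4 / K"
    using bound by (metis (no_types, lifting) of_nat_mono order_trans real_arch_simple)
  ultimately have "X \<le> 0 + 4 / K" by (rule LIMSEQ_le_const)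
  then show ?thesis by (simp add: X_def)
qed

text \<open>All normalised sums lie within \<open>4 / K\<close> of twice the same integral over
  \<open>{0..K}\<close>, so they are equal, and the case \<open>a = 2\<close> supplies the value.
  The Fresnel integral itself is never evaluated.\<close>

theorem gauss_sum_even:
  assumes "even a" "a > 0"
  shows "gauss_sum a = sqrt a *\<^sub>R cis (pi / 4)"
proof -
  define Y where "Y = norm (gauss_sum a /\<^sub>R sqrt a - gauss_sum 2 /\<^sub>R sqrt 2)"
  have "Y \<le> 8 / real (Suc n)" for n
  proof -
    let ?I = "2 *\<^sub>R integral {0..real (Suc n)} chirp"
    have "Y = norm ((gauss_sum a /\<^sub>R sqrt a - ?I) - (gauss_sum 2 /\<^sub>R sqrt 2 - ?I))"
      by (simp add: Y_def)
    also have "\<dots> \<le> 4 / real (Suc n) + 4 / real (Suc n)"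
      using gauss_sum_chirp[of a "real (Suc n)"] gauss_sum_chirp[of 2 "real (Suc n)"] assms
      by (intro order_trans[OF norm_triangle_ineq4 add_mono]) auto
    finally show ?thesis by simp
  qed
  moreover have "(\<lambda>n. 8 / real (Suc n)) \<longlonglongrightarrow> 0"
    using LIMSEQ_Suc[OF lim_const_over_n] by blast
  ultimately have "Y \<le> 0" by (meson LIMSEQ_le_const)
  then have "gauss_sum a /\<^sub>R sqrt a = gauss_sum 2 /\<^sub>R sqrt 2" by (simp add: Y_def)
  also have "\<dots> = cis (pi / 4)"
    by (simp add: gauss_sum_2 complex_eq_iff cos_45 sin_45 real_div_sqrt field_simps)
  finally show ?thesis using assms by (metis divideR_right of_nat_0_less_iff real_sqrt_gt_zero less_numeral_extra(3))
qed

section \<open>Milgram's formula for even lattices\<close>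

text \<open>A subgroup with even integral norms. Discreteness is implied: distinct elements differ
  by a vector of squared length at least 2.\<close>

definition even_lattice :: "'a::euclidean_space set \<Rightarrow> bool" where
  "even_lattice P \<longleftrightarrow> 0 \<in> P \<and> (\<forall>x\<in>P. \<forall>y\<in>P. x - y \<in> P) \<and> (\<forall>x\<in>P. x \<bullet> x / 2 \<in> \<int>)"

definition dual_lattice :: "'a::euclidean_space set \<Rightarrow> 'a set" where
  "dual_lattice P = {x. \<forall>m\<in>P. x \<bullet> m \<in> \<int>}"

lemma even_latticeD:
  assumes "even_lattice P"
  shows "0 \<in> P" "x \<in> P \<Longrightarrow> y \<in> P \<Longrightarrow> x - y \<in> P" "x \<in> P \<Longrightarrow> x \<bullet> x / 2 \<in> \<int>"
  using assms by (auto simp: even_lattice_def)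

lemma even_lattice_minus: "even_lattice P \<Longrightarrow> x \<in> P \<Longrightarrow> - x \<in> P"
  using even_latticeD(1) even_latticeD(2)[of P 0 x] by auto

lemma even_lattice_add: "even_lattice P \<Longrightarrow> x \<in> P \<Longrightarrow> y \<in> P \<Longrightarrow> x + y \<in> P"
  using even_latticeD(2)[of P x "- y"] even_lattice_minus[of P y] by auto

lemma even_lattice_scale_nat: "even_lattice P \<Longrightarrow> x \<in> P \<Longrightarrow> of_nat k *\<^sub>R x \<in> P"
  by (induction k) (auto simp: even_latticeD(1) even_lattice_add algebra_simps)

lemma even_lattice_scale: "even_lattice P \<Longrightarrow> x \<in> P \<Longrightarrow> of_int k *\<^sub>R x \<in> P"
  using even_lattice_scale_nat[of P x "nat k"] even_lattice_minus[of P "of_nat (nat (- k)) *\<^sub>R x"]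
    even_lattice_scale_nat[of P x "nat (- k)"]
  by (cases "k \<ge> 0") auto

lemma even_lattice_sum: "even_lattice P \<Longrightarrow> (\<And>i. i \<in> I \<Longrightarrow> f i \<in> P) \<Longrightarrow> sum f I \<in> P"
  by (induction I rule: infinite_finite_induct) (auto simp: even_latticeD(1) even_lattice_add)

lemma even_lattice_inner:
  assumes "even_lattice P" "x \<in> P" "y \<in> P"
  shows "x \<bullet> y \<in> \<int>"
proof -
  have "(x + y) \<bullet> (x + y) / 2 - x \<bullet> x / 2 - y \<bullet> y / 2 \<in> \<int>"
    using assms even_lattice_add even_latticeD(3) by (intro Ints_diff) blast+
  moreover have "(x + y) \<bullet> (x + y) / 2 - x \<bullet> x / 2 - y \<bullet> y / 2 = x \<bullet> y"
    by (simp add: inner_add_left inner_add_right inner_commute field_simps)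
  ultimately show ?thesis by simp
qed

lemma even_lattice_subset_dual: "even_lattice P \<Longrightarrow> P \<subseteq> dual_lattice P"
  using even_lattice_inner by (auto simp: dual_lattice_def)

lemma dual_lattice_add: "x \<in> dual_lattice P \<Longrightarrow> y \<in> dual_lattice P \<Longrightarrow> x + y \<in> dual_lattice P"
  by (auto simp: dual_lattice_def inner_add_left)

lemma dual_lattice_diff: "x \<in> dual_lattice P \<Longrightarrow> y \<in> dual_lattice P \<Longrightarrow> x - y \<in> dual_lattice P"
  by (auto simp: dual_lattice_def inner_diff_left)

text \<open>A maximal orthogonal set of nonzero elements of \<open>P\<close> spans. Otherwise the
  Gram--Schmidt remainder of some element, with denominators cleared by the product \<open>q\<close>
  of the norms, would be a further element of \<open>P\<close>. The result is a sublattice over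
  which Gauss sums factor.\<close>

lemma even_lattice_orthogonal_basis:
  fixes P :: "'a::euclidean_space set"
  assumes P: "even_lattice P" and span: "span P = UNIV"
  obtains O' where "O' \<subseteq> P" "finite O'" "pairwise orthogonal O'" "0 \<notin> O'" "span O' = UNIV" "card O' = DIM('a)"
proof -
  define Q where "Q k \<longleftrightarrow> (\<exists>O'. O' \<subseteq> P \<and> finite O' \<and> pairwise orthogonal O' \<and> 0 \<notin> O' \<and> card O' = k)" for k
  have "Q 0" unfolding Q_def by (rule exI[of _ "{}"]) auto
  moreover have bound: "k \<le> DIM('a)" if "Q k" for k
    using that pairwise_orthogonal_independent independent_bound unfolding Q_def by metis
  ultimately obtain k where k: "Q k" "\<And>l. Q l \<Longrightarrow> l \<le> k"
    using Greatest_le_nat[of Q] GreatestI_nat[of Q 0 "DIM('a)"] by blast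
  then obtain O' where O': "O' \<subseteq> P" "finite O'" "pairwise orthogonal O'" "0 \<notin> O'" "card O' = k"
    unfolding Q_def by blast
  have "P \<subseteq> span O'"
  proof
    fix p assume p: "p \<in> P"
    show "p \<in> span O'"
    proof (rule ccontr)
      assume np: "p \<notin> span O'"
      define q where "q = (\<Prod>w\<in>O'. w \<bullet> w)"
      define p' where "p' = q *\<^sub>R p - (\<Sum>w\<in>O'. (q * (p \<bullet> w) / (w \<bullet> w)) *\<^sub>R w)"
      have ww: "w \<bullet> w \<in> \<int>" "w \<bullet> w \<noteq> 0" "p \<bullet> w \<in> \<int>" if "w \<in> O'" for w
        using that O' P p even_lattice_inner by (auto simp: subset_iff)
      have "q \<in> \<int>" unfolding q_def using ww by (intro Ints_prod) auto
      have "q \<noteq> 0" unfolding q_def using ww O' by auto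
      have in': "(q * (p \<bullet> w) / (w \<bullet> w)) *\<^sub>R w \<in> P" if w: "w \<in> O'" for w
      proof -
        have "q = (w \<bullet> w) * (\<Prod>w\<in>O' - {w}. w \<bullet> w)"
          unfolding q_def using O' w by (simp add: prod.remove)
        then have "q * (p \<bullet> w) / (w \<bullet> w) = (\<Prod>w\<in>O' - {w}. w \<bullet> w) * (p \<bullet> w)"
          using ww[OF w] by simp
        also have "\<dots> \<in> \<int>" using ww w by (intro Ints_mult Ints_prod) auto
        finally obtain z where "q * (p \<bullet> w) / (w \<bullet> w) = of_int z" by (auto elim: Ints_cases)
        then show ?thesis using w O' even_lattice_scale[OF P, of w z] by auto
      qed
      have "q *\<^sub>R p \<in> P"
        using \<open>q \<in> \<int>\<close> even_lattice_scale[OF P p] by (auto elim!: Ints_cases)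
      then have p'P: "p' \<in> P" unfolding p'_def
        by (intro even_latticeD(2)[OF P] even_lattice_sum[OF P] in')
      have orth: "p' \<bullet> w = 0" if w: "w \<in> O'" for w
      proof -
        have "(\<Sum>v\<in>O'. (q * (p \<bullet> v) / (v \<bullet> v)) *\<^sub>R v) \<bullet> w = (\<Sum>v\<in>O'. if v = w then q * (p \<bullet> w) else 0)"
          unfolding inner_sum_left using O'(3) w ww[OF w]
          by (intro sum.cong) (auto simp: pairwise_def orthogonal_def)
        then show ?thesis using O'(2) w by (simp add: p'_def inner_diff_left)
      qed
      have "p' \<noteq> 0"
      proof
        assume "p' = 0"
        then have "q *\<^sub>R p = (\<Sum>w\<in>O'. (q * (p \<bullet> w) / (w \<bullet> w)) *\<^sub>R w)" by (simp add: p'_def)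
        also have "\<dots> \<in> span O'" by (intro span_sum span_scale span_base)
        finally have "q *\<^sub>R p \<in> span O'" .
        then have "(1 / q) *\<^sub>R (q *\<^sub>R p) \<in> span O'" by (rule span_scale)
        then show False using np \<open>q \<noteq> 0\<close> by simp
      qed
      have "p' \<notin> O'" using orth \<open>p' \<noteq> 0\<close> by force
      have "Q (Suc k)" unfolding Q_def
        using O' p'P orth \<open>p' \<noteq> 0\<close> \<open>p' \<notin> O'\<close>
        by (intro exI[of _ "insert p' O'"]) (auto simp: pairwise_insert orthogonal_def inner_commute)
      with k(2) show False by force
    qed
  qed
  then have "span O' = UNIV" using span span_mono[of P "span O'"] by (simp add: span_span) blast
  moreover have "independent O'" using O' pairwise_orthogonal_independent by blast
  ultimately have "card O' = DIM('a)" using dim_span_eq_card_independent[of O'] by simp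
  with O' \<open>span O' = UNIV\<close> that show thesis by blast
qed

section \<open>Gauss sums of lattices with an orthogonal basis\<close>

lemma cis_sum: "finite I \<Longrightarrow> cis (\<Sum>i\<in>I. f i) = (\<Prod>i\<in>I. cis (f i))"
  by (induction I rule: finite_induct) (auto simp flip: cis_mult)

lemma cis_int_shift: "k \<in> \<int> \<Longrightarrow> cis (x + 2 * pi * k) = cis x"
  by (auto elim!: Ints_cases simp: cis_2pi_int simp flip: cis_mult)

text \<open>\<open>D\<close> is the lattice with basis \<open>W\<close> and \<open>E\<close> is its
  dual; \<open>box\<close> represents \<open>E\<close> modulo \<open>D\<close>, and
  \<open>red\<close> sends a point of \<open>E\<close> to its representative. The coordinates
  \<open>x \<bullet> w\<close> identify \<open>box\<close> with the product of the ranges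
  \<open>{..<a w}\<close>, with inverse \<open>pt\<close>.\<close>

locale orthogonal_lattice =
  fixes W :: "'a::euclidean_space set"
  assumes fin: "finite W" and orth: "pairwise orthogonal W" and nz: "0 \<notin> W"
    and full: "span W = UNIV" and int: "\<And>w. w \<in> W \<Longrightarrow> w \<bullet> w / 2 \<in> \<int>"
begin

definition D where "D = {d. \<exists>k::'a \<Rightarrow> int. d = (\<Sum>w\<in>W. of_int (k w) *\<^sub>R w)}"
definition E where "E = {x. \<forall>w\<in>W. x \<bullet> w \<in> \<int>}"
definition box where "box = {x\<in>E. \<forall>w\<in>W. 0 \<le> x \<bullet> w \<and> x \<bullet> w < w \<bullet> w}"
definition red where "red x = x - (\<Sum>w\<in>W. of_int \<lfloor>x \<bullet> w / (w \<bullet> w)\<rfloor> *\<^sub>R w)"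
definition a where "a w = nat \<lfloor>w \<bullet> w\<rfloor>"
definition pt where "pt j = (\<Sum>w\<in>W. (real (j w) / (w \<bullet> w)) *\<^sub>R w)"

lemma wpos: "w \<in> W \<Longrightarrow> w \<bullet> w > 0"
  using nz by auto

lemma inner_W:
  assumes "w \<in> W"
  shows "(\<Sum>v\<in>W. f v *\<^sub>R v) \<bullet> w = f w * (w \<bullet> w)"
proof -
  have "(\<Sum>v\<in>W. f v *\<^sub>R v) \<bullet> w = (\<Sum>v\<in>W. if v = w then f w * (w \<bullet> w) else 0)"
    unfolding inner_sum_left using orth assms
    by (intro sum.cong) (auto simp: pairwise_def orthogonal_def)
  then show ?thesis using fin assms by simp
qed

lemma eqI:
  assumes "\<And>w. w \<in> W \<Longrightarrow> x \<bullet> w = y \<bullet> w"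
  shows "x = y"
proof -
  have "\<forall>w\<in>W. orthogonal (x - y) w" using assms by (simp add: orthogonal_def inner_diff_left)
  then have "orthogonal (x - y) (x - y)"
    using orthogonal_to_span[of "x - y" W "x - y"] full by auto
  then show ?thesis by (simp add: orthogonal_def)
qed

lemma a: "w \<in> W \<Longrightarrow> real (a w) = w \<bullet> w" "w \<in> W \<Longrightarrow> even (a w)" "w \<in> W \<Longrightarrow> a w > 0"
proof -
  assume w: "w \<in> W"
  then obtain k where k: "w \<bullet> w / 2 = of_int k" using int by (metis Ints_cases)
  then have ww: "w \<bullet> w = of_int (2 * k)" by simp
  then have "k > 0" using wpos[OF w] by simp
  moreover have "a w = nat (2 * k)" unfolding a_def ww by (simp only: floor_of_int)
  ultimately show "real (a w) = w \<bullet> w" "even (a w)" "a w > 0"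
    unfolding ww by (auto simp: even_nat_iff)
qed

lemma pt_inner: "w \<in> W \<Longrightarrow> pt j \<bullet> w = real (j w)"
  unfolding pt_def using wpos by (simp add: inner_W)

lemma pt_bij: "bij_betw pt (PiE W (\<lambda>w. {..<a w})) box"
proof (rule bij_betwI[where g = "\<lambda>x. restrict (\<lambda>w. nat \<lfloor>x \<bullet> w\<rfloor>) W"])
  show "pt \<in> (PiE W (\<lambda>w. {..<a w})) \<rightarrow> box"
  proof
    fix j assume j: "j \<in> PiE W (\<lambda>w. {..<a w})"
    have "real (j w) < w \<bullet> w" if "w \<in> W" for w
      using j that a(1)[OF that, symmetric] by (simp add: PiE_iff)
    then show "pt j \<in> box" by (auto simp: box_def E_def pt_inner)
  qed
  show "(\<lambda>x. restrict (\<lambda>w. nat \<lfloor>x \<bullet> w\<rfloor>) W) \<in> box \<rightarrow> (PiE W (\<lambda>w. {..<a w}))"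
  proof
    fix x assume x: "x \<in> box"
    have "nat \<lfloor>x \<bullet> w\<rfloor> < a w" if w: "w \<in> W" for w
    proof -
      have "0 \<le> x \<bullet> w" "x \<bullet> w < real (a w)" "x \<bullet> w \<in> \<int>" using x w a(1) by (auto simp: box_def E_def)
      then show ?thesis by (auto elim!: Ints_cases)
    qed
    then show "restrict (\<lambda>w. nat \<lfloor>x \<bullet> w\<rfloor>) W \<in> PiE W (\<lambda>w. {..<a w})" by auto
  qed
  show "restrict (\<lambda>w. nat \<lfloor>pt j \<bullet> w\<rfloor>) W = j" if "j \<in> PiE W (\<lambda>w. {..<a w})" for j
    using that by (auto simp: pt_inner PiE_iff extensional_def restrict_def fun_eq_iff)
  show "pt (restrict (\<lambda>w. nat \<lfloor>x \<bullet> w\<rfloor>) W) = x" if "x \<in> box" for x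
  proof (rule eqI)
    fix w assume w: "w \<in> W"
    then have "x \<bullet> w \<in> \<int>" "0 \<le> x \<bullet> w" using that by (auto simp: box_def E_def)
    then show "pt (restrict (\<lambda>w. nat \<lfloor>x \<bullet> w\<rfloor>) W) \<bullet> w = x \<bullet> w"
      using w by (auto simp: pt_inner elim!: Ints_cases)
  qed
qed

lemma finite_box: "finite box"
  using bij_betw_finite[OF pt_bij] fin by (simp add: finite_PiE)

text \<open>In the coordinates of \<open>pt\<close> the norm is the sum of the terms
  \<open>j w ^ 2 / a w\<close>, so the sum factors into one Gauss sum per element of
  \<open>W\<close>, each with phase \<open>pi / 4\<close>.\<close>

lemma gauss_sum_box: "\<exists>r>0. (\<Sum>x\<in>box. cis (pi * (x \<bullet> x))) = r *\<^sub>R cis (card W * pi / 4)"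
proof -
  have pp: "pt j \<bullet> pt j = (\<Sum>w\<in>W. real (j w) ^ 2 / real (a w))" for j
  proof -
    have "pt j \<bullet> pt j = (\<Sum>w\<in>W. (real (j w) / (w \<bullet> w)) * (pt j \<bullet> w))"
      by (subst (2) pt_def) (simp add: inner_sum_right)
    also have "\<dots> = (\<Sum>w\<in>W. real (j w) ^ 2 / real (a w))"
      by (intro sum.cong) (auto simp: pt_inner a power2_eq_square)
    finally show ?thesis .
  qed
  have "(\<Sum>x\<in>box. cis (pi * (x \<bullet> x))) = (\<Sum>j\<in>PiE W (\<lambda>w. {..<a w}). cis (pi * (pt j \<bullet> pt j)))"
    by (rule sum.reindex_bij_betw[OF pt_bij, symmetric])
  also have "\<dots> = (\<Sum>j\<in>PiE W (\<lambda>w. {..<a w}). \<Prod>w\<in>W. cis (pi * real (j w) ^ 2 / real (a w)))"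
    unfolding pp sum_distrib_left by (simp add: cis_sum fin)
  also have "\<dots> = (\<Prod>w\<in>W. \<Sum>i<a w. cis (pi * real i ^ 2 / real (a w)))"
    by (rule prod_sum_PiE[symmetric]) (auto simp: fin)
  also have "\<dots> = (\<Prod>w\<in>W. gauss_sum (a w))" by (simp add: gauss_sum_def)
  also have "\<dots> = (\<Prod>w\<in>W. of_real (sqrt (a w)) * cis (pi / 4))"
    by (intro prod.cong) (auto simp: gauss_sum_even a scaleR_conv_of_real)
  also have "\<dots> = of_real (\<Prod>w\<in>W. sqrt (a w)) * cis (pi / 4) ^ card W"
    by (simp add: prod.distrib)
  also have "cis (pi / 4) ^ card W = cis (card W * pi / 4)"
    by (simp only: Complex.DeMoivre) simp
  finally show ?thesis
    using a(3) by (intro exI[of _ "\<Prod>w\<in>W. sqrt (a w)"]) (auto simp: scaleR_conv_of_real intro!: prod_pos)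
qed

lemma D_sub_E: "D \<subseteq> E"
proof
  fix d assume "d \<in> D"
  then obtain k :: "'a \<Rightarrow> int" where d: "d = (\<Sum>w\<in>W. of_int (k w) *\<^sub>R w)" by (auto simp: D_def)
  have "w \<bullet> w \<in> \<int>" if "w \<in> W" for w using a(1)[OF that] by (metis Ints_of_nat)
  then show "d \<in> E" unfolding d E_def by (auto simp: inner_W)
qed

lemma E_add: "x \<in> E \<Longrightarrow> y \<in> E \<Longrightarrow> x + y \<in> E" and E_diff: "x \<in> E \<Longrightarrow> y \<in> E \<Longrightarrow> x - y \<in> E"
  by (auto simp: E_def inner_add_left inner_diff_left)

lemma red_diff: "x - red x \<in> D"
  by (auto simp: red_def D_def)

lemma red_box: "x \<in> E \<Longrightarrow> red x \<in> box"
proof -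
  assume x: "x \<in> E"
  have "x - red x \<in> E" using D_sub_E red_diff by blast
  then have "red x \<in> E" using E_diff[OF x] by fastforce
  moreover have "0 \<le> red x \<bullet> w \<and> red x \<bullet> w < w \<bullet> w" if w: "w \<in> W" for w
  proof -
    have "red x \<bullet> w = frac (x \<bullet> w / (w \<bullet> w)) * (w \<bullet> w)"
      using wpos[OF w] by (simp add: red_def inner_diff_left inner_W[OF w] frac_def left_diff_distrib)
    then show ?thesis using wpos[OF w] frac_ge_0 frac_lt_1 by simp
  qed
  ultimately show ?thesis by (auto simp: box_def)
qed

lemma red_id: "x \<in> box \<Longrightarrow> red x = x"
proof -
  assume x: "x \<in> box"
  have "\<lfloor>x \<bullet> w / (w \<bullet> w)\<rfloor> = 0" if "w \<in> W" for w
    using x that wpos[OF that] by (auto simp: box_def floor_eq_iff)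
  then show ?thesis by (simp add: red_def)
qed

lemma red_shift:
  assumes "d \<in> D" shows "red (x + d) = red x"
proof -
  obtain k :: "'a \<Rightarrow> int" where d: "d = (\<Sum>w\<in>W. of_int (k w) *\<^sub>R w)" using assms by (auto simp: D_def)
  have "\<lfloor>(x + d) \<bullet> w / (w \<bullet> w)\<rfloor> = \<lfloor>x \<bullet> w / (w \<bullet> w)\<rfloor> + k w" if "w \<in> W" for w
    using wpos[OF that] by (simp add: d inner_add_left inner_W[OF that] add_divide_distrib)
  then show ?thesis by (simp add: red_def d scaleR_add_left sum.distrib)
qed

text \<open>Translation by \<open>v\<close> permutes the classes of \<open>E\<close> modulo
  \<open>D\<close>, of which \<open>box\<close> contains one point each.\<close>

lemma sum_box_shift:
  fixes G :: "'a \<Rightarrow> complex"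
  assumes G: "\<And>x d. x \<in> E \<Longrightarrow> d \<in> D \<Longrightarrow> G (x + d) = G x" and v: "v \<in> E"
  shows "(\<Sum>x\<in>box. G (x + v)) = (\<Sum>x\<in>box. G x)"
proof -
  have boxE: "x \<in> E" if "x \<in> box" for x using that by (simp add: box_def)
  have Dminus: "- d \<in> D" if "d \<in> D" for d
    using that by (auto simp: D_def simp flip: sum_negf scaleR_minus_left of_int_minus)
  have G': "G (red x) = G x" if "x \<in> E" for x
    using G[OF that Dminus[OF red_diff[of x]]] by simp
  have rr: "red (red (x + v) - v) = x" "red (red (x - v) + v) = x" if "x \<in> box" for x
  proof -
    have 1: "red y - y \<in> D" for y using Dminus[OF red_diff[of y]] by simp
    show "red (red (x + v) - v) = x"
      using red_shift[OF 1[of "x + v"], of x] red_id[OF that] by (simp add: algebra_simps)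
    show "red (red (x - v) + v) = x"
      using red_shift[OF 1[of "x - v"], of x] red_id[OF that] by (simp add: algebra_simps)
  qed
  show ?thesis
    by (rule sum.reindex_bij_witness[of _ "\<lambda>x. red (x - v)" "\<lambda>x. red (x + v)"])
      (auto simp: rr red_box E_add E_diff boxE v G')
qed

end

text \<open>\<open>P\<close> lies between \<open>D\<close> and \<open>E\<close>. Averaging the sum
  over \<open>E\<close> modulo \<open>D\<close> over translations by \<open>P\<close> produces
  character sums that vanish outside the dual of \<open>P\<close>, so the sum keeps its value when
  restricted to the dual. The points of \<open>B\<close> represent the dual modulo \<open>D\<close>
  rather than modulo \<open>P\<close>; this multiplies the classical sum by the index of
  \<open>D\<close> in \<open>P\<close>, which the unspecified factor \<open>r\<close>
  absorbs.\<close>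

theorem milgram:
  fixes P :: "'a::euclidean_space set"
  assumes P: "even_lattice P" and span: "span P = UNIV"
  obtains B r where "finite B" "B \<subseteq> dual_lattice P" "r > 0"
    "(\<Sum>x\<in>B. cis (pi * (x \<bullet> x))) = r *\<^sub>R cis (DIM('a) * pi / 4)"
    "\<And>(G :: 'a \<Rightarrow> complex) v. (\<And>x m. x \<in> dual_lattice P \<Longrightarrow> m \<in> P \<Longrightarrow> G (x + m) = G x) \<Longrightarrow> v \<in> dual_lattice P
      \<Longrightarrow> (\<Sum>x\<in>B. G (x + v)) = (\<Sum>x\<in>B. G x)"
proof -
  obtain W where W: "W \<subseteq> P" "finite W" "pairwise orthogonal W" "0 \<notin> W" "span W = UNIV" "card W = DIM('a)"
    using even_lattice_orthogonal_basis[OF P span] by blast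
  interpret orthogonal_lattice W
    using W even_latticeD(3)[OF P] by unfold_locales auto
  let ?F = "\<lambda>x. cis (pi * (x \<bullet> x))"
  have DP: "D \<subseteq> P"
    using W(1) by (auto simp: D_def intro!: even_lattice_sum[OF P] even_lattice_scale[OF P])
  have dE: "dual_lattice P \<subseteq> E" using W(1) by (auto simp: dual_lattice_def E_def)
  have PE: "P \<subseteq> E" using dE even_lattice_subset_dual[OF P] by blast
  have DE_int: "x \<bullet> d \<in> \<int>" if "x \<in> E" "d \<in> D" for x d
    using that by (auto simp: D_def E_def inner_sum_right intro!: Ints_sum Ints_mult)
  have F_add: "?F (x + m) = ?F x * cis (2 * pi * (x \<bullet> m))" if "m \<in> P" for x m
  proof -
    have "pi * ((x + m) \<bullet> (x + m)) = pi * (x \<bullet> x) + 2 * pi * (x \<bullet> m) + 2 * pi * (m \<bullet> m / 2)"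
      by (simp add: inner_add_left inner_add_right inner_commute algebra_simps)
    then show ?thesis using even_latticeD(3)[OF P that]
      by (simp only: cis_int_shift) (simp add: cis_mult)
  qed
  have F_per: "?F (x + d) = ?F x" if "x \<in> E" "d \<in> D" for x d
    using F_add[of d x] DE_int[OF that] DP that cis_int_shift[of "x \<bullet> d" 0] by auto
  define B where "B = box \<inter> dual_lattice P"
  have mem_add: "x + m \<in> dual_lattice P \<longleftrightarrow> x \<in> dual_lattice P" if "m \<in> dual_lattice P" for x m
    using that dual_lattice_add dual_lattice_diff[of "x + m" P m] by auto
  define h where "h = card (box \<inter> P)"
  have "0 \<in> box" using P even_latticeD(1) wpos by (auto simp: box_def E_def)
  then have "h > 0" using finite_box even_latticeD(1)[OF P] by (auto simp: h_def card_gt_0_iff)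
  \<comment> \<open>Orthogonality of characters: if \<open>x \<bullet> m0\<close> is not an integer,
    translation by \<open>m0\<close> multiplies the sum by a factor other than 1.\<close>
  have char: "(\<Sum>m\<in>box \<inter> P. cis (2 * pi * (x \<bullet> m))) = (if x \<in> dual_lattice P then of_nat h else 0)"
    if x: "x \<in> E" for x
  proof (cases "x \<in> dual_lattice P")
    case True
    then have "cis (2 * pi * (x \<bullet> m)) = 1" if "m \<in> P" for m
      using that cis_int_shift[of "x \<bullet> m" 0] by (auto simp: dual_lattice_def)
    then show ?thesis using True by (simp add: h_def)
  next
    case False
    then obtain m0 where m0: "m0 \<in> P" "x \<bullet> m0 \<notin> \<int>" by (auto simp: dual_lattice_def)
    define G where "G m = (if m \<in> P then cis (2 * pi * (x \<bullet> m)) else 0)" for m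
    have Padd: "m + d \<in> P \<longleftrightarrow> m \<in> P" if "d \<in> P" for m d
      using that even_lattice_add[OF P] even_latticeD(2)[OF P, of "m + d" d] by auto
    have "(\<Sum>m\<in>box. G (m + m0)) = (\<Sum>m\<in>box. G m)"
    proof (rule sum_box_shift)
      fix m d assume "m \<in> E" "d \<in> D"
      then show "G (m + d) = G m"
        using Padd[of d m] DP cis_int_shift[OF DE_int[OF x], of d "2 * pi * (x \<bullet> m)"]
        by (auto simp: G_def inner_add_right distrib_left)
    qed (use m0 PE in auto)
    moreover have "G (m + m0) = cis (2 * pi * (x \<bullet> m0)) * G m" for m
      using Padd[OF m0(1)] by (simp add: G_def inner_add_right distrib_left flip: cis_mult)
    ultimately have "cis (2 * pi * (x \<bullet> m0)) * (\<Sum>m\<in>box. G m) = (\<Sum>m\<in>box. G m)"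
      by (simp add: sum_distrib_left)
    moreover have "cis (2 * pi * (x \<bullet> m0)) \<noteq> 1" using m0 cis_eq_one_imp_int by blast
    ultimately have "(\<Sum>m\<in>box. G m) = 0" by auto
    moreover have "(\<Sum>m\<in>box. G m) = (\<Sum>m\<in>box \<inter> P. cis (2 * pi * (x \<bullet> m)))"
      unfolding G_def using finite_box by (simp add: sum.inter_restrict)
    ultimately show ?thesis using False by simp
  qed
  have "of_nat h * (\<Sum>x\<in>box. ?F x) = (\<Sum>m\<in>box \<inter> P. \<Sum>x\<in>box. ?F (x + m))"
  proof -
    have "(\<Sum>x\<in>box. ?F (x + m)) = (\<Sum>x\<in>box. ?F x)" if "m \<in> box \<inter> P" for m
      using that by (intro sum_box_shift F_per) (auto simp: box_def)
    then show ?thesis by (simp add: h_def)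
  qed
  also have "\<dots> = (\<Sum>x\<in>box. ?F x * (\<Sum>m\<in>box \<inter> P. cis (2 * pi * (x \<bullet> m))))"
    by (subst sum.swap) (simp add: F_add sum_distrib_left)
  also have "\<dots> = (\<Sum>x\<in>box. if x \<in> dual_lattice P then of_nat h * ?F x else 0)"
  proof (rule sum.cong)
    fix x assume "x \<in> box"
    then have "x \<in> E" by (simp add: box_def)
    then show "?F x * (\<Sum>m\<in>box \<inter> P. cis (2 * pi * (x \<bullet> m))) = (if x \<in> dual_lattice P then of_nat h * ?F x else 0)"
      by (simp add: char)
  qed simp
  also have "\<dots> = of_nat h * (\<Sum>x\<in>B. ?F x)"
    unfolding B_def sum_distrib_left using finite_box by (simp add: sum.inter_restrict)
  finally have "(\<Sum>x\<in>B. ?F x) = (\<Sum>x\<in>box. ?F x)" using \<open>h > 0\<close> by simp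
  moreover obtain r where "r > 0" "(\<Sum>x\<in>box. ?F x) = r *\<^sub>R cis (card W * pi / 4)"
    using gauss_sum_box by blast
  moreover have "(\<Sum>x\<in>B. G (x + v)) = (\<Sum>x\<in>B. G x)"
    if G: "\<And>x m. x \<in> dual_lattice P \<Longrightarrow> m \<in> P \<Longrightarrow> G (x + m) = G x" and v: "v \<in> dual_lattice P"
    for G :: "'a \<Rightarrow> complex" and v
  proof -
    \<comment> \<open>Extension by zero turns a sum over \<open>B\<close> into one over
      \<open>box\<close>; it stays periodic because membership in the dual is invariant under
      \<open>D\<close> and \<open>v\<close>.\<close>
    define G' where "G' x = (if x \<in> dual_lattice P then G x else 0)" for x
    have "(\<Sum>x\<in>box. G' (x + v)) = (\<Sum>x\<in>box. G' x)"
    proof (rule sum_box_shift)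
      fix x d assume "x \<in> E" "d \<in> D"
      then show "G' (x + d) = G' x"
        using G[of x d] DP even_lattice_subset_dual[OF P] mem_add[of d x] by (auto simp: G'_def)
    qed (use v dE in auto)
    then show ?thesis
      unfolding G'_def mem_add[OF v] B_def using finite_box by (simp add: sum.inter_restrict)
  qed
  ultimately show thesis
    using that[of B r] finite_box W(6) by (auto simp: B_def)
qed

text \<open>Off-diagonal terms occur in equal pairs, so only the diagonal must absorb the division
  by 2.\<close>

lemma symmetric_double_sum_even:
  fixes g :: "'a \<Rightarrow> 'a \<Rightarrow> real" and c :: "'a \<Rightarrow> int"
  assumes "finite A" "\<And>a b. a \<in> A \<Longrightarrow> b \<in> A \<Longrightarrow> g a b \<in> \<int>" "\<And>a b. a \<in> A \<Longrightarrow> b \<in> A \<Longrightarrow> g a b = g b a"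
    "\<And>a. a \<in> A \<Longrightarrow> g a a / 2 \<in> \<int>"
  shows "(\<Sum>a\<in>A. \<Sum>b\<in>A. of_int (c a) * of_int (c b) * g a b) / 2 \<in> \<int>"
  using assms
proof (induction A rule: finite_induct)
  case (insert x A)
  let ?t = "\<lambda>a b. of_int (c a) * of_int (c b) * g a b"
  have "(\<Sum>a\<in>insert x A. \<Sum>b\<in>insert x A. ?t a b)
      = ?t x x + (\<Sum>b\<in>A. ?t x b) + ((\<Sum>a\<in>A. ?t a x) + (\<Sum>a\<in>A. \<Sum>b\<in>A. ?t a b))"
    using insert.hyps by (simp add: sum.distrib)
  also have "(\<Sum>a\<in>A. ?t a x) = (\<Sum>b\<in>A. ?t x b)"
    using insert.prems(2) by (intro sum.cong) auto
  finally have "(\<Sum>a\<in>insert x A. \<Sum>b\<in>insert x A. ?t a b) / 2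
     = of_int (c x) * of_int (c x) * (g x x / 2) + (\<Sum>b\<in>A. ?t x b) + (\<Sum>a\<in>A. \<Sum>b\<in>A. ?t a b) / 2"
    by (simp add: field_simps)
  moreover have "(\<Sum>a\<in>A. \<Sum>b\<in>A. ?t a b) / 2 \<in> \<int>" using insert by auto
  moreover have "(\<Sum>b\<in>A. ?t x b) \<in> \<int>" using insert.prems by (intro Ints_sum Ints_mult) auto
  moreover have "of_int (c x) * of_int (c x) * (g x x / 2) \<in> \<int>" using insert.prems by (intro Ints_mult) auto
  ultimately show ?case by (simp only: Ints_add)
qed simp

text \<open>The vectors of \<^term>\<open>A\<close> form a single coset of the even lattice
  of combinations whose coefficient sum is divisible by \<^term>\<open>q\<close>; the dual of that lattice is the union
  of the cosets \<^term>\<open>T + j *\<^sub>R a\<close>, where \<^term>\<open>T\<close> is the dual of the span of \<^term>\<open>A\<close>, and the Gauss sum factors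
  accordingly.\<close>
lemma glue_gauss_sum:
  fixes A :: "'a::euclidean_space set" and q :: nat and \<theta> :: real
  assumes A: "finite A" "span A = UNIV" "a0 \<in> A"
    and gram: "\<And>a b. a \<in> A \<Longrightarrow> b \<in> A \<Longrightarrow> a \<bullet> b - \<theta> \<in> \<int>"
    and diag: "\<And>a. a \<in> A \<Longrightarrow> (a \<bullet> a - \<theta>) / 2 \<in> \<int>"
    and q: "q > 0" "of_nat q * \<theta> \<in> \<int>" "(of_nat q)\<^sup>2 * \<theta> / 2 \<in> \<int>"
    and cover: "\<And>i::int. \<exists>j<q. of_int i / of_nat q - of_nat j * \<theta> \<in> \<int>"
    and inj: "\<And>j j'. j < q \<Longrightarrow> j' < q \<Longrightarrow> of_nat j * \<theta> - of_nat j' * \<theta> \<in> \<int> \<Longrightarrow> j = j'"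
  obtains B r where "finite B" "\<And>x a. x \<in> B \<Longrightarrow> a \<in> A \<Longrightarrow> x \<bullet> a \<in> \<int>" "r > (0::real)"
    "(\<Sum>x\<in>B. cis (pi * (x \<bullet> x))) * (\<Sum>j<q. cis (pi * (real j)\<^sup>2 * (a0 \<bullet> a0))) = r *\<^sub>R cis (DIM('a) * pi / 4)"
proof -
  define P where "P = {x. \<exists>c::'a \<Rightarrow> int. int q dvd (\<Sum>a\<in>A. c a) \<and> x = (\<Sum>a\<in>A. of_int (c a) *\<^sub>R a)}"
  define T where "T = {x. \<forall>a\<in>A. x \<bullet> a \<in> \<int>}"
  have comb_inner: "(\<Sum>a\<in>A. of_int (c a) *\<^sub>R a) \<bullet> b - of_int (\<Sum>a\<in>A. c a) * \<theta> \<in> \<int>" if "b \<in> A" for c b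
  proof -
    have "(\<Sum>a\<in>A. of_int (c a) *\<^sub>R a) \<bullet> b - of_int (\<Sum>a\<in>A. c a) * \<theta> = (\<Sum>a\<in>A. of_int (c a) * (a \<bullet> b - \<theta>))"
      by (simp add: inner_sum_left right_diff_distrib sum_subtractf sum_distrib_right)
    also have "\<dots> \<in> \<int>" using gram that by (intro Ints_sum Ints_mult) auto
    finally show ?thesis .
  qed
  have qth: "of_int k * \<theta> \<in> \<int>" if kq: "int q dvd k" for k
  proof -
    obtain l where "k = int q * l" using kq by blast
    then have "of_int k * \<theta> = of_int l * (of_nat q * \<theta>)" by simp
    then show ?thesis using q(2) by (metis Ints_mult Ints_of_int)
  qed
  have PT: "P \<subseteq> T"
  proof
    fix x assume "x \<in> P"
    then obtain c where c: "int q dvd (\<Sum>a\<in>A. c a)" "x = (\<Sum>a\<in>A. of_int (c a) *\<^sub>R a)" by (auto simp: P_def)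
    show "x \<in> T" unfolding T_def
    proof safe
      fix b assume "b \<in> A"
      from comb_inner[OF this, of c] qth[OF c(1)] show "x \<bullet> b \<in> \<int>"
        unfolding c(2)[symmetric] by (metis Ints_add diff_add_cancel)
    qed
  qed
  have "even_lattice P" unfolding even_lattice_def
  proof (intro conjI ballI)
    show "0 \<in> P" unfolding P_def by (auto intro!: exI[of _ "\<lambda>_. 0"])
  next
    fix x y assume "x \<in> P" "y \<in> P"
    then obtain c d where "int q dvd (\<Sum>a\<in>A. c a)" "x = (\<Sum>a\<in>A. of_int (c a) *\<^sub>R a)"
      "int q dvd (\<Sum>a\<in>A. d a)" "y = (\<Sum>a\<in>A. of_int (d a) *\<^sub>R a)" by (auto simp: P_def)
    then show "x - y \<in> P" unfolding P_def
      by (auto intro!: exI[of _ "\<lambda>a. c a - d a"] simp: sum_subtractf scaleR_diff_left)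
  next
    fix x assume "x \<in> P"
    then obtain c where c: "int q dvd (\<Sum>a\<in>A. c a)" "x = (\<Sum>a\<in>A. of_int (c a) *\<^sub>R a)" by (auto simp: P_def)
    then obtain k where k: "(\<Sum>a\<in>A. c a) = int q * k" by blast
    have "x \<bullet> x = (\<Sum>a\<in>A. \<Sum>b\<in>A. of_int (c a) * of_int (c b) * (a \<bullet> b))"
      unfolding c(2) by (simp add: inner_sum_left inner_sum_right sum_distrib_left mult_ac) (simp add: inner_commute)
    \<comment> \<open>Splitting off \<theta> leaves an integral matrix with even diagonal, and
      \<theta> times the square of a coefficient sum divisible by \<open>q\<close>.\<close>
    also have "(\<Sum>a\<in>A. \<Sum>b\<in>A. of_int (c a) * of_int (c b) * (a \<bullet> b))
        = (\<Sum>a\<in>A. \<Sum>b\<in>A. of_int (c a) * of_int (c b) * (a \<bullet> b - \<theta>)) + (of_int (\<Sum>a\<in>A. c a))\<^sup>2 * \<theta>"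
    proof -
      have "(of_int (\<Sum>a\<in>A. c a))\<^sup>2 * \<theta> = (\<Sum>a\<in>A. \<Sum>b\<in>A. of_int (c a) * of_int (c b) * \<theta>)"
        unfolding power2_eq_square of_int_sum by (subst sum_product) (simp add: sum_distrib_right)
      then show ?thesis by (simp only: right_diff_distrib sum_subtractf)
    qed
    finally have xx: "x \<bullet> x = (\<Sum>a\<in>A. \<Sum>b\<in>A. of_int (c a) * of_int (c b) * (a \<bullet> b - \<theta>))
        + (of_int (int q * k))\<^sup>2 * \<theta>" unfolding k .
    have "(s + (of_int (int q * k))\<^sup>2 * \<theta>) / 2 = s / 2 + of_int (k ^ 2) * ((of_nat q)\<^sup>2 * \<theta> / 2)" for s
      by (simp add: field_simps power_mult_distrib)
    then have "x \<bullet> x / 2 = (\<Sum>a\<in>A. \<Sum>b\<in>A. of_int (c a) * of_int (c b) * (a \<bullet> b - \<theta>)) / 2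
        + of_int (k ^ 2) * ((of_nat q)\<^sup>2 * \<theta> / 2)"
      by (simp only: xx)
    moreover have "(\<Sum>a\<in>A. \<Sum>b\<in>A. of_int (c a) * of_int (c b) * (a \<bullet> b - \<theta>)) / 2 \<in> \<int>"
      using gram diag A(1) by (intro symmetric_double_sum_even) (auto simp: inner_commute)
    moreover have "of_int (k ^ 2) * ((of_nat q)\<^sup>2 * \<theta> / 2) \<in> \<int>"
      using q(3) by (rule Ints_mult[OF Ints_of_int])
    ultimately show "x \<bullet> x / 2 \<in> \<int>" by (simp only: Ints_add)
  qed
  note P = this
  have diffP: "a - b \<in> P" if "a \<in> A" "b \<in> A" for a b
    unfolding P_def
  proof (intro CollectI exI conjI)
    let ?c = "\<lambda>x. (if x = a then 1 else 0) - (if x = b then 1 else (0::int))"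
    show "int q dvd (\<Sum>x\<in>A. ?c x)" using A that by (simp add: sum_subtractf)
    have "(\<Sum>x\<in>A. of_int (?c x) *\<^sub>R x) = (\<Sum>x\<in>A. if x = a then x else 0) - (\<Sum>x\<in>A. if x = b then x else 0)"
      unfolding sum_subtractf[symmetric] by (intro sum.cong) auto
    then show "a - b = (\<Sum>x\<in>A. of_int (?c x) *\<^sub>R x)" using A that by simp
  qed
  have qP: "of_nat q *\<^sub>R a \<in> P" if "a \<in> A" for a
    unfolding P_def
  proof (intro CollectI exI conjI)
    let ?c = "\<lambda>x. if x = a then int q else 0"
    show "int q dvd (\<Sum>x\<in>A. ?c x)" using A that by simp
    have "(\<Sum>x\<in>A. of_int (?c x) *\<^sub>R x) = (\<Sum>x\<in>A. if x = a then of_nat q *\<^sub>R x else 0)"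
      by (intro sum.cong) auto
    then show "of_nat q *\<^sub>R a = (\<Sum>x\<in>A. of_int (?c x) *\<^sub>R x)" using A that by simp
  qed
  have "A \<subseteq> span P"
  proof
    fix a assume "a \<in> A"
    then have "(1 / of_nat q) *\<^sub>R (of_nat q *\<^sub>R a) \<in> span P" by (intro span_scale span_base qP)
    then show "a \<in> span P" using q(1) by simp
  qed
  then have span: "span P = UNIV" using A(2) span_mono[of A "span P"] by (simp add: span_span) blast
  have TP: "T \<subseteq> dual_lattice P"
  proof
    fix x assume x: "x \<in> T"
    show "x \<in> dual_lattice P" unfolding dual_lattice_def P_def using x
      by (auto simp: T_def inner_sum_right intro!: Ints_sum Ints_mult)
  qed
  have a0P: "of_nat j *\<^sub>R a0 \<in> dual_lattice P" for j
    unfolding dual_lattice_def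
  proof safe
    fix m assume "m \<in> P"
    then have "m \<bullet> a0 \<in> \<int>" using PT A(3) by (auto simp: T_def)
    then show "of_nat j *\<^sub>R a0 \<bullet> m \<in> \<int>" by (simp add: inner_commute Ints_mult)
  qed
  \<comment> \<open>Elements of the dual of \<open>P\<close> pair integrally with differences of
    elements of \<open>A\<close>, so the class of \<open>x\<close> modulo \<open>T\<close> is
    decided by \<open>x \<bullet> a0\<close> modulo 1, a multiple of \<open>1 / q\<close>. By
    \<open>cover\<close> and \<open>inj\<close> each such multiple is met by exactly one
    \<open>j * \<theta>\<close> with \<open>j < q\<close>.\<close>
  have ex1: "\<exists>!j. j < q \<and> x - of_nat j *\<^sub>R a0 \<in> T" if x: "x \<in> dual_lattice P" for x
  proof -
    have "x \<bullet> (of_nat q *\<^sub>R a0) \<in> \<int>" using x qP[OF A(3)] by (auto simp: dual_lattice_def)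
    then obtain i where i: "of_nat q * (x \<bullet> a0) = of_int i" by (auto elim: Ints_cases)
    then have xi: "x \<bullet> a0 = of_int i / of_nat q" using q(1) by (simp add: field_simps)
    have iff: "x - of_nat j *\<^sub>R a0 \<in> T \<longleftrightarrow> of_int i / of_nat q - of_nat j * \<theta> \<in> \<int>" for j
    proof
      assume "x - of_nat j *\<^sub>R a0 \<in> T"
      then have "(x - of_nat j *\<^sub>R a0) \<bullet> a0 + of_nat j * (a0 \<bullet> a0 - \<theta>) \<in> \<int>"
        using gram A(3) by (intro Ints_add Ints_mult) (auto simp: T_def)
      then show "of_int i / of_nat q - of_nat j * \<theta> \<in> \<int>" by (simp add: inner_diff_left xi right_diff_distrib)
    next
      assume *: "of_int i / of_nat q - of_nat j * \<theta> \<in> \<int>"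
      show "x - of_nat j *\<^sub>R a0 \<in> T" unfolding T_def
      proof safe
        fix a assume a: "a \<in> A"
        have "x \<bullet> (a - a0) \<in> \<int>" using x diffP[OF a A(3)] by (auto simp: dual_lattice_def)
        then have "x \<bullet> (a - a0) + (of_int i / of_nat q - of_nat j * \<theta>) - of_nat j * (a0 \<bullet> a - \<theta>) \<in> \<int>"
          by (rule Ints_diff[OF Ints_add[OF _ *] Ints_mult[OF Ints_of_nat gram[OF A(3) a]]])
        then show "(x - of_nat j *\<^sub>R a0) \<bullet> a \<in> \<int>"
          by (simp add: inner_diff_left inner_diff_right xi right_diff_distrib)
      qed
    qed
    from cover[of i] obtain j where j: "j < q" "of_int i / of_nat q - of_nat j * \<theta> \<in> \<int>" by blast
    show ?thesis
    proof (rule ex1I[of _ j])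
      fix j' assume "j' < q \<and> x - of_nat j' *\<^sub>R a0 \<in> T"
      then have j': "j' < q" "of_int i / of_nat q - of_nat j' * \<theta> \<in> \<int>" by (auto simp: iff)
      have "of_nat j * \<theta> - of_nat j' * \<theta> \<in> \<int>" using Ints_diff[OF j'(2) j(2)] by simp
      then show "j' = j" using inj j j' by blast
    qed (use j iff in auto)
  qed
  show thesis
  proof (rule milgram[OF P span])
  fix B r
  assume B: "finite B" "B \<subseteq> dual_lattice P" "r > 0"
    "(\<Sum>x\<in>B. cis (pi * (x \<bullet> x))) = r *\<^sub>R cis (DIM('a) * pi / 4)"
    and shift: "\<And>(G :: 'a \<Rightarrow> complex) v. (\<And>x m. x \<in> dual_lattice P \<Longrightarrow> m \<in> P \<Longrightarrow> G (x + m) = G x) \<Longrightarrow> v \<in> dual_lattice P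
      \<Longrightarrow> (\<Sum>x\<in>B. G (x + v)) = (\<Sum>x\<in>B. G x)"
  let ?F = "\<lambda>x. cis (pi * (x \<bullet> x))"
  have F_per: "?F (x + m) = ?F x" if "x \<in> dual_lattice P" "m \<in> P" for x m
  proof -
    have "pi * ((x + m) \<bullet> (x + m)) = pi * (x \<bullet> x) + 2 * pi * (x \<bullet> m + m \<bullet> m / 2)"
      by (simp add: inner_add_left inner_add_right inner_commute algebra_simps)
    moreover have "x \<bullet> m + m \<bullet> m / 2 \<in> \<int>"
      using that even_latticeD(3)[OF P] by (intro Ints_add) (auto simp: dual_lattice_def)
    ultimately show ?thesis by (simp only: cis_int_shift)
  qed
  have T_add: "x + y \<in> T \<longleftrightarrow> x \<in> T" if "y \<in> T" for x y
  proof
    assume "x + y \<in> T"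
    then have "(x + y) \<bullet> a - y \<bullet> a \<in> \<int>" if "a \<in> A" for a
      using that \<open>y \<in> T\<close> by (auto simp: T_def simp del: inner_add_left)
    then show "x \<in> T" by (auto simp: T_def inner_add_left)
  qed (use that in \<open>auto simp: T_def inner_add_left\<close>)
  \<comment> \<open>Sort \<open>B\<close> by cosets of \<open>T\<close>. Translation by a multiple
    of \<open>a0\<close> brings each coset back to \<open>T\<close>, at the cost of a factor that
    depends on \<open>j\<close> alone since \<open>T\<close> pairs integrally with
    \<open>a0\<close>.\<close>
  have "(\<Sum>x\<in>B. ?F x) = (\<Sum>x\<in>B. \<Sum>j<q. if x - of_nat j *\<^sub>R a0 \<in> T then ?F x else 0)"
  proof (rule sum.cong)
    fix x assume "x \<in> B"
    note ex1[OF subsetD[OF B(2) this]]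
    then obtain j where j: "j < q \<and> x - of_nat j *\<^sub>R a0 \<in> T"
      and uniq: "\<forall>i. i < q \<and> x - of_nat i *\<^sub>R a0 \<in> T \<longrightarrow> i = j" by (rule ex1E)
    have "(\<Sum>i<q. if x - of_nat i *\<^sub>R a0 \<in> T then ?F x else 0) = (\<Sum>i<q. if i = j then ?F x else 0)"
    proof (rule sum.cong)
      fix i assume "i \<in> {..<q}"
      then have "x - of_nat i *\<^sub>R a0 \<in> T \<longleftrightarrow> i = j" using j uniq by blast
      then show "(if x - of_nat i *\<^sub>R a0 \<in> T then ?F x else 0) = (if i = j then ?F x else 0)" by (simp only:)
    qed simp
    then show "?F x = (\<Sum>i<q. if x - of_nat i *\<^sub>R a0 \<in> T then ?F x else 0)" using j by simp
  qed simp
  also have "\<dots> = (\<Sum>j<q. \<Sum>x\<in>B. if x - of_nat j *\<^sub>R a0 \<in> T then ?F x else 0)" by (rule sum.swap)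
  also have "\<dots> = (\<Sum>j<q. \<Sum>x\<in>B \<inter> T. ?F x * cis (pi * (real j)\<^sup>2 * (a0 \<bullet> a0)))"
  proof (rule sum.cong)
    fix j
    define G where "G x = (if x - of_nat j *\<^sub>R a0 \<in> T then ?F x else 0)" for x
    have "(\<Sum>x\<in>B. G x) = (\<Sum>x\<in>B. G (x + of_nat j *\<^sub>R a0))"
    proof (rule shift[symmetric, OF _ a0P])
      fix x m assume xm: "x \<in> dual_lattice P" "m \<in> P"
      have "x + m - of_nat j *\<^sub>R a0 = (x - of_nat j *\<^sub>R a0) + m" by simp
      then have "x + m - of_nat j *\<^sub>R a0 \<in> T \<longleftrightarrow> x - of_nat j *\<^sub>R a0 \<in> T"
        using T_add[OF subsetD[OF PT xm(2)], of "x - of_nat j *\<^sub>R a0"] by (simp only:)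
      then show "G (x + m) = G x" by (simp only: G_def F_per[OF xm])
    qed
    also have "\<dots> = (\<Sum>x\<in>B. if x \<in> T then ?F x * cis (pi * (real j)\<^sup>2 * (a0 \<bullet> a0)) else 0)"
    proof (rule sum.cong)
      fix x assume "x \<in> B"
      have "?F (x + of_nat j *\<^sub>R a0) = ?F x * cis (pi * (real j)\<^sup>2 * (a0 \<bullet> a0))" if "x \<in> T"
      proof -
        have "pi * ((x + of_nat j *\<^sub>R a0) \<bullet> (x + of_nat j *\<^sub>R a0))
            = (pi * (x \<bullet> x) + pi * (real j)\<^sup>2 * (a0 \<bullet> a0)) + 2 * pi * (of_nat j * (x \<bullet> a0))"
          by (simp add: inner_add_left inner_add_right inner_commute algebra_simps power2_eq_square)
        moreover have "of_nat j * (x \<bullet> a0) \<in> \<int>" using that A(3) by (intro Ints_mult) (auto simp: T_def)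
        ultimately show ?thesis by (simp only: cis_int_shift) (simp add: cis_mult)
      qed
      then show "G (x + of_nat j *\<^sub>R a0) = (if x \<in> T then ?F x * cis (pi * (real j)\<^sup>2 * (a0 \<bullet> a0)) else 0)"
        by (simp add: G_def)
    qed simp
    also have "\<dots> = (\<Sum>x\<in>B \<inter> T. ?F x * cis (pi * (real j)\<^sup>2 * (a0 \<bullet> a0)))"
      using B(1) by (simp add: sum.inter_restrict)
    finally show "(\<Sum>x\<in>B. if x - of_nat j *\<^sub>R a0 \<in> T then ?F x else 0)
      = (\<Sum>x\<in>B \<inter> T. ?F x * cis (pi * (real j)\<^sup>2 * (a0 \<bullet> a0)))" by (simp add: G_def)
  qed simp
  also have "\<dots> = (\<Sum>x\<in>B \<inter> T. ?F x) * (\<Sum>j<q. cis (pi * (real j)\<^sup>2 * (a0 \<bullet> a0)))"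
    unfolding sum_product by (rule sum.swap)
  finally have sumB: "(\<Sum>x\<in>B. ?F x) = (\<Sum>x\<in>B \<inter> T. ?F x) * (\<Sum>j<q. cis (pi * (real j)\<^sup>2 * (a0 \<bullet> a0)))" .
  show thesis
  proof (rule that[of "B \<inter> T" r])
    show "x \<bullet> a \<in> \<int>" if "x \<in> B \<inter> T" "a \<in> A" for x a
      using that by (simp add: T_def)
  qed (use B(1,3) B(4)[unfolded sumB] in simp_all)
  qed
qed

section \<open>Moments of the sphere and of the ultraspherical weight\<close>

lemma absolutely_integrable_on_ball_radial:
  fixes f :: "real^'n \<Rightarrow> real"
  assumes f: "continuous_on UNIV f"
  shows "(\<lambda>x. f (x /\<^sub>R norm x)) absolutely_integrable_on ball 0 1"
proof -
  have "compact (f ` cball 0 1)"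
    using f by (intro compact_continuous_image continuous_on_subset[OF f]) auto
  then obtain b where b: "\<And>x. x \<in> cball 0 1 \<Longrightarrow> norm (f x) \<le> b"
    using compact_imp_bounded by (force simp: bounded_iff)
  have "(\<lambda>x. f (x /\<^sub>R norm x)) \<in> borel_measurable borel"
    using borel_measurable_continuous_onI[OF f] by measurable
  then have meas: "(\<lambda>x. f (x /\<^sub>R norm x)) \<in> borel_measurable (lebesgue_on (ball 0 1))"
    by (intro measurable_restrict_space1 measurable_completion) simp
  show ?thesis
  proof (rule measurable_bounded_by_integrable_imp_absolutely_integrable[OF meas])
    show "(\<lambda>_. b) integrable_on ball (0::real^'n) 1"
      using integrable_on_const[of "ball (0::real^'n) 1" b] by simp
    fix x :: "real^'n"
    \<comment> \<open>At the origin the quotient is 0 because the inverse of 0 is 0; therefore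
      \<open>f\<close> is bounded on the closed ball, not just on the sphere.\<close>
    have "norm (x /\<^sub>R norm x) \<le> 1" by (cases "x = 0") auto
    then show "norm (f (x /\<^sub>R norm x)) \<le> b" using b by (simp only: mem_cball_0)
  qed simp
qed

lemma integrable_on_ball_radial:
  fixes f :: "real^'n \<Rightarrow> real"
  shows "continuous_on UNIV f \<Longrightarrow> (\<lambda>x. f (x /\<^sub>R norm x)) integrable_on ball 0 1"
  using absolutely_integrable_on_ball_radial absolutely_integrable_on_def by blast

lemma sphere_avg_add:
  fixes f g :: "real^'n \<Rightarrow> real"
  assumes "continuous_on UNIV f" "continuous_on UNIV g"
  shows "sphere_avg (\<lambda>x. f x + g x) = sphere_avg f + sphere_avg g"
  using assms[THEN integrable_on_ball_radial]
  by (simp add: sphere_avg_def Henstock_Kurzweil_Integration.integral_add add_divide_distrib)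

lemma sphere_avg_mult: "sphere_avg (\<lambda>x. c * f x) = c * sphere_avg f"
  by (simp add: sphere_avg_def)

lemma sphere_avg_sum:
  fixes f :: "'b \<Rightarrow> real^'n \<Rightarrow> real"
  assumes "finite I" "\<And>i. i \<in> I \<Longrightarrow> continuous_on UNIV (f i)"
  shows "sphere_avg (\<lambda>x. \<Sum>i\<in>I. f i x) = (\<Sum>i\<in>I. sphere_avg (f i))"
  using assms
proof (induction I rule: finite_induct)
  case empty
  then show ?case by (simp add: sphere_avg_def)
next
  case (insert i I)
  then show ?case by (simp add: sphere_avg_add continuous_on_sum)
qed

text \<open>Radial projection misses the sphere only at the origin, a null set.\<close>

lemma sphere_avg_cong:
  fixes f g :: "real^'n \<Rightarrow> real"
  assumes "\<And>x. norm x = 1 \<Longrightarrow> f x = g x"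
  shows "sphere_avg f = sphere_avg g"
proof -
  have "integral (ball 0 1) (\<lambda>x. f (x /\<^sub>R norm x)) = integral (ball 0 1) (\<lambda>x. g (x /\<^sub>R norm x))"
    by (rule integral_spike[of "{0}"]) (auto intro!: assms[symmetric])
  then show ?thesis by (simp add: sphere_avg_def)
qed

lemma sphere_avg_const: "sphere_avg (\<lambda>x::real^'n. c) = c"
proof -
  have "measure lebesgue (ball (0::real^'n) 1) > 0" by simp
  moreover have "integral (ball (0::real^'n) 1) (\<lambda>x. c * 1) = c * measure lebesgue (ball (0::real^'n) 1)"
    using lmeasure_integral[of "ball (0::real^'n) 1"] by (subst integral_mult_right) simp
  ultimately show ?thesis by (simp add: sphere_avg_def)
qed

text \<open>The change of variables theorem for linear maps is only available for well-ordered index types.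
  The following copy of a finite type carries such an order, and it is used to transfer invariance under
  orthogonal transformations to arbitrary finite index types.\<close>
typedef 'a ranked = "UNIV :: 'a set" by auto

definition rank :: "'a::finite \<Rightarrow> nat" where "rank = (SOME f. inj f)"

lemma inj_rank: "inj (rank :: 'a::finite \<Rightarrow> nat)"
proof -
  have "\<exists>f :: 'a \<Rightarrow> nat. inj f" using finite_imp_inj_to_nat_seg[of "UNIV :: 'a set"] by auto
  then show ?thesis unfolding rank_def by (rule someI_ex)
qed

lemma range_Abs_ranked: "range Abs_ranked = UNIV"
  by (metis Rep_ranked_inverse surjI)

instance ranked :: (finite) finite
proof
  have "finite (range (Abs_ranked :: 'a \<Rightarrow> 'a ranked))" by simp
  then show "finite (UNIV :: 'a ranked set)" by (simp only: range_Abs_ranked)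
qed

instantiation ranked :: (finite) linorder
begin
definition less_eq_ranked :: "'a ranked \<Rightarrow> 'a ranked \<Rightarrow> bool" where
  "less_eq_ranked x y \<longleftrightarrow> rank (Rep_ranked x) \<le> rank (Rep_ranked y)"
definition less_ranked :: "'a ranked \<Rightarrow> 'a ranked \<Rightarrow> bool" where
  "less_ranked x y \<longleftrightarrow> rank (Rep_ranked x) < rank (Rep_ranked y)"
instance
  by standard (auto simp: less_eq_ranked_def less_ranked_def Rep_ranked_inject dest: injD[OF inj_rank])
end

instance ranked :: (finite) wellorder
proof
  fix P :: "'a ranked \<Rightarrow> bool" and x
  assume step: "\<And>x. (\<And>y. y < x \<Longrightarrow> P y) \<Longrightarrow> P x"
  show "P x"
    by (induction x rule: measure_induct_rule[where f = "\<lambda>x. rank (Rep_ranked x)"])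
      (auto intro: step simp: less_ranked_def)
qed

definition unrank :: "real^'n ranked \<Rightarrow> real^'n" where
  "unrank x = (\<chi> i. x $ Abs_ranked i)"
definition enrank :: "real^'n \<Rightarrow> real^'n ranked" where
  "enrank y = (\<chi> j. y $ Rep_ranked j)"

lemma unrank_enrank [simp]: "unrank (enrank y) = y" "enrank (unrank x) = x"
  by (simp_all add: unrank_def enrank_def vec_eq_iff Abs_ranked_inverse Rep_ranked_inverse)

lemma bij_Abs_ranked: "bij Abs_ranked"
  by (rule bijI) (auto simp: inj_def Abs_ranked_inject range_Abs_ranked)

lemma linear_rank: "linear unrank" "linear enrank"
  by (auto intro!: linearI simp: unrank_def enrank_def vec_eq_iff)

lemma inner_unrank: "unrank x \<bullet> unrank y = x \<bullet> y"
proof -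
  have "unrank x \<bullet> unrank y = (\<Sum>i\<in>UNIV. x $ Abs_ranked i * y $ Abs_ranked i)"
    by (simp add: inner_vec_def unrank_def)
  also have "\<dots> = (\<Sum>j\<in>UNIV. x $ j * y $ j)"
    using sum.reindex_bij_betw[OF bij_Abs_ranked, of "\<lambda>j. x $ j * y $ j"] by simp
  finally show ?thesis by (simp add: inner_vec_def)
qed

lemma inner_enrank: "enrank x \<bullet> enrank y = x \<bullet> y"
  using inner_unrank[of "enrank x" "enrank y"] by simp

lemma norm_unrank: "norm (unrank x) = norm x"
  by (simp add: norm_eq_sqrt_inner inner_unrank)

lemma unrank_cbox: "unrank ` cbox u v = cbox (unrank u) (unrank v)"
proof -
  have "unrank x \<in> cbox (unrank u) (unrank v) \<longleftrightarrow> x \<in> cbox u v" for x :: "real^('n::finite) ranked" and u v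
  proof -
    have "(\<forall>i. P (Abs_ranked i)) \<longleftrightarrow> (\<forall>j. P j)" for P :: "'n ranked \<Rightarrow> bool"
      using bij_Abs_ranked by (metis bij_pointE)
    then show ?thesis unfolding mem_box_cart unrank_def by simp
  qed
  then have "enrank y \<in> cbox u v \<longleftrightarrow> y \<in> cbox (unrank u) (unrank v)" for y
    by (metis unrank_enrank(1))
  moreover have "unrank ` S = {y. enrank y \<in> S}" for S
    by (force simp: image_iff)
  ultimately show ?thesis by auto
qed

lemma enrank_cbox: "enrank ` cbox u v = cbox (enrank u) (enrank v)"
proof -
  have "cbox u v = unrank ` cbox (enrank u) (enrank v)" by (simp add: unrank_cbox)
  then show ?thesis by (simp only: image_image unrank_enrank image_ident)
qed

lemma content_unrank_cbox: "measure lborel (unrank ` cbox u v) = measure lborel (cbox u v)"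
proof -
  have "(\<Prod>i\<in>UNIV. v $ Abs_ranked i - u $ Abs_ranked i) = (\<Prod>j\<in>UNIV. v $ j - u $ j)"
    using prod.reindex_bij_betw[OF bij_Abs_ranked, of "\<lambda>j. v $ j - u $ j"] by simp
  moreover have "cbox (unrank u) (unrank v) = {} \<longleftrightarrow> cbox u v = {}"
    by (metis image_is_empty unrank_cbox)
  ultimately show ?thesis
    unfolding unrank_cbox by (simp add: content_cbox_if_cart) (simp add: unrank_def)
qed

text \<open>Relabelling coordinates maps boxes to boxes of the same content, so
  \<open>has_integral_twiddle\<close> applies. It speaks of boxes, hence the extension of the
  integrand by zero from the ball to a cube.\<close>

lemma integral_unrank:
  fixes F :: "real^'n \<Rightarrow> real"
  assumes "F integrable_on ball 0 1"
  shows "integral (ball 0 1) (\<lambda>x. F (unrank x)) = integral (ball 0 1) F"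
proof -
  let ?G = "\<lambda>x. if x \<in> ball 0 1 then F x else 0"
  have lin_cont: "isCont unrank x" for x :: "real^'n ranked"
    using linear_rank(1) linear_conv_bounded_linear linear_continuous_at by blast
  have sub: "ball 0 1 \<subseteq> cbox (- 1) (1 :: real^'m)"
  proof
    fix x :: "real^'m" assume "x \<in> ball 0 1"
    then have "\<bar>x $ i\<bar> \<le> 1" for i using component_le_norm_cart[of x i] by simp
    then show "x \<in> cbox (- 1) 1" by (simp add: mem_box_cart abs_le_iff minus_le_iff)
  qed
  have "(?G has_integral integral (ball 0 1) F) (cbox (- 1) 1)"
    unfolding has_integral_restrict[OF sub] using assms by (rule integrable_integral)
  then have "((\<lambda>x. ?G (unrank x)) has_integral (1 / 1) *\<^sub>R integral (ball 0 1) F) (enrank ` cbox (- 1) 1)"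
    by (rule has_integral_twiddle[rotated 7])
      (simp_all add: content_unrank_cbox, simp_all add: unrank_cbox enrank_cbox lin_cont, blast+)
  moreover have "enrank ` cbox (- 1) (1 :: real^'n) = cbox (- 1) 1"
  proof -
    have "enrank (- 1 :: real^'n) = - 1" "enrank (1 :: real^'n) = 1" by (simp_all add: enrank_def vec_eq_iff)
    then show ?thesis by (simp only: enrank_cbox)
  qed
  moreover have "(\<lambda>x. ?G (unrank x)) = (\<lambda>x. if x \<in> ball 0 1 then F (unrank x) else 0)"
    by (auto simp: norm_unrank)
  ultimately have "((\<lambda>x. F (unrank x)) has_integral integral (ball 0 1) F) (ball 0 1)"
    using has_integral_restrict[OF sub, of "\<lambda>x. F (unrank x)"] by simp
  then show ?thesis by (rule integral_unique)
qed

lemma sphere_avg_unrank: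
  fixes f :: "real^'n \<Rightarrow> real"
  assumes "continuous_on UNIV f"
  shows "sphere_avg (\<lambda>x. f (unrank x)) = sphere_avg f"
proof -
  have "integral (ball 0 1) (\<lambda>x. f (unrank (x /\<^sub>R norm x))) = integral (ball 0 1) (\<lambda>x. f (x /\<^sub>R norm x))"
    using integral_unrank[OF integrable_on_ball_radial[OF assms]]
    by (simp add: norm_unrank linear_cmul[OF linear_rank(1)])
  moreover have "measure lebesgue (ball (0 :: real^'n ranked) 1) = measure lebesgue (ball (0 :: real^'n) 1)"
    using integral_unrank[of "\<lambda>_. 1 :: real"] integrable_on_const[of "ball (0 :: real^'n) 1" "1 :: real"]
      lmeasure_integral[of "ball (0 :: real^'n) 1"] lmeasure_integral[of "ball (0 :: real^'n ranked) 1"] by simp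
  ultimately show ?thesis by (simp add: sphere_avg_def)
qed

lemma sphere_avg_orthogonal_wellorder:
  fixes f :: "real^'n::{finite,wellorder} \<Rightarrow> real" and U :: "real^'n::_ \<Rightarrow> real^'n::_"
  assumes f: "continuous_on UNIV f" and U: "orthogonal_transformation U"
  shows "sphere_avg (\<lambda>x. f (U x)) = sphere_avg f"
proof -
  have lin: "linear U" using U by (simp add: orthogonal_transformation_def)
  have nU: "norm (U x) = norm x" for x using U by (simp add: orthogonal_transformation_norm)
  have im: "U ` ball 0 1 = ball 0 1"
    using image_orthogonal_transformation_ball[OF U, of 0 1] linear_0[OF lin] by simp
  have det: "\<bar>det (matrix U)\<bar> = 1"
    using U det_orthogonal_matrix[of "matrix U"] by (auto simp: orthogonal_transformation_matrix)
  let ?g = "\<lambda>x. f (x /\<^sub>R norm x)"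
  \<comment> \<open>The linear change of variables is stated for vector-valued functions, so real
    values are wrapped as elements of \<open>real^1\<close>.\<close>
  have vec: "bounded_linear (vec :: real \<Rightarrow> real^1)"
    by (rule linear_conv_bounded_linear[THEN iffD1]) (auto intro!: linearI simp: vec_eq_iff)
  have "?g absolutely_integrable_on ball 0 1" by (rule absolutely_integrable_on_ball_radial[OF f])
  then have "(vec \<circ> ?g :: _ \<Rightarrow> real^1) absolutely_integrable_on ball 0 1"
    using vec by (rule absolutely_integrable_linear)
  then have "integral (U ` ball 0 1) (vec \<circ> ?g :: _ \<Rightarrow> real^1) = \<bar>det (matrix U)\<bar> *\<^sub>R integral (ball 0 1) ((vec \<circ> ?g) \<circ> U)"
    using im by (intro integral_change_of_variables_linear[OF lin]) simp
  then have "integral (ball 0 1) (vec \<circ> ?g :: _ \<Rightarrow> real^1) = integral (ball 0 1) (vec \<circ> (\<lambda>x. f (U (x /\<^sub>R norm x))))"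
    by (simp add: im det o_def nU linear_cmul[OF lin])
  moreover have "continuous_on UNIV (\<lambda>x. f (U x))"
    using f linear_continuous_on[of U UNIV] lin
    by (intro continuous_on_compose2[OF f]) (auto simp: linear_conv_bounded_linear)
  ultimately have "(vec (integral (ball 0 1) ?g) :: real^1) = vec (integral (ball 0 1) (\<lambda>x. f (U (x /\<^sub>R norm x))))"
    using integral_linear[OF integrable_on_ball_radial[OF f] vec]
      integral_linear[OF integrable_on_ball_radial[of "\<lambda>x. f (U x)"] vec] by simp
  then show ?thesis
    by (simp add: sphere_avg_def vec_eq_iff)
qed

lemma sphere_avg_orthogonal:
  fixes f :: "real^'n \<Rightarrow> real" and U :: "real^'n \<Rightarrow> real^'n"
  assumes f: "continuous_on UNIV f" and U: "orthogonal_transformation U"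
  shows "sphere_avg (\<lambda>x. f (U x)) = sphere_avg f"
proof -
  have cu: "continuous_on UNIV unrank" using linear_rank linear_continuous_on linear_conv_bounded_linear by blast
  have cU: "continuous_on UNIV U"
    using U linear_continuous_on linear_conv_bounded_linear by (metis orthogonal_transformation_def)
  have V: "orthogonal_transformation (\<lambda>x. enrank (U (unrank x)))"
  proof -
    have "linear U" "\<And>x y. U x \<bullet> U y = x \<bullet> y" using U by (simp_all add: orthogonal_transformation_def)
    moreover from this(1) have "linear (enrank \<circ> (U \<circ> unrank))"
      by (intro linear_compose linear_rank)
    ultimately show ?thesis
      by (simp add: orthogonal_transformation_def inner_enrank inner_unrank o_def)
  qed
  have c1: "continuous_on UNIV (\<lambda>x. f (unrank x))"
    by (rule continuous_on_compose2[OF f cu]) auto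
  have c2: "continuous_on UNIV (\<lambda>x. f (U x))"
    by (rule continuous_on_compose2[OF f cU]) auto
  show ?thesis
    using sphere_avg_orthogonal_wellorder[OF c1 V] sphere_avg_unrank[OF c2] sphere_avg_unrank[OF f] by simp
qed

lemma continuous_on_inner_power: "continuous_on UNIV (\<lambda>y :: real^'n. (u \<bullet> y) ^ m)"
  by (intro continuous_intros)

text \<open>All zonal moments of the sphere are determined by rotation invariance alone: comparing the
  coefficients of \<^term>\<open>s\<^sup>2\<close> in the average of \<^term>\<open>(x $ i + s * x $ j) ^ m\<close> gives a recursion.\<close>
definition zonal_moment :: "'n::finite itself \<Rightarrow> nat \<Rightarrow> real" where
  "zonal_moment _ m = sphere_avg (\<lambda>y :: real^'n. (y $ undefined) ^ m)"

text \<open>Rotate a coordinate axis to the direction of \<open>u\<close>; homogeneity supplies the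
  power of the norm.\<close>

lemma sphere_avg_inner_power:
  fixes u :: "real^'n"
  shows "sphere_avg (\<lambda>y. (u \<bullet> y) ^ m) = norm u ^ m * zonal_moment TYPE('n) m"
proof (cases "u = 0")
  case True
  then show ?thesis by (cases m) (simp_all add: sphere_avg_const zonal_moment_def)
next
  case False
  let ?e = "axis undefined 1 :: real^'n"
  obtain U where U: "orthogonal_transformation U" "U ?e = u /\<^sub>R norm u"
    using orthogonal_transformation_exists_1[of ?e "u /\<^sub>R norm u"] False by (auto simp: norm_axis_1)
  have "sphere_avg (\<lambda>y. (u \<bullet> y) ^ m) = sphere_avg (\<lambda>y. norm u ^ m * (U ?e \<bullet> y) ^ m)"
  proof -
    have "u \<bullet> y = norm u * (U ?e \<bullet> y)" for y using False by (simp add: U(2))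
    then show ?thesis by (simp add: power_mult_distrib)
  qed
  also have "\<dots> = norm u ^ m * sphere_avg (\<lambda>y. (U ?e \<bullet> y) ^ m)" by (rule sphere_avg_mult)
  also have "sphere_avg (\<lambda>y. (U ?e \<bullet> y) ^ m) = sphere_avg (\<lambda>y. (U ?e \<bullet> U y) ^ m)"
    using sphere_avg_orthogonal[OF continuous_on_inner_power U(1), of "U ?e" m] by simp
  also have "\<dots> = sphere_avg (\<lambda>y. (?e \<bullet> y) ^ m)"
    using U(1) by (simp add: orthogonal_transformation_def)
  finally show ?thesis by (simp add: zonal_moment_def inner_axis')
qed

lemma zonal_moment_0: "zonal_moment TYPE('n::finite) 0 = 1"
  by (simp add: zonal_moment_def sphere_avg_const)

lemma zonal_moment_odd:
  assumes "odd m"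
  shows "zonal_moment TYPE('n::finite) m = 0"
proof -
  have "zonal_moment TYPE('n) m = sphere_avg (\<lambda>y :: real^'n. (- axis undefined 1 \<bullet> y) ^ m)"
    using sphere_avg_inner_power[of "- axis undefined 1 :: real^'n" m] by (simp add: norm_axis_1)
  also have "\<dots> = sphere_avg (\<lambda>y :: real^'n. - 1 * (y $ undefined) ^ m)"
    using assms by (simp add: inner_axis' power_minus_odd)
  also have "\<dots> = - zonal_moment TYPE('n) m" by (simp only: sphere_avg_mult) (simp add: zonal_moment_def)
  finally show ?thesis by simp
qed

lemma coeff_one_plus_square_power: "coeff ([:1, 0, 1:] ^ r :: real poly) 2 = real r"
proof -
  have "coeff ([:1, 0, 1:] ^ r :: real poly) 0 = 1 \<and> coeff ([:1, 0, 1:] ^ r :: real poly) 1 = 0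
    \<and> coeff ([:1, 0, 1:] ^ r :: real poly) 2 = real r"
    by (induction r) (auto simp: coeff_mult numeral_2_eq_2)
  then show ?thesis by blast
qed

lemma sphere_avg_mixed:
  fixes i j :: "'n::finite"
  assumes "i \<noteq> j"
  shows "real (m + 1) * sphere_avg (\<lambda>y :: real^'n. (y $ i) ^ m * (y $ j) ^ 2) = zonal_moment TYPE('n) (m + 2)"
proof (cases "even m")
  \<comment> \<open>For odd \<open>m\<close> both sides vanish by central symmetry.\<close>
  case False
  have "sphere_avg (\<lambda>y :: real^'n. (y $ i) ^ m * (y $ j) ^ 2) = 
      sphere_avg (\<lambda>y :: real^'n. ((- y) $ i) ^ m * ((- y) $ j) ^ 2)"
    by (rule sphere_avg_orthogonal[of "\<lambda>y. (y $ i) ^ m * (y $ j) ^ 2" uminus, symmetric])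
      (auto intro!: continuous_intros linearI simp: orthogonal_transformation_def)
  also have "\<dots> = - 1 * sphere_avg (\<lambda>y :: real^'n. (y $ i) ^ m * (y $ j) ^ 2)"
    using False by (subst sphere_avg_mult[symmetric]) (simp add: power_minus_odd)
  finally show ?thesis using False by (simp add: zonal_moment_odd)
next
  case True
  then obtain r where r: "m + 2 = 2 * (r + 1)" by (metis add.commute add_mult_distrib2 evenE nat_mult_1_right)
  define k where "k = m + 2"
  define E where "E l = sphere_avg (\<lambda>y :: real^'n. (y $ i) ^ (k - l) * (y $ j) ^ l)" for l
  define p where "p = (\<Sum>l\<le>k. monom (of_nat (k choose l) * E l) l)"
  have "poly p s = poly (smult (zonal_moment TYPE('n) k) ([:1, 0, 1:] ^ (r + 1))) s" for s
  proof -
    let ?u = "axis i 1 + s *\<^sub>R axis j 1 :: real^'n"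
    \<comment> \<open>The squared length of \<open>?u\<close> is \<open>1 + s^2\<close>; as
      \<open>k = 2 * (r + 1)\<close> is even, the \<open>k\<close>-th power of the length is a
      polynomial in \<open>s\<close>.\<close>
    have "norm ?u ^ 2 = 1 + s\<^sup>2"
      unfolding power2_norm_eq_inner
      using assms by (simp add: inner_add_left inner_add_right inner_axis_axis power2_eq_square)
    then have nk: "norm ?u ^ k = (1 + s\<^sup>2) ^ (r + 1)" unfolding k_def r power_mult by simp
    have "norm ?u ^ k * zonal_moment TYPE('n) k = sphere_avg (\<lambda>y. (?u \<bullet> y) ^ k)"
      by (rule sphere_avg_inner_power[symmetric])
    also have "\<dots> = sphere_avg (\<lambda>y. \<Sum>l\<le>k. (of_nat (k choose l) * s ^ l) * ((y $ i) ^ (k - l) * (y $ j) ^ l))"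
    proof -
      have "(?u \<bullet> y) ^ k = (s * y $ j + y $ i) ^ k" for y
        by (simp add: inner_add_left inner_axis' add.commute)
      then show ?thesis by (simp add: binomial_ring power_mult_distrib mult_ac)
    qed
    also have "\<dots> = (\<Sum>l\<le>k. (of_nat (k choose l) * s ^ l) * E l)"
      unfolding E_def sphere_avg_mult[symmetric]
      by (rule sphere_avg_sum) (auto intro!: continuous_intros)
    also have "\<dots> = poly p s" by (simp add: p_def poly_sum poly_monom mult_ac)
    finally have "poly p s = zonal_moment TYPE('n) k * (1 + s\<^sup>2) ^ (r + 1)" using nk by (simp add: mult.commute)
    moreover have "poly [:1, 0, 1:] s = 1 + s\<^sup>2" by (simp add: power2_eq_square)
    ultimately show ?thesis by (simp only: poly_smult poly_power)
  qed
  then have "p = smult (zonal_moment TYPE('n) k) ([:1, 0, 1:] ^ (r + 1))" by (simp add: poly_eq_poly_eq_iff[symmetric] fun_eq_iff)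
  then have "coeff p 2 = zonal_moment TYPE('n) k * real (r + 1)" by (simp only: coeff_smult coeff_one_plus_square_power)
  moreover have "coeff p 2 = of_nat (k choose 2) * E 2"
  proof -
    have "2 \<le> k" by (simp add: k_def)
    then show ?thesis by (simp add: p_def coeff_sum coeff_monom)
  qed
  moreover have "real (k choose 2) = real (r + 1) * real (m + 1)"
  proof -
    have "k choose 2 = (r + 1) * (m + 1)" unfolding choose_two k_def r using r by (simp add: mult.assoc)
    then show ?thesis by (metis of_nat_mult)
  qed
  ultimately have "real (r + 1) * (real (m + 1) * E 2) = real (r + 1) * zonal_moment TYPE('n) k" by (simp add: mult_ac)
  then have "real (m + 1) * E 2 = zonal_moment TYPE('n) k" by (simp only: mult_left_cancel)
  then show ?thesis by (simp add: E_def k_def)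
qed

text \<open>Squares of coordinates sum to 1 on the sphere. Inserting this sum into the average of a
  power of one coordinate gives the moment of order \<open>m + 2\<close> once from that coordinate,
  and \<open>1 / (m + 1)\<close> times it from each of the others.\<close>

lemma zonal_moment_rec:
  "(real CARD('n) + real m) * zonal_moment TYPE('n::finite) (m + 2) = (real m + 1) * zonal_moment TYPE('n) m"
proof -
  let ?i = "undefined :: 'n"
  have "zonal_moment TYPE('n) m = sphere_avg (\<lambda>y :: real^'n. (y $ ?i) ^ m * (\<Sum>j\<in>UNIV. (y $ j) ^ 2))"
    unfolding zonal_moment_def
    by (rule sphere_avg_cong) (simp add: norm_eq_sqrt_inner inner_vec_def power2_eq_square)
  also have "\<dots> = (\<Sum>j\<in>UNIV. sphere_avg (\<lambda>y :: real^'n. (y $ ?i) ^ m * (y $ j) ^ 2))"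
    unfolding sum_distrib_left by (rule sphere_avg_sum) (auto intro!: continuous_intros)
  also have "\<dots> = zonal_moment TYPE('n) (m + 2) + (\<Sum>j\<in>UNIV - {?i}. sphere_avg (\<lambda>y :: real^'n. (y $ ?i) ^ m * (y $ j) ^ 2))"
    by (subst sum.remove[of UNIV ?i]) (simp_all add: zonal_moment_def power_add[symmetric])
  also have "(\<Sum>j\<in>UNIV - {?i}. sphere_avg (\<lambda>y :: real^'n. (y $ ?i) ^ m * (y $ j) ^ 2))
     = (\<Sum>j\<in>UNIV - {?i}. zonal_moment TYPE('n) (m + 2) / real (m + 1))"
    by (intro sum.cong refl) (use sphere_avg_mixed[of ?i _ m] in \<open>auto simp: field_simps\<close>)
  also have "\<dots> = (real CARD('n) - 1) * zonal_moment TYPE('n) (m + 2) / real (m + 1)"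
    by (simp add: card_Diff_singleton of_nat_diff)
  finally show ?thesis by (simp add: field_simps)
qed

section \<open>Moments of the ultraspherical weight by integration by parts\<close>

definition ultra_weight :: "nat \<Rightarrow> real \<Rightarrow> real" where
  "ultra_weight n t = (1 - t\<^sup>2) powr ((real n - 3) / 2)"

definition ultra_moment :: "nat \<Rightarrow> nat \<Rightarrow> real" where
  "ultra_moment n m = integral {-1..1} (\<lambda>t. ultra_weight n t * t ^ m)"

lemma one_minus_square_nonneg: "t \<in> {-1..1} \<Longrightarrow> 0 \<le> 1 - (t::real)\<^sup>2"
  by (simp add: abs_square_le_1 abs_le_iff)

text \<open>The integrand is the derivative of \<open>t ^ m * (1 - t^2) powr ((n - 1) / 2)\<close>,
  which vanishes at both ends as \<open>n \<ge> 2\<close>. For \<open>n = 2\<close> the weight is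
  unbounded near the ends, and this identity is also the source of integrability. For
  \<open>m = 0\<close> the truncated exponent \<open>m - 1\<close> carries the coefficient
  0.\<close>

lemma has_integral_ultra_weight_deriv:
  assumes n: "n \<ge> 2"
  shows "((\<lambda>t. real m * t ^ (m - 1) * (1 - t\<^sup>2) powr ((real n - 1) / 2)
      - (real n - 1) * (ultra_weight n t * t ^ (m + 1))) has_integral 0) {-1..1}"
proof -
  define \<alpha> where "\<alpha> = (real n - 1) / 2"
  have \<alpha>: "\<alpha> > 0" using n by (simp add: \<alpha>_def)
  let ?f = "\<lambda>t::real. t ^ m * (1 - t\<^sup>2) powr \<alpha>"
  have "((\<lambda>t. real m * t ^ (m - 1) * (1 - t\<^sup>2) powr \<alpha> - (real n - 1) * (ultra_weight n t * t ^ (m + 1)))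
      has_integral (?f 1 - ?f (- 1))) {-1..1}"
  proof (rule fundamental_theorem_of_calculus_interior[where f = ?f])
    show "continuous_on {-1..1} ?f"
      using \<alpha> one_minus_square_nonneg
      by (intro continuous_on_mult continuous_on_power continuous_on_id continuous_on_powr' continuous_on_diff continuous_on_const) auto
    fix t :: real assume t: "t \<in> {-1<..<1}"
    then have pos: "1 - t\<^sup>2 > 0" by (simp add: abs_square_less_1 abs_less_iff)
    have der: "(?f has_real_derivative (real m * t ^ (m - 1) * (1 - t\<^sup>2) powr \<alpha>
        + t ^ m * (\<alpha> * (1 - t\<^sup>2) powr (\<alpha> - 1) * (- (2 * t))))) (at t)"
      using pos by (auto intro!: derivative_eq_intros)
    have \<alpha>1: "\<alpha> - 1 = (real n - 3) / 2" by (simp add: \<alpha>_def field_simps)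
    have eq: "t ^ m * (\<alpha> * (1 - t\<^sup>2) powr (\<alpha> - 1) * (- (2 * t))) = - ((real n - 1) * (ultra_weight n t * t ^ (m + 1)))"
      by (simp only: ultra_weight_def \<alpha>1) (simp add: \<alpha>_def)
    show "(?f has_vector_derivative real m * t ^ (m - 1) * (1 - t\<^sup>2) powr \<alpha>
        - (real n - 1) * (ultra_weight n t * t ^ (m + 1))) (at t)"
      using der unfolding eq has_real_derivative_iff_has_vector_derivative by (simp only: diff_conv_add_uminus)
  qed simp
  then show ?thesis using \<alpha> by (simp add: \<alpha>_def)
qed

lemma integrable_one_minus_square:
  assumes "n \<ge> 2"
  shows "(\<lambda>t::real. t ^ m * (1 - t\<^sup>2) powr ((real n - 1) / 2)) integrable_on {-1..1}"
  using assms one_minus_square_nonneg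
  by (intro integrable_continuous_real continuous_on_mult continuous_on_power continuous_on_id
      continuous_on_powr' continuous_on_diff continuous_on_const) auto

text \<open>This includes the endpoints, where \<open>0 powr x = 0\<close> makes both sides
  vanish.\<close>

lemma ultra_weight_mult:
  assumes "t \<in> {-1..1}"
  shows "(1 - t\<^sup>2) powr ((real n - 1) / 2) = ultra_weight n t * (1 - t\<^sup>2)"
proof -
  have "(1 - t\<^sup>2) powr ((real n - 3) / 2 + 1) = (1 - t\<^sup>2) powr ((real n - 3) / 2) * (1 - t\<^sup>2)"
    using one_minus_square_nonneg[OF assms] by (simp add: powr_add)
  moreover have "(real n - 3) / 2 + 1 = (real n - 1) / 2" by (simp add: field_simps)
  ultimately show ?thesis by (simp add: ultra_weight_def)
qed

lemma integrable_ultra_weight_power: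
  assumes n: "n \<ge> 2"
  shows "(\<lambda>t. ultra_weight n t * t ^ m) integrable_on {-1..1}"
proof -
  have pos: "(\<lambda>t. ultra_weight n t * t ^ (m + 1)) integrable_on {-1..1}" for m
  proof -
    have "(\<lambda>t. real m * (t ^ (m - 1) * (1 - t\<^sup>2) powr ((real n - 1) / 2))
      - (real m * t ^ (m - 1) * (1 - t\<^sup>2) powr ((real n - 1) / 2)
      - (real n - 1) * (ultra_weight n t * t ^ (m + 1)))) integrable_on {-1..1}"
      by (intro Henstock_Kurzweil_Integration.integrable_diff integrable_on_mult_right integrable_one_minus_square[OF n]
          has_integral_integrable[OF has_integral_ultra_weight_deriv[OF n]])
    then have "(\<lambda>t. (real n - 1) * (ultra_weight n t * t ^ (m + 1))) integrable_on {-1..1}"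
      by (simp add: mult.assoc)
    then have "(\<lambda>t. (1 / (real n - 1)) * ((real n - 1) * (ultra_weight n t * t ^ (m + 1)))) integrable_on {-1..1}"
      by (rule integrable_on_mult_right)
    then show ?thesis using n by simp
  qed
  show ?thesis
  proof (cases m)
    case 0
    \<comment> \<open>The exponent 0 is outside the reach of \<open>pos\<close>; the weight is split
      by \<open>1 = (1 - t^2) + t^2\<close>.\<close>
    have "(\<lambda>t. ultra_weight n t * t\<^sup>2) integrable_on {-1..1}"
      using pos[of 1] by (simp only: one_add_one)
    then have "(\<lambda>t. t ^ 0 * (1 - t\<^sup>2) powr ((real n - 1) / 2) + ultra_weight n t * t\<^sup>2) integrable_on {-1..1}"
      by (intro Henstock_Kurzweil_Integration.integrable_add integrable_one_minus_square[OF n])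
    then have "(\<lambda>t. ultra_weight n t * t ^ 0) integrable_on {-1..1}"
      by (rule integrable_eq) (simp add: ultra_weight_mult right_diff_distrib)
    then show ?thesis using 0 by simp
  qed (use pos in simp)
qed

lemma integrable_ultra_weight_poly:
  assumes n: "n \<ge> 2"
  shows "(\<lambda>t. ultra_weight n t * poly p t) integrable_on {-1..1}"
proof -
  have "(\<lambda>t. \<Sum>i\<le>degree p. coeff p i * (ultra_weight n t * t ^ i)) integrable_on {-1..1}"
    by (intro integrable_sum integrable_on_mult_right integrable_ultra_weight_power n) auto
  then show ?thesis by (simp add: poly_altdef sum_distrib_left mult_ac)
qed

lemma ultra_moment_1:
  assumes n: "n \<ge> 2"
  shows "ultra_moment n 1 = 0"
proof -
  have "((\<lambda>t. - (real n - 1) * (ultra_weight n t * t ^ 1)) has_integral 0) {-1..1}"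
    by (rule has_integral_eq[OF _ has_integral_ultra_weight_deriv[OF n, of 0]]) (simp add: algebra_simps)
  moreover have "((\<lambda>t. - (real n - 1) * (ultra_weight n t * t ^ 1)) has_integral - (real n - 1) * ultra_moment n 1) {-1..1}"
    unfolding ultra_moment_def by (intro has_integral_mult_right integrable_integral integrable_ultra_weight_power n)
  ultimately have "- (real n - 1) * ultra_moment n 1 = 0" by (rule has_integral_unique[symmetric])
  then show ?thesis using n by simp
qed

lemma ultra_moment_rec:
  assumes n: "n \<ge> 2"
  shows "(real n + real m) * ultra_moment n (m + 2) = (real m + 1) * ultra_moment n m"
proof -
  have "((\<lambda>t. real (m + 1) * t ^ m * (1 - t\<^sup>2) powr ((real n - 1) / 2)
      - (real n - 1) * (ultra_weight n t * t ^ (m + 2))) has_integral 0) {-1..1}"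
    using has_integral_ultra_weight_deriv[OF n, of "m + 1"] by simp
  then have "((\<lambda>t. real (m + 1) * (ultra_weight n t * t ^ m) - (real n + real m) * (ultra_weight n t * t ^ (m + 2))) has_integral 0) {-1..1}"
    by (rule has_integral_eq[rotated]) (simp add: ultra_weight_mult power_add, simp add: algebra_simps power2_eq_square)
  moreover have "((\<lambda>t. real (m + 1) * (ultra_weight n t * t ^ m) - (real n + real m) * (ultra_weight n t * t ^ (m + 2)))
    has_integral (real (m + 1) * ultra_moment n m - (real n + real m) * ultra_moment n (m + 2))) {-1..1}"
    unfolding ultra_moment_def
    by (intro has_integral_diff has_integral_mult_right integrable_integral integrable_ultra_weight_power n)
  ultimately have "real (m + 1) * ultra_moment n m - (real n + real m) * ultra_moment n (m + 2) = 0"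
    by (rule has_integral_unique[symmetric])
  then show ?thesis by (simp add: algebra_simps)
qed

lemma ultra_weight_pos: "t \<in> {-1<..<1} \<Longrightarrow> ultra_weight n t > 0"
  by (simp add: ultra_weight_def abs_square_less_1 abs_less_iff) (metis abs_less_iff abs_square_less_1 less_irrefl minus_less_iff)

lemma ultra_weight_nonneg: "ultra_weight n t \<ge> 0"
  by (simp add: ultra_weight_def)

text \<open>On \<open>{-1/2..1/2}\<close> the weight is continuous and positive, so an integral
  equal to 0 makes \<open>p\<close> vanish on an infinite set.\<close>

lemma integral_ultra_weight_poly_eq_0:
  assumes n: "n \<ge> 2" and nonneg: "\<And>t. t \<in> {-1..1} \<Longrightarrow> poly p t \<ge> 0"
    and zero: "integral {-1..1} (\<lambda>t. ultra_weight n t * poly p t) = 0"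
  shows "p = 0"
proof -
  let ?f = "\<lambda>t. ultra_weight n t * poly p t"
  have pos: "0 \<le> ?f t" if "t \<in> {-1..1}" for t
    using nonneg[OF that] ultra_weight_nonneg by simp
  have sub: "{-1/2..1/2} \<subseteq> {-1..1::real}" by auto
  have int: "?f integrable_on {-1/2..1/2}"
    using integrable_on_subinterval[OF integrable_ultra_weight_poly[OF n] sub] by blast
  have "integral {-1/2..1/2} ?f \<le> integral {-1..1} ?f"
    by (intro integral_subset_le sub int integrable_ultra_weight_poly n) (use pos in auto)
  moreover have "0 \<le> integral {-1/2..1/2} ?f"
    by (intro integral_nonneg int) (use pos in auto)
  ultimately have z: "integral {-1/2..1/2} ?f = 0" using zero by simp
  have cont: "continuous_on {-1/2..1/2} ?f"
  proof -
    have "x\<^sup>2 < 1" if "x \<in> {-1/2..1/2}" for x :: real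
      using that by (simp add: abs_square_less_1 abs_less_iff)
    then have "1 - x\<^sup>2 \<noteq> 0" if "x \<in> {-1/2..1/2}" for x :: real using that by fastforce
    then show ?thesis unfolding ultra_weight_def
      by (intro continuous_on_mult continuous_on_powr continuous_on_poly continuous_on_diff continuous_on_const
          continuous_on_power continuous_on_id) auto
  qed
  have fz: "?f t = 0" if "t \<in> {-1/2..1/2}" for t
    using integral_eq_0_iff[OF cont] z pos that by auto
  have "{-1/2..1/2} \<subseteq> {t. poly p t = 0}"
  proof
    fix t :: real assume t: "t \<in> {-1/2..1/2}"
    then have "ultra_weight n t > 0" by (intro ultra_weight_pos) auto
    then show "t \<in> {t. poly p t = 0}" using fz[OF t] by simp
  qed
  moreover have "infinite {-1/2..1/2::real}" by simp
  ultimately have "infinite {t. poly p t = 0}" using finite_subset by blast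
  then show "p = 0" using poly_roots_finite by blast
qed

lemma ultra_moment_0_pos:
  assumes n: "n \<ge> 2"
  shows "ultra_moment n 0 > 0"
proof -
  have "ultra_moment n 0 \<ge> 0" unfolding ultra_moment_def
    by (rule integral_nonneg[OF integrable_ultra_weight_power[OF n]]) (simp add: ultra_weight_nonneg)
  moreover have "ultra_moment n 0 \<noteq> 0"
    using integral_ultra_weight_poly_eq_0[OF n, of 1] by (auto simp: ultra_moment_def)
  ultimately show ?thesis by simp
qed

text \<open>Both sequences obey the same two-step recursion and are proportional in orders 0 and 1.
  This identifies the image of surface measure on an axis through its moments.\<close>

lemma ultra_moment_zonal:
  assumes "CARD('n::finite) = n" "n \<ge> 2"
  shows "ultra_moment n m = zonal_moment TYPE('n) m * ultra_moment n 0"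
proof (induction m rule: induct_nat_012)
  case (ge2 m)
  have "(real n + real m) * ultra_moment n (m + 2) = (real m + 1) * (zonal_moment TYPE('n) m * ultra_moment n 0)"
    using ultra_moment_rec[OF assms(2), of m] ge2 by simp
  also have "\<dots> = (real n + real m) * (zonal_moment TYPE('n) (m + 2) * ultra_moment n 0)"
    using zonal_moment_rec[of m, where ?'n = 'n] assms(1) by (metis mult.assoc)
  finally have "ultra_moment n (m + 2) = zonal_moment TYPE('n) (m + 2) * ultra_moment n 0"
    using assms(2) by simp
  then show ?case by simp
qed (use ultra_moment_1[OF assms(2)] in \<open>auto simp: zonal_moment_0 zonal_moment_odd\<close>)

lemma mu_int_poly_eq:
  "mu_int n (poly p) = integral {-1..1} (\<lambda>t. ultra_weight n t * poly p t) / ultra_moment n 0"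
  by (simp add: mu_int_def ultra_weight_def ultra_moment_def)

lemma mu_int_poly:
  assumes "CARD('n::finite) = n" "n \<ge> 2"
  shows "mu_int n (poly p) = (\<Sum>i\<le>degree p. coeff p i * zonal_moment TYPE('n) i)"
proof -
  have "integral {-1..1} (\<lambda>t. ultra_weight n t * poly p t)
      = integral {-1..1} (\<lambda>t. \<Sum>i\<le>degree p. coeff p i * (ultra_weight n t * t ^ i))"
    by (simp add: poly_altdef sum_distrib_left mult_ac)
  also have "\<dots> = (\<Sum>i\<le>degree p. integral {-1..1} (\<lambda>t. coeff p i * (ultra_weight n t * t ^ i)))"
    by (intro integral_sum integrable_on_mult_right integrable_ultra_weight_power assms(2)) auto
  also have "\<dots> = (\<Sum>i\<le>degree p. coeff p i * zonal_moment TYPE('n) i) * ultra_moment n 0"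
    unfolding sum_distrib_right
    by (intro sum.cong refl, subst integral_mult_right)
      (use ultra_moment_zonal[OF assms] in \<open>simp add: ultra_moment_def\<close>)
  finally show ?thesis
    using ultra_moment_0_pos[OF assms(2)] by (simp add: mu_int_poly_eq)
qed

lemma mu_int_nonneg_poly_eq_0:
  assumes n: "n \<ge> 2" and "\<And>t. t \<in> {-1..1} \<Longrightarrow> poly p t \<ge> 0" and "mu_int n (poly p) = 0"
  shows "p = 0"
  using assms ultra_moment_0_pos[OF n]
  by (intro integral_ultra_weight_poly_eq_0[OF n]) (auto simp: mu_int_poly_eq)

section \<open>Zonal polynomials averaged over a design\<close>

lemma poly_funs_upto_add:
  assumes "p \<in> poly_funs_upto d" "q \<in> poly_funs_upto d"
  shows "(\<lambda>x. p x + q x) \<in> poly_funs_upto d"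
proof -
  obtain A c where A: "finite A" "\<forall>a\<in>A. total_degree a \<le> d" "p = (\<lambda>x. \<Sum>a\<in>A. c a * monomial_fun a x)"
    using assms(1) by (auto simp: poly_funs_upto_def)
  obtain B e where B: "finite B" "\<forall>a\<in>B. total_degree a \<le> d" "q = (\<lambda>x. \<Sum>a\<in>B. e a * monomial_fun a x)"
    using assms(2) by (auto simp: poly_funs_upto_def)
  let ?c = "\<lambda>a. (if a \<in> A then c a else 0) + (if a \<in> B then e a else 0)"
  have "p x + q x = (\<Sum>a\<in>A \<union> B. ?c a * monomial_fun a x)" for x
  proof -
    have "p x = (\<Sum>a\<in>A \<union> B. (if a \<in> A then c a else 0) * monomial_fun a x)"
      unfolding A(3) using A(1) B(1) by (intro sum.mono_neutral_cong_left) auto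
    moreover have "q x = (\<Sum>a\<in>A \<union> B. (if a \<in> B then e a else 0) * monomial_fun a x)"
      unfolding B(3) using A(1) B(1) by (intro sum.mono_neutral_cong_left) auto
    ultimately show ?thesis by (simp add: distrib_right sum.distrib)
  qed
  then show ?thesis unfolding poly_funs_upto_def
    using A B by (intro CollectI exI[of _ "A \<union> B"] exI[of _ ?c]) auto
qed

lemma poly_funs_upto_const: "(\<lambda>x. k) \<in> poly_funs_upto d"
  unfolding poly_funs_upto_def
  by (intro CollectI exI[of _ "{\<lambda>_. 0}"] exI[of _ "\<lambda>_. k"]) (auto simp: total_degree_def monomial_fun_def)

lemma poly_funs_upto_sum:
  "finite I \<Longrightarrow> (\<And>i. i \<in> I \<Longrightarrow> f i \<in> poly_funs_upto d) \<Longrightarrow> (\<lambda>x. \<Sum>i\<in>I. f i x) \<in> poly_funs_upto d"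
  by (induction I rule: finite_induct) (auto simp: poly_funs_upto_const poly_funs_upto_add)

lemma monomial_fun_inc: "monomial_fun (a(i := a i + 1)) x = x $ i * monomial_fun a x"
proof -
  have "(\<Prod>j\<in>UNIV - {i}. (x $ j) ^ (a(i := a i + 1)) j) = (\<Prod>j\<in>UNIV - {i}. (x $ j) ^ a j)"
    by (intro prod.cong) auto
  then show ?thesis
    unfolding monomial_fun_def by (subst (1 2) prod.remove[of UNIV i]) auto
qed

lemma total_degree_inc: "total_degree (a(i := a i + 1)) = total_degree a + 1"
proof -
  have "(\<Sum>j\<in>UNIV - {i}. (a(i := a i + 1)) j) = (\<Sum>j\<in>UNIV - {i}. a j)"
    by (intro sum.cong) auto
  then show ?thesis
    unfolding total_degree_def by (subst (1 2) sum.remove[of UNIV i]) auto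
qed

lemma poly_funs_upto_coord:
  assumes "p \<in> poly_funs_upto d"
  shows "(\<lambda>x. k * (x $ i * p x)) \<in> poly_funs_upto (d + 1)"
proof -
  obtain A c where A: "finite A" "\<forall>a\<in>A. total_degree a \<le> d" "p = (\<lambda>x. \<Sum>a\<in>A. c a * monomial_fun a x)"
    using assms(1) by (auto simp: poly_funs_upto_def)
  have one: "(\<lambda>x. k * (x $ i * (c a * monomial_fun a x))) \<in> poly_funs_upto (d + 1)" if "a \<in> A" for a
    unfolding poly_funs_upto_def
    by (intro CollectI exI[of _ "{a(i := a i + 1)}"] exI[of _ "\<lambda>_. k * c a"])
      (use A(2) that in \<open>auto simp: total_degree_inc[unfolded One_nat_def add_Suc_right add_0_right] monomial_fun_inc[unfolded One_nat_def add_Suc_right add_0_right] mult_ac\<close>)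
  have "(\<lambda>x. k * (x $ i * p x)) = (\<lambda>x. \<Sum>a\<in>A. k * (x $ i * (c a * monomial_fun a x)))"
    by (simp add: A(3) sum_distrib_left)
  then show ?thesis using poly_funs_upto_sum[OF A(1) one] by simp
qed

lemma poly_funs_upto_inner_power: "(\<lambda>y :: real^'n. (u \<bullet> y) ^ m) \<in> poly_funs_upto m"
proof (induction m)
  case (Suc m)
  have "(\<lambda>y :: real^'n. (u \<bullet> y) ^ Suc m) = (\<lambda>y. \<Sum>i\<in>UNIV. u $ i * (y $ i * (u \<bullet> y) ^ m))"
    by (simp add: inner_vec_def[of u] sum_distrib_right mult_ac)
  then show ?case using poly_funs_upto_sum[of UNIV "\<lambda>i y. u $ i * (y $ i * (u \<bullet> y) ^ m)", OF _ poly_funs_upto_coord[OF Suc]]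
    by simp
qed (simp add: poly_funs_upto_const)

lemma poly_funs_upto_mono: "d \<le> e \<Longrightarrow> poly_funs_upto d \<subseteq> poly_funs_upto e"
  unfolding poly_funs_upto_def by (blast intro: order_trans)

lemma design_power_sum:
  fixes C :: "(real^'n) set"
  assumes "spherical_design \<tau> C" "m \<le> \<tau>"
  shows "(\<Sum>y\<in>C. (x \<bullet> y) ^ m) = real (card C) * (norm x ^ m * zonal_moment TYPE('n) m)"
proof -
  have "(\<lambda>y. (x \<bullet> y) ^ m) \<in> poly_funs_upto \<tau>"
    using poly_funs_upto_inner_power poly_funs_upto_mono[OF assms(2)] by blast
  then have "(\<Sum>y\<in>C. (x \<bullet> y) ^ m) / real (card C) = norm x ^ m * zonal_moment TYPE('n) m"
    using assms(1) unfolding spherical_design_def sphere_avg_inner_power[symmetric] by blast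
  moreover have "card C > 0" using assms(1) by (auto simp: spherical_design_def card_gt_0_iff)
  ultimately show ?thesis by (simp add: field_simps)
qed

text \<open>The bridge from the code to the interval: power sums over a design are zonal moments,
  and these are the moments behind \<open>mu_int\<close>.\<close>

lemma design_quadrature:
  fixes C :: "(real^'n) set"
  assumes C: "spherical_design \<tau> C" and x: "norm x = 1" and p: "degree p \<le> \<tau>"
    and n: "CARD('n) = n" "n \<ge> 2"
  shows "(\<Sum>y\<in>C. poly p (x \<bullet> y)) = real (card C) * mu_int n (poly p)"
proof -
  have "(\<Sum>y\<in>C. poly p (x \<bullet> y)) = (\<Sum>i\<le>degree p. \<Sum>y\<in>C. coeff p i * (x \<bullet> y) ^ i)"
    unfolding poly_altdef by (rule sum.swap)
  also have "\<dots> = (\<Sum>i\<le>degree p. coeff p i * (real (card C) * zonal_moment TYPE('n) i))"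
    unfolding sum_distrib_left[symmetric] using p x
    by (intro sum.cong refl) (subst design_power_sum[OF C], auto)
  also have "\<dots> = real (card C) * mu_int n (poly p)"
    unfolding mu_int_poly[OF n] sum_distrib_left by (intro sum.cong) auto
  finally show ?thesis .
qed

lemma zonal_moment_2: "zonal_moment TYPE('n::finite) 2 = 1 / CARD('n)"
  using zonal_moment_rec[of 0, where ?'n = 'n] by (simp add: zonal_moment_0 field_simps numeral_2_eq_2)

lemma zonal_moment_4: "zonal_moment TYPE('n::finite) 4 = 3 / (CARD('n) * (CARD('n) + 2))"
proof -
  have "(real CARD('n) + 2) * zonal_moment TYPE('n) 4 = 3 / CARD('n)"
    using zonal_moment_rec[of 2, where ?'n = 'n] by (simp add: zonal_moment_2)
  then have "zonal_moment TYPE('n) 4 = 3 / CARD('n) / (real CARD('n) + 2)"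
    by (subst eq_divide_eq) (simp add: mult.commute)
  then show ?thesis by (simp add: algebra_simps)
qed

lemma zonal_moment_6: "zonal_moment TYPE('n::finite) 6 = 15 / (CARD('n) * (CARD('n) + 2) * (CARD('n) + 4))"
proof -
  have "(real CARD('n) + 4) * zonal_moment TYPE('n) 6 = 15 / (CARD('n) * (CARD('n) + 2))"
    using zonal_moment_rec[of 4, where ?'n = 'n] by (simp add: zonal_moment_4)
  then have "zonal_moment TYPE('n) 6 = 15 / (CARD('n) * (CARD('n) + 2)) / (real CARD('n) + 4)"
    by (subst eq_divide_eq) (simp add: mult.commute)
  then show ?thesis by (simp add: algebra_simps)
qed

section \<open>Hermite interpolation and the universal minimum\<close>

text \<open>Rolle between neighbours, with the largest point split off in the induction. The new
  zeros avoid \<open>S\<close>, so that they can be counted together with double zeros, and they are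
  interior, so that \<open>S\<close> may contain endpoints, where only continuity is known.\<close>

lemma rolle_finite_set:
  fixes f f' :: "real \<Rightarrow> real"
  assumes "finite S" "card S = Suc m" "S \<subseteq> {l..u}" "continuous_on {l..u} f"
    and "\<And>t. t \<in> {l<..<u} \<Longrightarrow> (f has_real_derivative f' t) (at t)" "\<And>s. s \<in> S \<Longrightarrow> f s = 0"
  shows "\<exists>S'. finite S' \<and> card S' = m \<and> S' \<inter> S = {} \<and> S' \<subseteq> {l<..<Max S} \<and> (\<forall>s\<in>S'. f' s = 0)"
  using assms
proof (induction m arbitrary: S)
  case 0
  then show ?case by (intro exI[of _ "{}"]) auto
next
  case (Suc m)
  define M where "M = Max S"
  define S1 where "S1 = S - {M}"
  have ne: "S \<noteq> {}" using Suc.prems by auto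
  have M: "M \<in> S" "\<And>s. s \<in> S \<Longrightarrow> s \<le> M" using Suc.prems ne by (auto simp: M_def)
  have S1: "finite S1" "card S1 = Suc m" "S1 \<subseteq> {l..u}" using Suc.prems M by (auto simp: S1_def)
  then obtain S' where S': "finite S'" "card S' = m" "S' \<inter> S1 = {}" "S' \<subseteq> {l<..<Max S1}" "\<forall>s\<in>S'. f' s = 0"
    using Suc.IH[of S1] Suc.prems(4-6) by (auto simp: S1_def)
  have "S1 \<noteq> {}" using S1 by auto
  then have M1: "Max S1 \<in> S1" "\<And>s. s \<in> S1 \<Longrightarrow> s \<le> Max S1" using S1 by auto
  then have lt: "Max S1 < M" using M by (auto simp: S1_def order_less_le)
  have bnds: "l \<le> Max S1" "M \<le> u" using M1 S1 M Suc.prems(3) by auto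
  have "\<exists>z. Max S1 < z \<and> z < M \<and> f' z = 0"
  proof -
    have "\<exists>z>Max S1. z < M \<and> (\<lambda>h. h * f' z) = (\<lambda>v. 0)"
    proof (rule Rolle_deriv[OF lt, of f "\<lambda>z h. h * f' z"])
      show "f (Max S1) = f M" using M1 M Suc.prems(6) by (auto simp: S1_def)
      show "continuous_on {Max S1..M} f"
        using Suc.prems(4) bnds by (auto intro: continuous_on_subset)
      show "(f has_derivative (\<lambda>h. h * f' x)) (at x)" if "Max S1 < x" "x < M" for x
        using Suc.prems(5)[of x] that bnds by (simp add: has_field_derivative_def mult_commute_abs)
    qed
    then obtain z where z: "z > Max S1" "z < M" "(\<lambda>h. h * f' z) = (\<lambda>v. 0)" by blast
    from fun_cong[OF z(3), of 1] show ?thesis using z by auto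
  qed
  then obtain z where z: "Max S1 < z" "z < M" "f' z = 0" by blast
  have "z \<notin> S'" using S'(4) z by auto
  moreover have "z \<notin> S" using z M1(2)[of z] by (auto simp: S1_def)
  moreover have "S' \<inter> S = {}" using S'(3,4) lt by (auto simp: S1_def)
  ultimately show ?case
    using S' z lt bnds by (intro exI[of _ "insert z S'"]) (auto simp flip: M_def)
qed

lemma rolle_iterated:
  fixes g :: "nat \<Rightarrow> real \<Rightarrow> real"
  assumes "finite S" "card S = Suc m" "S \<subseteq> {l<..<u}"
    and "\<And>i t. i < m \<Longrightarrow> t \<in> {l<..<u} \<Longrightarrow> (g i has_real_derivative g (Suc i) t) (at t)"
    and "\<And>s. s \<in> S \<Longrightarrow> g 0 s = 0"
  shows "\<exists>\<xi>\<in>{l<..<u}. g m \<xi> = 0"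
  using assms
proof (induction m arbitrary: g S)
  case 0
  then obtain s where "s \<in> S" by (metis card.empty ex_in_conv old.nat.distinct(1))
  then show ?case using 0 by blast
next
  case (Suc m)
  have ne: "S \<noteq> {}" using Suc.prems by auto
  have sub: "S \<subseteq> {Min S..Max S}" using Suc.prems ne by auto
  have mm: "l < Min S" "Max S < u" using Suc.prems ne by auto
  have "continuous_on {Min S..Max S} (g 0)"
  proof (rule DERIV_atLeastAtMost_imp_continuous_on)
    fix x assume "Min S \<le> x" "x \<le> Max S"
    then have "(g 0 has_real_derivative g (Suc 0) x) (at x)" using Suc.prems(4)[of 0 x] mm by auto
    then show "\<exists>y. (g 0 has_real_derivative y) (at x)" by blast
  qed
  then obtain S' where S': "finite S'" "card S' = Suc m" "S' \<subseteq> {Min S<..<Max S}" "\<forall>s\<in>S'. g (Suc 0) s = 0"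
    using rolle_finite_set[OF Suc.prems(1,2) sub, of "g 0" "g (Suc 0)"] Suc.prems(4)[of 0] Suc.prems(5) mm by auto
  have "\<exists>\<xi>\<in>{l<..<u}. g (Suc m) \<xi> = 0"
    by (rule Suc.IH[of S' "\<lambda>i. g (Suc i)"]) (use S' mm Suc.prems(4) in \<open>auto simp: subset_iff\<close>)
  then show ?case .
qed

text \<open>The derivative has \<open>card S - 1\<close> zeros away from \<open>S\<close> and
  \<open>card d\<close> more at the double points, together \<open>m + 1\<close>, which is enough
  for \<open>m\<close> further applications of Rolle.\<close>

lemma rolle_double_zeros:
  fixes g :: "nat \<Rightarrow> real \<Rightarrow> real"
  assumes S: "finite S" "S \<subseteq> {l..u}" "S \<noteq> {}" and d: "d \<subseteq> S" "d \<subseteq> {l<..<u}"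
    and card: "card S + card d = m + 2"
    and cont: "continuous_on {l..u} (g 0)"
    and der: "\<And>i t. i \<le> m \<Longrightarrow> t \<in> {l<..<u} \<Longrightarrow> (g i has_real_derivative g (Suc i) t) (at t)"
    and zero: "\<And>s. s \<in> S \<Longrightarrow> g 0 s = 0" "\<And>s. s \<in> d \<Longrightarrow> g 1 s = 0"
  shows "\<exists>\<xi>\<in>{l<..<u}. g (Suc m) \<xi> = 0"
proof -
  obtain c where c: "card S = Suc c" using S by (metis card_gt_0_iff gr0_implies_Suc)
  have "Max S \<le> u" using S by auto
  obtain S' where S': "finite S'" "card S' = c" "S' \<inter> S = {}" "S' \<subseteq> {l<..<Max S}" "\<forall>s\<in>S'. g 1 s = 0"
    using rolle_finite_set[OF S(1) c S(2) cont, of "g 1"] der[of 0] zero by auto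
  have "finite d" using d S finite_subset by blast
  have "card (S' \<union> d) = Suc m"
    using S' d \<open>finite d\<close> c card by (subst card_Un_disjoint) auto
  moreover have "S' \<union> d \<subseteq> {l<..<u}" using S'(4) d \<open>Max S \<le> u\<close> by auto
  ultimately have "\<exists>\<xi>\<in>{l<..<u}. (\<lambda>i. g (Suc i)) m \<xi> = 0"
    by (intro rolle_iterated[of "S' \<union> d"]) (use S' \<open>finite d\<close> der zero in auto)
  then show ?thesis .
qed

lemma pderiv_iter_monic:
  fixes p :: "real poly"
  assumes "degree p = m" "lead_coeff p = 1"
  shows "poly ((pderiv ^^ m) p) t = fact m"
proof -
  have "degree ((pderiv ^^ i) p) = degree p - i \<and> (i \<le> degree p \<longrightarrow> coeff ((pderiv ^^ i) p) (degree p - i) = pochhammer (of_nat (degree p - i) + 1) i * lead_coeff p)" for i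
  proof (induction i)
    case (Suc i)
    then show ?case
      by (auto simp: degree_pderiv coeff_pderiv pochhammer_rec Suc_diff_le Suc_diff_Suc algebra_simps)
  qed simp
  from this[of m] assms have "degree ((pderiv ^^ m) p) = 0" "coeff ((pderiv ^^ m) p) 0 = fact m"
    by (auto simp: pochhammer_fact)
  then show ?thesis by (metis degree_0_id poly_pCons poly_0 mult_zero_right add_0_right)
qed

lemma pderiv_iter_small:
  fixes p :: "real poly"
  assumes "degree p < m"
  shows "(pderiv ^^ m) p = 0"
  using assms
proof (induction m arbitrary: p)
  case (Suc m)
  show ?case
  proof (cases "degree p = 0")
    case True
    then have "pderiv p = 0" by (simp add: pderiv_eq_0_iff)
    then show ?thesis by (simp only: funpow_Suc_right o_apply) (induction m, auto)
  next
    case False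
    then have "degree (pderiv p) < m" using Suc.prems by (simp add: degree_pderiv)
    then show ?thesis using Suc.IH by (simp only: funpow_Suc_right o_apply)
  qed
qed simp

lemma double_root:
  fixes q :: "real poly"
  assumes "p = [:- s, 1:]\<^sup>2 * q"
  shows "poly p s = 0" "poly (pderiv p) s = 0"
  unfolding assms by (simp_all only: pderiv_mult power2_eq_square poly_add poly_mult) simp_all

text \<open>The classical remainder argument: subtract from \<open>f - H\<close> the multiple of the
  node polynomial that creates one more zero at \<open>t\<close>. Only the nodes in \<open>d\<close>
  are double; a simple node may be an endpoint.\<close>

lemma hermite_error:
  fixes f :: "real \<Rightarrow> real" and D :: "nat \<Rightarrow> real \<Rightarrow> real"
  assumes S: "finite S" "S \<subseteq> {l..u}" and d: "d \<subseteq> S" "d \<subseteq> {l<..<u}"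
    and card: "card S + card d = Suc \<tau>" and H: "degree H \<le> \<tau>"
    and cont: "continuous_on {l..u} f"
    and D0: "\<And>t. t \<in> {l<..<u} \<Longrightarrow> D 0 t = f t"
    and der: "\<And>i t. i \<le> \<tau> \<Longrightarrow> t \<in> {l<..<u} \<Longrightarrow> (D i has_real_derivative D (Suc i) t) (at t)"
    and val: "\<And>s. s \<in> S \<Longrightarrow> poly H s = f s" "\<And>s. s \<in> d \<Longrightarrow> poly (pderiv H) s = D 1 s"
    and t: "t \<in> {l..u}" "t \<notin> S"
  shows "\<exists>\<xi>\<in>{l<..<u}. f t - poly H t = D (Suc \<tau>) \<xi> / fact (Suc \<tau>) * ((\<Prod>s\<in>S. t - s) * (\<Prod>s\<in>d. t - s))"
proof -
  have fd: "finite d" using d S finite_subset by blast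
  define \<Omega> :: "real poly" where "\<Omega> = (\<Prod>s\<in>S. [:- s, 1:]) * (\<Prod>s\<in>d. [:- s, 1:])"
  have \<Omega>_poly: "poly \<Omega> x = (\<Prod>s\<in>S. x - s) * (\<Prod>s\<in>d. x - s)" for x
    by (simp add: \<Omega>_def poly_prod)
  have nz: "(\<Prod>s\<in>A. [:- s, 1:]) \<noteq> (0 :: real poly)" if "finite A" for A using that by auto
  have deg: "degree (\<Prod>s\<in>A. [:- s, 1 :: real:]) = card A" if "finite A" for A
    by (subst degree_prod_eq_sum_degree) auto
  have deg\<Omega>: "degree \<Omega> = Suc \<tau>"
    unfolding \<Omega>_def using nz S fd card by (simp add: degree_mult_eq deg)
  have lead: "lead_coeff \<Omega> = 1" by (simp add: \<Omega>_def lead_coeff_mult lead_coeff_prod)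
  have \<Omega>t: "poly \<Omega> t \<noteq> 0" using t d S fd by (auto simp: \<Omega>_poly)
  define K where "K = (f t - poly H t) / poly \<Omega> t"
  \<comment> \<open>Order 0 uses \<open>f\<close> itself, because \<open>D 0\<close> is known to
    agree with it on the open interval only, while nodes may be endpoints.\<close>
  define g where "g i x = (if i = 0 then f x else D i x) - poly ((pderiv ^^ i) H) x - K * poly ((pderiv ^^ i) \<Omega>) x" for i x
  have "\<exists>\<xi>\<in>{l<..<u}. g (Suc \<tau>) \<xi> = 0"
  proof (rule rolle_double_zeros[of "insert t S" l u d])
    show "card (insert t S) + card d = \<tau> + 2" using S t card by simp
    show "continuous_on {l..u} (g 0)" unfolding g_def using cont by (auto intro!: continuous_intros)
    show "g 0 s = 0" if "s \<in> insert t S" for s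
    proof (cases "s = t")
      case True
      then show ?thesis using \<Omega>t by (simp add: g_def K_def)
    next
      case False
      then have "s \<in> S" using that by simp
      then have "poly \<Omega> s = 0" using S by (auto simp: \<Omega>_poly)
      then show ?thesis using val(1)[OF \<open>s \<in> S\<close>] by (simp add: g_def)
    qed
    show "g 1 s = 0" if s: "s \<in> d" for s
    proof -
      have "\<Omega> = [:- s, 1:]\<^sup>2 * ((\<Prod>s\<in>S - {s}. [:- s, 1:]) * (\<Prod>s\<in>d - {s}. [:- s, 1:]))"
      proof -
        have "(\<Prod>s\<in>S. [:- s, 1:]) = [:- s, 1:] * (\<Prod>s\<in>S - {s}. [:- s, 1 :: real:])"
          "(\<Prod>s\<in>d. [:- s, 1:]) = [:- s, 1:] * (\<Prod>s\<in>d - {s}. [:- s, 1 :: real:])"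
          using s d S(1) fd by (blast intro: prod.remove)+
        then show ?thesis unfolding \<Omega>_def by (simp only: power2_eq_square mult_ac)
      qed
      then have "poly (pderiv \<Omega>) s = 0" by (rule double_root)
      then show ?thesis using val(2)[OF s] by (simp add: g_def)
    qed
    fix i x assume ix: "i \<le> \<tau>" "x \<in> {l<..<u}"
    have "((\<lambda>x. (if i = 0 then f x else D i x)) has_real_derivative D (Suc i) x) (at x)"
    proof (cases "i = 0")
      case True
      have "(f has_real_derivative D (Suc 0) x) (at x) \<longleftrightarrow> (D 0 has_real_derivative D (Suc 0) x) (at x)"
        by (rule DERIV_cong_ev) (use ix D0 in \<open>auto intro!: eventually_mono[OF eventually_nhds_in_open[of "{l<..<u}" x]]\<close>)
      then show ?thesis using True der[of 0 x] ix by simp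
    qed (use der ix in auto)
    then show "(g i has_real_derivative g (Suc i) x) (at x)"
      unfolding g_def by (auto intro!: derivative_eq_intros simp del: of_nat_Suc)
  qed (use S t d in auto)
  then obtain \<xi> where \<xi>: "\<xi> \<in> {l<..<u}" "g (Suc \<tau>) \<xi> = 0" by blast
  have "(pderiv ^^ Suc \<tau>) H = 0" using H by (intro pderiv_iter_small) auto
  moreover have "poly ((pderiv ^^ Suc \<tau>) \<Omega>) \<xi> = fact (Suc \<tau>)"
    by (rule pderiv_iter_monic) (use deg\<Omega> lead in auto)
  ultimately have "D (Suc \<tau>) \<xi> = K * fact (Suc \<tau>)"
    using \<xi>(2) unfolding g_def by (simp del: funpow.simps fact_Suc)
  then have "K = D (Suc \<tau>) \<xi> / fact (Suc \<tau>)" by (simp del: fact_Suc)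
  moreover have "f t - poly H t = K * poly \<Omega> t" using \<Omega>t by (simp add: K_def)
  ultimately show ?thesis using \<xi>(1) unfolding \<Omega>_poly by (intro bexI[of _ \<xi>]) simp_all
qed

text \<open>A new node contributes a linear factor times the square of the node polynomial, which
  disturbs no earlier value or derivative. Phrasing the degree bound by coefficients makes it say
  \<open>H = 0\<close> for the empty set, where a bound on \<open>degree\<close> could not.\<close>

lemma hermite_double:
  fixes f f' :: "real \<Rightarrow> real"
  assumes "finite d"
  shows "\<exists>H. (\<forall>i\<ge>2 * card d. coeff H i = 0) \<and> (\<forall>s\<in>d. poly H s = f s \<and> poly (pderiv H) s = f' s)"
  using assms
proof (induction d rule: finite_induct)
  case (insert a d)
  then obtain H where H: "\<forall>i\<ge>2 * card d. coeff H i = 0" "\<forall>s\<in>d. poly H s = f s \<and> poly (pderiv H) s = f' s"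
    by blast
  define \<Omega> :: "real poly" where "\<Omega> = (\<Prod>s\<in>d. [:- s, 1:])\<^sup>2"
  have \<Omega>a: "poly \<Omega> a \<noteq> 0" using insert.hyps by (auto simp: \<Omega>_def poly_prod)
  \<comment> \<open>The value \<open>c\<close> and the slope \<open>b\<close> of \<open>r\<close>
    that repair the value and the derivative at the new node.\<close>
  define c where "c = (f a - poly H a) / poly \<Omega> a"
  define b where "b = (f' a - poly (pderiv H) a - poly (pderiv \<Omega>) a * c) / poly \<Omega> a"
  define r where "r = [:c - b * a, b:]"
  have r: "poly r a = c" "pderiv r = [:b:]" by (auto simp: r_def pderiv_pCons algebra_simps)
  have deg: "degree (\<Prod>s\<in>d. [:- s, 1 :: real:]) = card d"
    by (subst degree_prod_eq_sum_degree) auto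
  have "degree (\<Omega> * r) \<le> 2 * card d + 1"
    by (rule order_trans[OF degree_mult_le]) (auto simp: \<Omega>_def degree_power_eq deg r_def insert.hyps)
  then have "\<forall>i\<ge>2 * card (insert a d). coeff (H + \<Omega> * r) i = 0"
    using H(1) insert.hyps by (auto intro: coeff_eq_0)
  moreover have "poly (H + \<Omega> * r) s = f s \<and> poly (pderiv (H + \<Omega> * r)) s = f' s" if "s \<in> insert a d" for s
  proof (cases "s = a")
    case True
    then show ?thesis using \<Omega>a
      by (simp add: pderiv_add pderiv_mult r) (simp add: c_def b_def)
  next
    case False
    then have s: "s \<in> d" using that by simp
    have "\<Omega> = [:- s, 1:]\<^sup>2 * (\<Prod>s\<in>d - {s}. [:- s, 1:])\<^sup>2"
      unfolding \<Omega>_def using prod.remove[OF insert.hyps(1) s, of "\<lambda>s. [:- s, 1:]"] by (simp only: power_mult_distrib)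
    then have "poly \<Omega> s = 0" "poly (pderiv \<Omega>) s = 0" by (rule double_root)+
    then show ?thesis using H(2) s by (simp add: pderiv_add pderiv_mult)
  qed
  ultimately show ?case by blast
qed (auto intro: exI[of _ 0])

text \<open>The node \<open>a\<close> with prescribed value only is -1 in Gauss--Radau
  interpolation, and an auxiliary point in the proof that \<open>h\<close> is finite at -1.\<close>

lemma hermite_double_simple:
  fixes f f' :: "real \<Rightarrow> real"
  assumes d: "finite d" "a \<notin> d"
  shows "\<exists>H. (\<forall>i\<ge>2 * card d + 1. coeff H i = 0) \<and> (\<forall>s\<in>insert a d. poly H s = f s) \<and> (\<forall>s\<in>d. poly (pderiv H) s = f' s)"
proof -
  obtain H where H: "\<forall>i\<ge>2 * card d. coeff H i = 0" "\<forall>s\<in>d. poly H s = f s \<and> poly (pderiv H) s = f' s"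
    using hermite_double[OF d(1), of f f'] by blast
  define \<Omega> :: "real poly" where "\<Omega> = (\<Prod>s\<in>d. [:- s, 1:])\<^sup>2"
  have \<Omega>a: "poly \<Omega> a \<noteq> 0" using d by (auto simp: \<Omega>_def poly_prod)
  define c where "c = (f a - poly H a) / poly \<Omega> a"
  have deg: "degree (\<Prod>s\<in>d. [:- s, 1 :: real:]) = card d"
    by (subst degree_prod_eq_sum_degree) auto
  have "degree (smult c \<Omega>) \<le> 2 * card d"
    by (rule order_trans[OF degree_smult_le]) (auto simp: \<Omega>_def degree_power_eq deg d)
  then have "coeff (smult c \<Omega>) i = 0" if "i \<ge> 2 * card d + 1" for i
    using that by (intro coeff_eq_0) linarith
  then have "\<forall>i\<ge>2 * card d + 1. coeff (H + smult c \<Omega>) i = 0"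
    using H(1) by simp
  moreover have "poly \<Omega> s = 0 \<and> poly (pderiv \<Omega>) s = 0" if "s \<in> d" for s
  proof -
    have "\<Omega> = [:- s, 1:]\<^sup>2 * (\<Prod>s\<in>d - {s}. [:- s, 1:])\<^sup>2"
      unfolding \<Omega>_def using prod.remove[OF d(1) that, of "\<lambda>s. [:- s, 1:]"] by (simp only: power_mult_distrib)
    then show ?thesis using double_root by blast
  qed
  ultimately show ?thesis using H \<Omega>a
    by (intro exI[of _ "H + smult c \<Omega>"]) (auto simp: pderiv_add pderiv_smult c_def)
qed

section \<open>Gauss and Gauss--Radau nodes as zeros of Jacobi polynomials\<close>

definition node_poly :: "real set \<Rightarrow> real poly" where
  "node_poly Z = (\<Prod>b\<in>Z. [:- b, 1:])"

lemma poly_node_poly: "poly (node_poly Z) t = (\<Prod>b\<in>Z. t - b)"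
  by (simp add: node_poly_def poly_prod)

lemma node_poly_eq_0_iff: "finite Z \<Longrightarrow> poly (node_poly Z) t = 0 \<longleftrightarrow> t \<in> Z"
  by (auto simp: poly_node_poly)

lemma degree_node_poly: "finite Z \<Longrightarrow> degree (node_poly Z) = card Z"
  unfolding node_poly_def by (subst degree_prod_eq_sum_degree) auto

lemma node_poly_nz: "finite Z \<Longrightarrow> node_poly Z \<noteq> 0"
  by (auto simp: node_poly_def)

lemma node_poly_remove: "finite Z \<Longrightarrow> b \<in> Z \<Longrightarrow> node_poly Z = [:- b, 1:] * node_poly (Z - {b})"
  unfolding node_poly_def by (rule prod.remove)

text \<open>The second Jacobi parameter exceeds the first by \<open>e\<close>, so the Jacobi weight
  is the ultraspherical weight times a polynomial, and orthogonality can be expressed by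
  \<open>mu_int\<close>.\<close>

lemma jacobi_weight_ultra:
  assumes "t \<in> {-1..1}" "e \<le> 1"
  shows "jacobi_weight ((real n - 3) / 2) (real e + (real n - 3) / 2) t = ultra_weight n t * (1 + t) ^ e"
proof -
  have nn: "0 \<le> 1 - t" "0 \<le> 1 + t" using assms by auto
  have "(1 + t) powr (real e + (real n - 3) / 2) = (1 + t) powr ((real n - 3) / 2) * (1 + t) ^ e"
  proof (cases "e = 0")
    case False
    then have "e = 1" using assms by simp
    then show ?thesis using nn by (simp add: powr_add)
  qed simp
  moreover have "(1 - t) powr ((real n - 3) / 2) * (1 + t) powr ((real n - 3) / 2) = ultra_weight n t"
    using nn by (simp add: ultra_weight_def powr_mult[symmetric] algebra_simps power2_eq_square)
  ultimately show ?thesis by (simp add: jacobi_weight_def mult.assoc[symmetric])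
qed

lemma integral_jacobi_weight:
  assumes "n \<ge> 2" "e \<le> 1"
  shows "integral {-1..1} (\<lambda>t. jacobi_weight ((real n - 3) / 2) (real e + (real n - 3) / 2) t * poly p t * poly q t)
    = mu_int n (poly ([:1, 1:] ^ e * p * q)) * ultra_moment n 0"
proof -
  have "integral {-1..1} (\<lambda>t. jacobi_weight ((real n - 3) / 2) (real e + (real n - 3) / 2) t * poly p t * poly q t)
    = integral {-1..1} (\<lambda>t. ultra_weight n t * poly ([:1, 1:] ^ e * p * q) t)"
    by (rule integral_cong) (simp add: jacobi_weight_ultra[OF _ assms(2)] mult_ac)
  then show ?thesis using ultra_moment_0_pos[OF assms(1)] by (simp add: mu_int_poly_eq)
qed

lemma mu_int_poly_diff:
  assumes "n \<ge> 2"
  shows "mu_int n (poly (p - q)) = mu_int n (poly p) - mu_int n (poly q)"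
  using integrable_ultra_weight_poly[OF assms, of p] integrable_ultra_weight_poly[OF assms, of q]
  by (simp add: mu_int_poly_eq right_diff_distrib Henstock_Kurzweil_Integration.integral_diff diff_divide_distrib)

lemma mu_int_poly_smult: "mu_int n (poly (smult c p)) = c * mu_int n (poly p)"
proof -
  have "integral {-1..1} (\<lambda>t. ultra_weight n t * (c * poly p t)) = c * integral {-1..1} (\<lambda>t. ultra_weight n t * poly p t)"
    by (subst integral_mult_right[symmetric]) (simp add: mult.left_commute)
  then show ?thesis by (simp add: mu_int_poly_eq)
qed

lemma mu_int_square_eq_0:
  assumes n: "n \<ge> 2" and "mu_int n (poly ([:1, 1:] ^ e * r * r)) = 0"
  shows "r = 0"
proof -
  have "[:1, 1:] ^ e * r * r = 0"
    by (rule mu_int_nonneg_poly_eq_0[OF n _ assms(2)]) (auto simp: mult.assoc)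
  then show ?thesis by auto
qed

text \<open>This resolves the definite description in \<open>jacobi_poly\<close>. Two candidates,
  each multiplied by the leading coefficient of the other, differ by a polynomial \<open>r\<close>
  of degree below \<open>k\<close>; it is orthogonal to both, hence to itself, and so it is
  0.\<close>

lemma jacobiP_eqI:
  assumes n: "n \<ge> 2" and e: "e \<le> 1" and k: "k > 0"
    and p: "degree p = k" "poly p 1 \<noteq> 0"
    and orth: "\<And>q. degree q < k \<Longrightarrow> mu_int n (poly ([:1, 1:] ^ e * p * q)) = 0"
  shows "jacobiP n 0 e k = smult (1 / poly p 1) p"
proof -
  let ?I = "\<lambda>p q. integral {-1..1} (\<lambda>t. jacobi_weight ((real n - 3) / 2) (real e + (real n - 3) / 2) t * poly p t * poly q t)"
  let ?Q = "\<lambda>p. degree p = k \<and> poly p 1 = 1 \<and> (\<forall>q :: real poly. degree q < k \<longrightarrow> ?I p q = 0)"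
  let ?P = "smult (1 / poly p 1) p"
  have scale: "mu_int n (poly ([:1, 1:] ^ e * smult c p' * q)) = c * mu_int n (poly ([:1, 1:] ^ e * p' * q))" for c p' q
    using mu_int_poly_smult[of n c "[:1, 1:] ^ e * p' * q"] by simp
  have P: "?Q ?P"
  proof (intro conjI allI impI)
    fix q :: "real poly" assume "degree q < k"
    then have "mu_int n (poly ([:1, 1:] ^ e * ?P * q)) = 0" by (simp only: scale orth mult_zero_right)
    then show "?I ?P q = 0" by (simp only: integral_jacobi_weight[OF n e] mult_zero_left)
  qed (use p in simp_all)
  have "P' = ?P" if P': "?Q P'" for P'
  proof -
    have o1: "mu_int n (poly ([:1, 1:] ^ e * P' * q)) = 0" if "degree q < k" for q
      using P' that ultra_moment_0_pos[OF n] by (simp add: integral_jacobi_weight[OF n e])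
    have o2: "mu_int n (poly ([:1, 1:] ^ e * ?P * q)) = 0" if "degree q < k" for q
      by (simp only: scale orth[OF that] mult_zero_right)
    define r where "r = smult (lead_coeff ?P) P' - smult (lead_coeff P') ?P"
    have dP: "degree P' = k" "degree ?P = k" using P' P by auto
    have "coeff r k = 0" by (simp only: r_def coeff_diff coeff_smult dP mult.commute diff_self)
    moreover have "degree r \<le> k" unfolding r_def using dP
      by (intro degree_diff_le) (auto intro: order_trans[OF degree_smult_le])
    ultimately have "degree r < k" using k
      by (metis degree_0 le_neq_implies_less leading_coeff_0_iff)
    have "[:1, 1:] ^ e * r * r = smult (lead_coeff ?P) ([:1, 1:] ^ e * P' * r) - smult (lead_coeff P') ([:1, 1:] ^ e * ?P * r)"
      by (subst (1) r_def) (simp add: algebra_simps smult_diff_right)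
    then have "mu_int n (poly ([:1, 1:] ^ e * r * r)) = 0"
      using o1[OF \<open>degree r < k\<close>] o2[OF \<open>degree r < k\<close>]
      by (simp only: mu_int_poly_diff[OF n] mu_int_poly_smult)
    then have "r = 0" by (rule mu_int_square_eq_0[OF n])
    then have *: "smult (lead_coeff ?P) P' = smult (lead_coeff P') ?P" by (simp add: r_def)
    have "lead_coeff ?P * poly P' 1 = lead_coeff P' * poly ?P 1"
      using arg_cong[OF *, of "\<lambda>p. poly p 1"] by simp
    then have lc: "lead_coeff ?P = lead_coeff P'" using P P' by simp
    have "lead_coeff P' \<noteq> 0" using dP k by auto
    then show "P' = ?P" using * unfolding lc by (metis smult_eq_iff)
  qed
  with P show ?thesis
    unfolding jacobiP_def jacobi_poly_def of_nat_0 add_0_left by (intro the_equality) blast+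
qed

text \<open>A point with few inner products turns the design into a Gauss(-Radau) quadrature,
  whose nodes are forced to be the zeros of the Jacobi polynomial.\<close>
lemma sharp_nodes_eq_image:
  fixes C :: "(real^'n) set" and x :: "real^'n"
  assumes C: "spherical_design \<tau> C" and x: "norm x = 1" and n: "CARD('n) = n" "n \<ge> 2"
    and ke: "\<tau> + 1 = 2 * k + e" "e \<le> 1" "k > 0"
    and Z: "card ((\<bullet>) x ` C) \<le> k + e" "e = 1 \<Longrightarrow> -1 \<in> (\<bullet>) x ` C"
  shows "sharp_nodes n \<tau> = (\<bullet>) x ` C" "card ((\<bullet>) x ` C) = k + e"
    "(\<bullet>) x ` C - (if e = 1 then {-1} else {}) \<subseteq> {-1<..<1}"
proof -
  have fC: "finite C" and C1: "\<And>y. y \<in> C \<Longrightarrow> norm y = 1" using C by (auto simp: spherical_design_def)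
  define E :: "real set" where "E = (if e = 1 then {-1} else {})"
  define Z where "Z = (\<bullet>) x ` C"
  define Z0 where "Z0 = Z - E"
  have fZ: "finite Z" "finite Z0" using fC by (auto simp: Z_def Z0_def)
  have EZ: "E \<subseteq> Z" using Z(2) by (auto simp: E_def Z_def)
  have cardE: "card E = e" using ke(2) by (auto simp: E_def)
  have cZ: "card Z = card Z0 + e"
    using EZ fZ(1) card_mono[OF fZ(1) EZ] cardE finite_subset[OF EZ fZ(1)] by (simp add: Z0_def card_Diff_subset)
  have cZ0: "card Z0 \<le> k" using Z(1) cZ by (simp add: Z_def)
  have range: "Z \<subseteq> {-1..1}"
    using Cauchy_Schwarz_ineq2[of x] x C1 by (auto simp: Z_def abs_le_iff) (smt (verit) mult_cancel_left1)+
  define w where "w = node_poly Z0"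
  have dw: "degree w = card Z0" "w \<noteq> 0" using fZ by (auto simp: w_def degree_node_poly node_poly_nz)
  let ?e = "[:1, 1:] ^ e :: real poly"
  have de: "degree ?e = e" by (simp add: degree_power_eq)
  have vanish: "poly (?e * w) t = 0" if "t \<in> Z" for t
  proof (cases "t \<in> E")
    case True
    then show ?thesis by (auto simp: E_def split: if_splits)
  next
    case False
    then have "t \<in> Z0" using that by (simp add: Z0_def)
    then show ?thesis using fZ by (simp add: w_def node_poly_eq_0_iff)
  qed
  \<comment> \<open>\<open>?e * w\<close> vanishes at every inner product, and the product with
    \<open>q\<close> has degree at most \<tau>, so the quadrature gives 0.\<close>
  have mu0: "mu_int n (poly (?e * w * q)) = 0" if "degree q < k" for q
  proof -
    have "degree (?e * w * q) \<le> \<tau>"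
      using that cZ0 dw(1) de ke degree_mult_le[of "?e * w" q] degree_mult_le[of ?e w] by linarith
    then have "(\<Sum>y\<in>C. poly (?e * w * q) (x \<bullet> y)) = real (card C) * mu_int n (poly (?e * w * q))"
      by (rule design_quadrature[OF C x _ n])
    moreover have "poly (?e * w * q) (x \<bullet> y) = 0" if "y \<in> C" for y
      using vanish[of "x \<bullet> y"] that by (auto simp: Z_def)
    moreover have "card C > 0" using C by (auto simp: spherical_design_def card_gt_0_iff)
    moreover have "(\<Sum>y\<in>C. poly (?e * w * q) (x \<bullet> y)) = 0"
      by (rule sum.neutral) (use calculation(2) in blast)
    ultimately show ?thesis by (simp only: mult_eq_0_iff of_nat_eq_0_iff) simp
  qed
  \<comment> \<open>With fewer interior nodes \<open>w\<close> could serve as its own test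
    polynomial, and its weighted square would integrate to 0.\<close>
  have "\<not> card Z0 < k"
    using mu0[of w] mu_int_square_eq_0[OF n(2), of e w] dw by auto
  then have cZ0: "card Z0 = k" using cZ0 by simp
  have drop: "degree (node_poly (Z0 - {b})) < k" if "b \<in> Z0" for b
    using that fZ cZ0 ke(3) by (simp add: degree_node_poly)
  \<comment> \<open>A node 1 would leave, after testing with the remaining factor \<open>u\<close>,
    the integrand \<open>(1 - t) * u^2\<close> of constant sign.\<close>
  have one: "1 \<notin> Z0"
  proof
    assume b: "1 \<in> Z0"
    define u where "u = node_poly (Z0 - {1})"
    have wu: "w = [:- 1, 1:] * u" using node_poly_remove[OF fZ(2) b] by (simp add: w_def u_def)
    have "?e * w * (- u) = 0"
    proof (rule mu_int_nonneg_poly_eq_0[OF n(2)])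
      show "mu_int n (poly (?e * w * (- u))) = 0" using mu0[of "- u"] drop[OF b] by (simp add: u_def)
      fix t :: real assume t: "t \<in> {-1..1}"
      have "poly (?e * w * (- u)) t = (1 + t) ^ e * ((1 - t) * (poly u t * poly u t))"
        by (simp add: wu algebra_simps)
      also have "\<dots> \<ge> 0" using t by (intro mult_nonneg_nonneg[OF zero_le_power mult_nonneg_nonneg[OF _ zero_le_square]]) auto
      finally show "0 \<le> poly (?e * w * (- u)) t" .
    qed
    moreover have "u \<noteq> 0" using fZ by (simp add: u_def node_poly_nz)
    ultimately show False using dw by simp
  qed
  \<comment> \<open>\<open>Z0\<close> excludes -1 when \<open>e = 1\<close>. When
    \<open>e = 0\<close>, a node -1 would lead to the nonnegative integrand
    \<open>(1 + t) * u^2\<close>.\<close>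
  have mone: "-1 \<notin> Z0"
  proof
    assume b: "-1 \<in> Z0"
    have "e = 0"
    proof (rule ccontr)
      assume "e \<noteq> 0"
      then have "e = 1" using ke(2) by simp
      then show False using b by (simp add: Z0_def E_def)
    qed
    define u where "u = node_poly (Z0 - {-1})"
    have wu: "w = [:1, 1:] * u" using node_poly_remove[OF fZ(2) b] by (simp add: w_def u_def)
    have "?e * w * u = 0"
    proof (rule mu_int_nonneg_poly_eq_0[OF n(2)])
      show "mu_int n (poly (?e * w * u)) = 0" using mu0[of u] drop[OF b] by (simp add: u_def)
      fix t :: real assume t: "t \<in> {-1..1}"
      have "poly (?e * w * u) t = (1 + t) * (poly u t * poly u t)"
        by (simp add: wu \<open>e = 0\<close> algebra_simps)
      also have "\<dots> \<ge> 0" using t by (intro mult_nonneg_nonneg[OF _ zero_le_square]) auto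
      finally show "0 \<le> poly (?e * w * u) t" .
    qed
    moreover have "u \<noteq> 0" using fZ by (simp add: u_def node_poly_nz)
    ultimately show False using dw by simp
  qed
  have w1: "poly w 1 \<noteq> 0" using one fZ by (simp add: w_def node_poly_eq_0_iff)
  have J: "jacobiP n 0 e k = smult (1 / poly w 1) w"
    using jacobiP_eqI[OF n(2) ke(2,3) _ w1 mu0] dw(1) cZ0 by simp
  have tk: "tau_k \<tau> = k" "tau_eps \<tau> = e" using ke by (auto simp: tau_k_def tau_eps_def)
  have "sharp_nodes n \<tau> = {t. (1 + t) ^ e * poly w t = 0}"
    unfolding sharp_nodes_def tk J using w1 by auto
  also have "\<dots> = Z"
  proof (intro equalityI subsetI)
    fix t assume "t \<in> {t. (1 + t) ^ e * poly w t = 0}"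
    then have "((1 + t = 0 \<and> e = 1) \<or> t \<in> Z0)" using ke(2) fZ by (auto simp: w_def node_poly_eq_0_iff)
    then have "t \<in> E \<or> t \<in> Z0" by (auto simp: E_def)
    then show "t \<in> Z" using EZ by (auto simp: Z0_def)
  next
    fix t assume "t \<in> Z"
    then show "t \<in> {t. (1 + t) ^ e * poly w t = 0}" using vanish[of t] by simp
  qed
  finally show "sharp_nodes n \<tau> = (\<bullet>) x ` C" by (simp add: Z_def)
  show "card ((\<bullet>) x ` C) = k + e" using cZ cZ0 by (simp add: Z_def)
  have "Z0 \<subseteq> {-1<..<1}"
  proof
    fix t assume t: "t \<in> Z0"
    then have "t \<noteq> 1" "t \<noteq> -1" "-1 \<le> t" "t \<le> 1" using one mone range by (auto simp: Z0_def)
    then show "t \<in> {-1<..<1}" by auto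
  qed
  then show "(\<bullet>) x ` C - (if e = 1 then {-1} else {}) \<subseteq> {-1<..<1}" by (simp add: Z0_def Z_def E_def)
qed

text \<open>On the inner products the Lagrange polynomial of \<open>a\<close> is the indicator of
  \<open>a\<close>, so its sum over the code counts the fibre.\<close>

lemma card_fibre_eq_weight:
  fixes C :: "(real^'n) set" and x :: "real^'n"
  assumes C: "spherical_design \<tau> C" and x: "norm x = 1" and n: "CARD('n) = n" "n \<ge> 2"
    and nodes: "sharp_nodes n \<tau> = (\<bullet>) x ` C" and card: "card ((\<bullet>) x ` C) \<le> \<tau> + 1" and a: "a \<in> (\<bullet>) x ` C"
  shows "real (card {y \<in> C. x \<bullet> y = a}) = real (card C) * sharp_weight n \<tau> a"
proof -
  define Z where "Z = (\<bullet>) x ` C"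
  have fC: "finite C" using C by (simp add: spherical_design_def)
  have fZ: "finite Z" using fC by (simp add: Z_def)
  define L where "L = (\<Prod>b\<in>Z - {a}. smult (1 / (a - b)) [:- b, 1:])"
  have L: "poly L t = lagrange_basis Z a t" for t
    by (simp add: L_def poly_prod lagrange_basis_def divide_simps)
  have "degree L \<le> (\<Sum>b\<in>Z - {a}. degree (smult (1 / (a - b)) [:- b, 1:]))"
    unfolding L_def using degree_prod_sum_le[of "Z - {a}" "\<lambda>b. smult (1 / (a - b)) [:- b, 1:]"] fZ
    by (simp add: o_def)
  also have "\<dots> \<le> (\<Sum>b\<in>Z - {a}. 1)" by (intro sum_mono order_trans[OF degree_smult_le]) auto
  also have "\<dots> \<le> \<tau>" using fZ card a by (simp add: Z_def)
  finally have "(\<Sum>y\<in>C. poly L (x \<bullet> y)) = real (card C) * mu_int n (poly L)"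
    by (rule design_quadrature[OF C x _ n])
  moreover have "poly L (x \<bullet> y) = (if x \<bullet> y = a then 1 else 0)" if "y \<in> C" for y
  proof (cases "x \<bullet> y = a")
    case True
    then show ?thesis unfolding L lagrange_basis_def by (simp add: prod.neutral)
  next
    case False
    then have "x \<bullet> y \<in> Z - {a}" using that by (simp add: Z_def)
    then have "lagrange_basis Z a (x \<bullet> y) = 0"
      unfolding lagrange_basis_def using fZ by (intro prod_zero) auto
    then show ?thesis using False by (simp add: L)
  qed
  then have "(\<Sum>y\<in>C. poly L (x \<bullet> y)) = real (card {y \<in> C. x \<bullet> y = a})"
    using fC by (simp add: sum.If_cases Int_def)
  moreover have "mu_int n (poly L) = sharp_weight n \<tau> a"
    unfolding sharp_weight_def nodes using L by (simp add: Z_def[symmetric] fun_eq_iff) (metis ext L)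
  ultimately show ?thesis by simp
qed

section \<open>Polynomial minorants of functions that may be infinite at the endpoints\<close>

lemma ereal_poly_le_closed:
  fixes h :: "real \<Rightarrow> ereal"
  assumes h: "continuous_on {-1..1} h" and le: "\<And>s. s \<in> {-1<..<1} \<Longrightarrow> ereal (poly H s) \<le> h s"
    and t: "t \<in> {-1..1}"
  shows "ereal (poly H t) \<le> h t"
proof -
  define s where "s m = t * (1 - 1 / real (Suc (Suc m)))" for m
  have abs_s: "\<bar>s m\<bar> < 1" for m
  proof -
    have "\<bar>s m\<bar> = \<bar>t\<bar> * (1 - 1 / real (Suc (Suc m)))" by (simp add: s_def abs_mult)
    also have "\<dots> \<le> 1 * (1 - 1 / real (Suc (Suc m)))" using t by (intro mult_right_mono) auto
    also have "\<dots> < 1" by simp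
    finally show ?thesis .
  qed
  have sr: "s m \<in> {-1<..<1}" for m using abs_s[of m] by (simp add: abs_less_iff)
  have "s \<longlonglongrightarrow> t * (1 - 0)" unfolding s_def
    by (intro tendsto_intros LIMSEQ_Suc[OF LIMSEQ_Suc[OF lim_const_over_n]])
  then have lim: "s \<longlonglongrightarrow> t" by simp
  have sin: "s m \<in> {-1..1}" for m using sr[of m] by auto
  have 1: "(\<lambda>m. h (s m)) \<longlonglongrightarrow> h t"
    by (rule continuous_on_tendsto_compose[OF h lim t]) (simp only: sin eventually_sequentiallyI)
  have 2: "(\<lambda>m. ereal (poly H (s m))) \<longlonglongrightarrow> ereal (poly H t)"
    using lim by (intro tendsto_intros)
  show ?thesis by (rule LIMSEQ_le[OF 2 1]) (use le[OF sr] in blast)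
qed

lemma ereal_le_poly_left_endpoint:
  fixes h :: "real \<Rightarrow> ereal"
  assumes h: "continuous_on {-1..1} h" and t0: "t0 \<in> {-1<..<1}"
    and le: "\<And>s. s \<in> {-1<..<t0} \<Longrightarrow> h s \<le> ereal (poly H s)"
  shows "h (-1) \<le> ereal (poly H (-1))"
proof -
  define s where "s m = -1 + (t0 + 1) * (1 / real (Suc (Suc m)))" for m
  have sr: "s m \<in> {-1<..<t0}" for m
  proof -
    have "(t0 + 1) * (1 / real (Suc (Suc m))) < (t0 + 1) * 1"
      using t0 by (intro mult_strict_left_mono) auto
    moreover have "(t0 + 1) * (1 / real (Suc (Suc m))) > 0" using t0 by (intro mult_pos_pos) auto
    ultimately show ?thesis by (simp add: s_def)
  qed
  have "s \<longlonglongrightarrow> -1 + (t0 + 1) * 0" unfolding s_def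
    by (intro tendsto_intros LIMSEQ_Suc[OF LIMSEQ_Suc[OF lim_const_over_n]])
  then have lim: "s \<longlonglongrightarrow> -1" by simp
  have sin: "s m \<in> {-1..1}" for m using sr[of m] t0 by auto
  have 1: "(\<lambda>m. h (s m)) \<longlonglongrightarrow> h (-1)"
    by (rule continuous_on_tendsto_compose[OF h lim]) (simp_all only: sin eventually_sequentiallyI, simp)
  have 2: "(\<lambda>m. ereal (poly H (s m))) \<longlonglongrightarrow> ereal (poly H (-1))"
    using lim by (intro tendsto_intros)
  show ?thesis by (rule LIMSEQ_le[OF 1 2]) (use le[OF sr] in blast)
qed

text \<open>With double interior nodes, and the simple node -1 if \<open>e = 1\<close>, the
  remainder is a nonnegative derivative times a square, times \<open>t + 1\<close> in the second
  case. The estimate is made inside \<open>{-1<..<1}\<close> and reaches the endpoints by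
  continuity.\<close>

lemma hermite_minorant:
  fixes h :: "real \<Rightarrow> ereal" and D :: "nat \<Rightarrow> real \<Rightarrow> real"
  assumes ke: "\<tau> + 1 = 2 * k + e" "e \<le> 1"
    and Z: "finite Z0" "card Z0 = k" "Z0 \<subseteq> {-1<..<1}"
    and pos: "\<And>t. t \<in> {-1..1} \<Longrightarrow> 0 \<le> h t" and cont: "continuous_on {-1..1} h"
    and fin: "\<And>t. t \<in> {-1<..<1} \<Longrightarrow> h t \<noteq> \<infinity>"
    and D0: "\<And>t. t \<in> {-1<..<1} \<Longrightarrow> D 0 t = real_of_ereal (h t)"
    and der: "\<And>m t. m \<le> \<tau> \<Longrightarrow> t \<in> {-1<..<1} \<Longrightarrow> (D m has_real_derivative D (Suc m) t) (at t)"
    and Dpos: "\<And>t. t \<in> {-1<..<1} \<Longrightarrow> 0 \<le> D (Suc \<tau>) t"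
  obtains H where "degree H \<le> \<tau>" "\<And>s. s \<in> Z0 \<union> (if e = 1 then {-1} else {}) \<Longrightarrow> h s = ereal (poly H s)"
    "\<And>t. t \<in> {-1..1} \<Longrightarrow> ereal (poly H t) \<le> h t"
proof -
  define f where "f s = real_of_ereal (h s)" for s
  have fin': "\<bar>h t\<bar> \<noteq> \<infinity>" if "t \<in> {-1<..<1}" for t
    using pos[of t] fin[OF that] that by auto
  have hf: "h t = ereal (f t)" if "\<bar>h t\<bar> \<noteq> \<infinity>" for t using that by (simp add: f_def ereal_real)
  have contf: "continuous_on A f" if "A \<subseteq> {-1..1}" "\<And>t. t \<in> A \<Longrightarrow> \<bar>h t\<bar> \<noteq> \<infinity>" for A
    using continuous_on_iff_real[of A h] that continuous_on_subset[OF cont that(1)] by (simp add: f_def[abs_def] o_def)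
  have D0f: "D 0 t = f t" if "t \<in> {-1<..<1}" for t using D0[OF that] by (simp add: f_def)
  have dpos: "0 \<le> D (Suc \<tau>) \<xi> / fact (Suc \<tau>)" if "\<xi> \<in> {-1<..<1}" for \<xi>
    using Dpos[OF that] by (simp del: fact_Suc)
  \<comment> \<open>For \<open>e = 1\<close> the value at the node -1 must be finite. Interpolate
    with an auxiliary simple node \<open>t0\<close> left of all interior nodes: for
    \<open>t < t0\<close> the remainder has the sign of \<open>t - t0\<close>, so \<open>h\<close>
    stays below a polynomial near -1.\<close>
  have finite_left: "\<bar>h (-1)\<bar> \<noteq> \<infinity>" if e: "e = 1"
  proof -
    define m where "m = Min (insert 1 Z0)"
    have m: "-1 < m" "m \<le> 1" "\<And>s. s \<in> Z0 \<Longrightarrow> m \<le> s" using Z by (auto simp: m_def)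
    \<comment> \<open>Halfway between -1 and the leftmost interior node, or 1 if there is
      none.\<close>
    define t0 where "t0 = (m - 1) / 2"
    have t0: "-1 < t0" "t0 < m" "t0 < 1" using m by (auto simp: t0_def)
    then have t0Z: "t0 \<notin> Z0" using m(3) by force
    obtain H where H: "\<forall>i\<ge>2 * card Z0 + 1. coeff H i = 0" "\<forall>s\<in>insert t0 Z0. poly H s = f s"
      "\<forall>s\<in>Z0. poly (pderiv H) s = D 1 s"
      using hermite_double_simple[OF Z(1) t0Z, of f "D 1"] by blast
    have dH: "degree H \<le> \<tau>" by (rule degree_le) (use H(1) ke e Z in auto)
    have "h (-1) \<le> ereal (poly H (-1))"
    proof (rule ereal_le_poly_left_endpoint[OF cont])
      fix t assume t: "t \<in> {-1<..<t0}"
      \<comment> \<open>A right end beyond all nodes but short of 1, so that \<open>h\<close> is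
        finite on \<open>{t..u}\<close>.\<close>
      define u where "u = (1 + Max (insert t0 Z0)) / 2"
      have M: "Max (insert t0 Z0) < 1" "\<And>s. s \<in> insert t0 Z0 \<Longrightarrow> s \<le> Max (insert t0 Z0)" using Z t0 by auto
      have u: "u < 1" "\<And>s. s \<in> insert t0 Z0 \<Longrightarrow> s < u"
      proof -
        show "u < 1" using M(1) by (simp add: u_def)
        fix s assume "s \<in> insert t0 Z0"
        then have "s \<le> Max (insert t0 Z0)" by (rule M(2))
        then show "s < u" using M(1) by (simp add: u_def)
      qed
      have lt: "t < s" if "s \<in> insert t0 Z0" for s using that t t0 m(3) by force
      have sub: "{t..u} \<subseteq> {-1<..<1}" using t u(1) by auto
      have "\<exists>\<xi>\<in>{t<..<u}. f t - poly H t = D (Suc \<tau>) \<xi> / fact (Suc \<tau>) * ((\<Prod>s\<in>insert t0 Z0. t - s) * (\<Prod>s\<in>Z0. t - s))"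
      proof (rule hermite_error[OF _ _ _ _ _ dH])
        show "finite (insert t0 Z0)" "Z0 \<subseteq> insert t0 Z0" using Z by auto
        show "insert t0 Z0 \<subseteq> {t..u}" "Z0 \<subseteq> {t<..<u}" by (auto intro!: less_imp_le[OF lt] less_imp_le[OF u(2)] lt u(2))
        show "card (insert t0 Z0) + card Z0 = Suc \<tau>" using Z t0Z ke e by simp
        show "continuous_on {t..u} f"
        proof (rule contf)
          show "{t..u} \<subseteq> {-1..1}" using sub by (rule order_trans) auto
          show "\<bar>h s\<bar> \<noteq> \<infinity>" if "s \<in> {t..u}" for s using fin'[OF subsetD[OF sub that]] .
        qed
        show "t \<notin> insert t0 Z0" using lt by blast
        have "t < t0" "t0 < u" using lt u(2) by blast+
        then show "t \<in> {t..u}" by simp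
        have sub': "s \<in> {-1<..<1}" if "s \<in> {t<..<u}" for s using t u(1) that by auto
        show "D 0 s = f s" if "s \<in> {t<..<u}" for s using D0f[OF sub'[OF that]] .
        show "(D i has_real_derivative D (Suc i) s) (at s)" if "i \<le> \<tau>" "s \<in> {t<..<u}" for i s
          using der[OF that(1) sub'[OF that(2)]] .
      qed (use H in auto)
      then obtain \<xi> where \<xi>: "\<xi> \<in> {t<..<u}"
        "f t - poly H t = D (Suc \<tau>) \<xi> / fact (Suc \<tau>) * ((\<Prod>s\<in>insert t0 Z0. t - s) * (\<Prod>s\<in>Z0. t - s))" by blast
      have "(\<Prod>s\<in>insert t0 Z0. t - s) * (\<Prod>s\<in>Z0. t - s) = (t - t0) * (\<Prod>s\<in>Z0. t - s)\<^sup>2"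
        using Z(1) t0Z by (simp add: power2_eq_square)
      also have "\<dots> \<le> 0" using t by (intro mult_nonpos_nonneg) auto
      finally have "(\<Prod>s\<in>insert t0 Z0. t - s) * (\<Prod>s\<in>Z0. t - s) \<le> 0" .
      moreover have "\<xi> \<in> {-1<..<1}" using \<xi>(1) t u(1) by auto
      ultimately have "f t - poly H t \<le> 0"
        unfolding \<xi>(2) using dpos mult_nonneg_nonpos by blast
      then show "h t \<le> ereal (poly H t)" using hf[OF fin'[of t]] t t0 by simp
    qed (use t0 in auto)
    then show ?thesis using pos[of "-1"] by auto
  qed
  define E :: "real set" where "E = (if e = 1 then {-1} else {})"
  define S where "S = Z0 \<union> E"
  have finS: "\<bar>h s\<bar> \<noteq> \<infinity>" if "s \<in> S" for s
  proof (cases "s \<in> Z0")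
    case True
    then show ?thesis by (rule fin'[OF subsetD[OF Z(3)]])
  next
    case False
    then have "s \<in> E" using that by (simp add: S_def)
    then have "e = 1 \<and> s = -1" by (cases "e = 1") (simp_all add: E_def)
    then show ?thesis using finite_left by simp
  qed
  have disj: "Z0 \<inter> E = {}" using Z by (auto simp: E_def)
  have cS: "finite S" "card S + card Z0 = Suc \<tau>"
    using Z ke disj by (auto simp: S_def E_def card_Un_disjoint)
  obtain H where H: "degree H \<le> \<tau>" "\<forall>s\<in>S. poly H s = f s" "\<forall>s\<in>Z0. poly (pderiv H) s = D 1 s"
  proof (cases "e = 1")
    case True
    have "-1 \<notin> Z0" using Z by auto
    then obtain H where H: "\<forall>i\<ge>2 * card Z0 + 1. coeff H i = 0" "\<forall>s\<in>insert (-1) Z0. poly H s = f s"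
      "\<forall>s\<in>Z0. poly (pderiv H) s = D 1 s" using hermite_double_simple[OF Z(1), of "-1" f "D 1"] by blast
    moreover have "degree H \<le> \<tau>" by (rule degree_le) (use H(1) True ke Z in auto)
    ultimately show thesis using True by (intro that[of H]) (auto simp: S_def E_def)
  next
    case False
    obtain H where H: "\<forall>i\<ge>2 * card Z0. coeff H i = 0" "\<forall>s\<in>Z0. poly H s = f s \<and> poly (pderiv H) s = D 1 s"
      using hermite_double[OF Z(1), of f "D 1"] by blast
    moreover have "degree H \<le> \<tau>" by (rule degree_le) (use H(1) False ke Z in auto)
    ultimately show thesis using False by (intro that[of H]) (auto simp: S_def E_def)
  qed
  have ev: "h s = ereal (poly H s)" if "s \<in> S" for s
    using hf[OF finS[OF that]] H(2) that by simp
  have inner: "ereal (poly H t) \<le> h t" if t: "t \<in> {-1<..<1}" for t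
  proof (cases "t \<in> S")
    case True
    then show ?thesis using ev by simp
  next
    case False
    let ?S = "insert t Z0"
    \<comment> \<open>For \<open>e = 1\<close> the left end is the node -1 itself. For
      \<open>e = 0\<close> it keeps away from -1, where \<open>h\<close> may be infinite.\<close>
    define l where "l = (if e = 1 then -1 else (Min ?S - 1) / 2)"
    define u where "u = (1 + Max ?S) / 2"
    have M: "Max ?S < 1" "\<And>s. s \<in> ?S \<Longrightarrow> s \<le> Max ?S" "-1 < Min ?S" "\<And>s. s \<in> ?S \<Longrightarrow> Min ?S \<le> s"
      using Z t by auto
    have u: "u < 1" "s < u" "l < s" if "s \<in> ?S" for s
    proof -
      show "u < 1" using M(1) by (simp add: u_def)
      show "s < u" using M(1) M(2)[OF that] by (simp add: u_def)
      show "l < s" using M(3) M(4)[OF that] by (auto simp: l_def)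
    qed
    have l: "l \<ge> -1" "e \<noteq> 1 \<Longrightarrow> l > -1" using M(3) by (auto simp: l_def)
    have u1: "u < 1" using u(1)[of t] by simp
    have finlu: "\<bar>h s\<bar> \<noteq> \<infinity>" if "s \<in> {l..u}" for s
    proof (cases "s = -1")
      case True
      then have "e = 1" using l that by force
      then show ?thesis using finite_left True by simp
    next
      case False
      then have "s \<in> {-1<..<1}" using that l u1 by auto
      then show ?thesis by (rule fin')
    qed
    have sub: "{l<..<u} \<subseteq> {-1<..<1}" using l u1 by auto
    have "\<exists>\<xi>\<in>{l<..<u}. f t - poly H t = D (Suc \<tau>) \<xi> / fact (Suc \<tau>) * ((\<Prod>s\<in>S. t - s) * (\<Prod>s\<in>Z0. t - s))"
    proof (rule hermite_error[OF cS(1) _ _ _ cS(2) H(1)])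
      show zu: "Z0 \<subseteq> {l<..<u}" using u(2,3) by auto
      have "E \<subseteq> {l..u}" using u(2)[of t] t by (auto simp: E_def l_def)
      moreover have "Z0 \<subseteq> {l..u}" by (rule order_trans[OF zu]) auto
      ultimately show "S \<subseteq> {l..u}" by (simp add: S_def)
      show "continuous_on {l..u} f" using finlu l u1 by (intro contf) auto
      show "t \<in> {l..u}" using u(2,3)[of t] by simp
      show "D 0 s = f s" if "s \<in> {l<..<u}" for s using D0f[OF subsetD[OF sub that]] .
      show "(D i has_real_derivative D (Suc i) s) (at s)" if "i \<le> \<tau>" "s \<in> {l<..<u}" for i s
        using der[OF that(1) subsetD[OF sub that(2)]] .
    qed (use H False in \<open>auto simp: S_def\<close>)
    then obtain \<xi> where \<xi>: "\<xi> \<in> {l<..<u}"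
      "f t - poly H t = D (Suc \<tau>) \<xi> / fact (Suc \<tau>) * ((\<Prod>s\<in>S. t - s) * (\<Prod>s\<in>Z0. t - s))" by blast
    have "(\<Prod>s\<in>S. t - s) * (\<Prod>s\<in>Z0. t - s) = (\<Prod>s\<in>E. t - s) * (\<Prod>s\<in>Z0. t - s)\<^sup>2"
      unfolding S_def using Z(1) disj by (subst prod.union_disjoint) (auto simp: E_def power2_eq_square)
    also have "\<dots> \<ge> 0" using t by (intro mult_nonneg_nonneg) (auto simp: E_def)
    finally have "0 \<le> (\<Prod>s\<in>S. t - s) * (\<Prod>s\<in>Z0. t - s)" .
    then have "0 \<le> f t - poly H t"
      unfolding \<xi>(2) using dpos[OF subsetD[OF sub \<xi>(1)]] mult_nonneg_nonneg by blast
    then show ?thesis using hf[OF fin'[OF t]] by simp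
  qed
  show thesis
  proof (rule that[OF H(1)])
    show "h s = ereal (poly H s)" if "s \<in> Z0 \<union> (if e = 1 then {-1} else {})" for s
      using ev[of s] that by (simp add: S_def E_def)
    show "ereal (poly H t) \<le> h t" if "t \<in> {-1..1}" for t
      by (rule ereal_poly_le_closed[OF cont inner that])
  qed
qed

text \<open>The points found later are arbitrary nonzero vectors, mostly of lattices. They are
  normalised here, and therefore the node -1 enters as \<open>- norm x\<close>.\<close>

lemma universal_minimum_of_few_inner_products:
  fixes C :: "(real^'n) set" and x :: "real^'n"
  assumes C: "spherical_design \<tau> C" and x: "x \<noteq> 0" and n: "CARD('n) = n" "n \<ge> 2" and N: "card C = N"
    and ke: "\<tau> + 1 = 2 * k + e" "e \<le> 1" "k > 0"
    and Z: "card ((\<bullet>) x ` C) \<le> k + e" "e = 1 \<Longrightarrow> - norm x \<in> (\<bullet>) x ` C"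
  shows "\<exists>xt \<in> sphere (0::real^'n) 1.
     (\<lambda>y. xt \<bullet> y) ` C = sharp_nodes n \<tau> \<and>
     (\<forall>a \<in> sharp_nodes n \<tau>. real (card {y \<in> C. xt \<bullet> y = a}) = real N * sharp_weight n \<tau> a) \<and>
     (\<forall>h :: real \<Rightarrow> ereal.
        ((\<forall>t\<in>{-1..1}. 0 \<le> h t) \<and> continuous_on {-1..1} h \<and> (\<forall>t\<in>{-1<..<1}. h t \<noteq> \<infinity>) \<and>
         (\<exists>D :: nat \<Rightarrow> real \<Rightarrow> real.
            (\<forall>t\<in>{-1<..<1}. D 0 t = real_of_ereal (h t)) \<and>
            (\<forall>m\<le>\<tau>. \<forall>t\<in>{-1<..<1}. (D m has_real_derivative D (Suc m) t) (at t)) \<and>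
            (\<forall>t\<in>{-1<..<1}. 0 \<le> D (Suc \<tau>) t)))
        \<longrightarrow> (INF x \<in> sphere (0::real^'n) 1. \<Sum>y\<in>C. h (x \<bullet> y))
               = (\<Sum>a \<in> sharp_nodes n \<tau>. ereal (real N * sharp_weight n \<tau> a) * h a)
          \<and> (\<Sum>y\<in>C. h (xt \<bullet> y))
               = (\<Sum>a \<in> sharp_nodes n \<tau>. ereal (real N * sharp_weight n \<tau> a) * h a))"
proof -
  define xt where "xt = x /\<^sub>R norm x"
  have xt: "norm xt = 1" using x by (simp add: xt_def)
  have fC: "finite C" and C1: "\<And>y. y \<in> C \<Longrightarrow> norm y = 1" using C by (auto simp: spherical_design_def)
  have im: "(\<bullet>) xt ` C = (\<lambda>t. t / norm x) ` ((\<bullet>) x ` C)"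
    by (simp add: image_image xt_def divide_inverse mult.commute)
  have cards: "card ((\<bullet>) xt ` C) \<le> k + e"
    unfolding im using card_image_le[of "(\<bullet>) x ` C" "\<lambda>t. t / norm x"] fC Z(1) by simp
  have mone: "-1 \<in> (\<bullet>) xt ` C" if "e = 1"
  proof -
    have "- norm x / norm x \<in> (\<bullet>) xt ` C" unfolding im using Z(2)[OF that] by (rule imageI)
    then show ?thesis using x by simp
  qed
  have nodes: "sharp_nodes n \<tau> = (\<bullet>) xt ` C" "card ((\<bullet>) xt ` C) = k + e"
    "(\<bullet>) xt ` C - (if e = 1 then {-1} else {}) \<subseteq> {-1<..<1}"
    using sharp_nodes_eq_image[OF C xt n ke cards] mone by blast+
  have weights: "real (card {y \<in> C. xt \<bullet> y = a}) = real N * sharp_weight n \<tau> a" if "a \<in> sharp_nodes n \<tau>" for a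
    using card_fibre_eq_weight[OF C xt n nodes(1) _ that[unfolded nodes(1)]] nodes(2) ke N by simp
  define E :: "real set" where "E = (if e = 1 then {-1} else {})"
  define Z0 where "Z0 = (\<bullet>) xt ` C - E"
  have EZ: "E \<subseteq> (\<bullet>) xt ` C" using mone by (auto simp: E_def)
  have Z0: "finite Z0" "Z0 \<subseteq> {-1<..<1}" using fC nodes(3) by (auto simp: Z0_def E_def)
  have cE: "card E = e" using ke by (auto simp: E_def)
  have cZ0: "card Z0 = k"
    unfolding Z0_def using EZ nodes(2) cE fC by (subst card_Diff_subset) (auto intro: finite_subset)
  have main: "(INF x \<in> sphere (0::real^'n) 1. \<Sum>y\<in>C. h (x \<bullet> y))
        = (\<Sum>a \<in> sharp_nodes n \<tau>. ereal (real N * sharp_weight n \<tau> a) * h a)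
      \<and> (\<Sum>y\<in>C. h (xt \<bullet> y)) = (\<Sum>a \<in> sharp_nodes n \<tau>. ereal (real N * sharp_weight n \<tau> a) * h a)"
    if pos: "\<forall>t\<in>{-1..1}. 0 \<le> h t" and cont: "continuous_on {-1..1} h" and fin: "\<forall>t\<in>{-1<..<1}. h t \<noteq> \<infinity>"
      and D0: "\<forall>t\<in>{-1<..<1}. D 0 t = real_of_ereal (h t)"
      and der: "\<forall>m\<le>\<tau>. \<forall>t\<in>{-1<..<1}. (D m has_real_derivative D (Suc m) t) (at t)"
      and Dpos: "\<forall>t\<in>{-1<..<1}. 0 \<le> D (Suc \<tau>) t" for h :: "real \<Rightarrow> ereal" and D
  proof -
    have "\<exists>H. degree H \<le> \<tau> \<and> (\<forall>s\<in>Z0 \<union> E. h s = ereal (poly H s)) \<and> (\<forall>t\<in>{-1..1}. ereal (poly H t) \<le> h t)"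
    proof (rule hermite_minorant[OF ke(1,2) Z0(1) cZ0 Z0(2), where h = h and D = D])
      show "0 \<le> h t" if "t \<in> {-1..1}" for t using pos that by blast
      show "continuous_on {-1..1} h" by (rule cont)
      show "h t \<noteq> \<infinity>" if "t \<in> {-1<..<1}" for t using fin that by blast
      show "D 0 t = real_of_ereal (h t)" if "t \<in> {-1<..<1}" for t using D0 that by blast
      show "(D m has_real_derivative D (Suc m) t) (at t)" if "m \<le> \<tau>" "t \<in> {-1<..<1}" for m t
        using der that by blast
      show "0 \<le> D (Suc \<tau>) t" if "t \<in> {-1<..<1}" for t using Dpos that by blast
      fix H assume "degree H \<le> \<tau>" "\<And>s. s \<in> Z0 \<union> (if e = 1 then {-1} else {}) \<Longrightarrow> h s = ereal (poly H s)"
        "\<And>t. t \<in> {-1..1} \<Longrightarrow> ereal (poly H t) \<le> h t"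
      then show ?thesis unfolding E_def by (intro exI[of _ H] conjI ballI)
    qed
    then obtain H where H: "degree H \<le> \<tau>" "\<forall>s\<in>Z0 \<union> E. h s = ereal (poly H s)"
      "\<forall>t\<in>{-1..1}. ereal (poly H t) \<le> h t" by (elim exE conjE)
    have hH: "h (xt \<bullet> y) = ereal (poly H (xt \<bullet> y))" if "y \<in> C" for y
    proof -
      have "xt \<bullet> y \<in> Z0 \<union> E" using that by (simp add: Z0_def)
      then show ?thesis by (rule H(2)[rule_format])
    qed
    have quad: "(\<Sum>y\<in>C. poly H (z \<bullet> y)) = real (card C) * mu_int n (poly H)" if "norm z = 1" for z
      by (rule design_quadrature[OF C that H(1) n])
    have at: "(\<Sum>y\<in>C. h (xt \<bullet> y)) = ereal (real (card C) * mu_int n (poly H))"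
      using hH quad[OF xt] by simp
    have low: "ereal (real (card C) * mu_int n (poly H)) \<le> (\<Sum>y\<in>C. h (z \<bullet> y))" if z: "norm z = 1" for z
    proof -
      have "z \<bullet> y \<in> {-1..1}" if "y \<in> C" for y
        using Cauchy_Schwarz_ineq2[of z y] z C1[OF that] by (auto simp: abs_le_iff)
      then have "(\<Sum>y\<in>C. ereal (poly H (z \<bullet> y))) \<le> (\<Sum>y\<in>C. h (z \<bullet> y))"
        by (intro sum_mono H(3)[rule_format])
      then show ?thesis using quad[OF z] by simp
    qed
    have "(INF x \<in> sphere (0::real^'n) 1. \<Sum>y\<in>C. h (x \<bullet> y)) = (\<Sum>y\<in>C. h (xt \<bullet> y))"
    proof (rule antisym)
      show "(INF x \<in> sphere (0::real^'n) 1. \<Sum>y\<in>C. h (x \<bullet> y)) \<le> (\<Sum>y\<in>C. h (xt \<bullet> y))"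
        using xt by (intro INF_lower) simp
      show "(\<Sum>y\<in>C. h (xt \<bullet> y)) \<le> (INF x \<in> sphere (0::real^'n) 1. \<Sum>y\<in>C. h (x \<bullet> y))"
        unfolding at by (intro INF_greatest low) simp
    qed
    moreover have "(\<Sum>y\<in>C. h (xt \<bullet> y)) = (\<Sum>a \<in> sharp_nodes n \<tau>. ereal (real N * sharp_weight n \<tau> a) * h a)"
    proof -
      have ha: "h a = ereal (poly H a)" if "a \<in> (\<bullet>) xt ` C" for a using hH that by auto
      have "(\<Sum>y\<in>C. poly H (xt \<bullet> y)) = (\<Sum>a\<in>(\<bullet>) xt ` C. \<Sum>y | y \<in> C \<and> xt \<bullet> y = a. poly H (xt \<bullet> y))"
        using fC by (rule sum.image_gen)
      also have "\<dots> = (\<Sum>a\<in>(\<bullet>) xt ` C. real N * sharp_weight n \<tau> a * poly H a)"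
        using weights unfolding nodes(1) by (intro sum.cong refl) simp
      finally have "(\<Sum>y\<in>C. h (xt \<bullet> y)) = ereal (\<Sum>a\<in>(\<bullet>) xt ` C. real N * sharp_weight n \<tau> a * poly H a)"
        using hH by simp
      then show ?thesis unfolding nodes(1) using ha by simp
    qed
    ultimately show ?thesis by simp
  qed
  show ?thesis
  proof (rule bexI[of _ xt], intro conjI ballI)
    show "(\<lambda>y. xt \<bullet> y) ` C = sharp_nodes n \<tau>" by (simp only: nodes(1))
    show "real (card {y \<in> C. xt \<bullet> y = a}) = real N * sharp_weight n \<tau> a" if "a \<in> sharp_nodes n \<tau>" for a
      using that by (rule weights)
    show "xt \<in> sphere 0 1" using xt by simp
  qed (intro allI impI, elim conjE exE, rule main)
qed

section \<open>Minimal vectors in cosets of lattices\<close>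

text \<open>The numbers \<open>\<kappa> * (x \<bullet> x)\<close> are natural, so well-ordering
  replaces a compactness argument.\<close>

lemma min_norm_exists:
  fixes Y :: "'a::real_inner set"
  assumes "Y \<noteq> {}" "\<kappa> > 0" "\<And>x. x \<in> Y \<Longrightarrow> \<kappa> * (x \<bullet> x) \<in> \<int>"
  obtains x where "x \<in> Y" "\<And>y. y \<in> Y \<Longrightarrow> x \<bullet> x \<le> y \<bullet> y"
proof -
  let ?f = "\<lambda>x. nat \<lfloor>\<kappa> * (x \<bullet> x)\<rfloor>"
  obtain y0 where "y0 \<in> Y" using assms(1) by blast
  then obtain x where x: "x \<in> Y" "\<forall>y. y \<in> Y \<longrightarrow> ?f x \<le> ?f y"
    using ex_has_least_nat[of "\<lambda>y. y \<in> Y" y0 ?f] by blast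
  have f: "real (?f y) = \<kappa> * (y \<bullet> y)" if "y \<in> Y" for y
    using assms(3)[OF that] assms(2) by (auto elim!: Ints_cases)
  show thesis
  proof (rule that[OF x(1)])
    fix y assume "y \<in> Y"
    then have "\<kappa> * (x \<bullet> x) \<le> \<kappa> * (y \<bullet> y)" using x f by (metis of_nat_mono)
    then show "x \<bullet> x \<le> y \<bullet> y" using assms(2) by simp
  qed
qed

text \<open>The diagonal of a symmetric matrix over the field with two elements lies in its column space;
  the proof eliminates a row with odd diagonal entry.\<close>
lemma symmetric_diagonal_mod_2:
  fixes g :: "'a \<Rightarrow> 'a \<Rightarrow> int"
  assumes "finite A" "\<And>a b. a \<in> A \<Longrightarrow> b \<in> A \<Longrightarrow> g a b = g b a"
  shows "\<exists>c :: 'a \<Rightarrow> int. \<forall>a\<in>A. even ((\<Sum>b\<in>A. c b * g a b) - g a a)"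
  using assms
proof (induction "card A" arbitrary: A g)
  case 0
  then show ?case by simp
next
  case (Suc m)
  show ?case
  proof (cases "\<forall>a\<in>A. even (g a a)")
    case True
    then show ?thesis by (intro exI[of _ "\<lambda>_. 0"]) auto
  next
    case False
    then obtain i where i: "i \<in> A" "odd (g i i)" by blast
    define A' where "A' = A - {i}"
    \<comment> \<open>One step of symmetric elimination; the pivot \<open>g i i\<close> is odd and
      thus equal to 1 modulo 2.\<close>
    define g' where "g' j k = g j k - g j i * g i k" for j k
    have A': "finite A'" "card A' = m" "A = insert i A'" "i \<notin> A'"
      using Suc.hyps(2) Suc.prems(1) i(1) by (auto simp: A'_def)
    have "\<exists>c. \<forall>a\<in>A'. even ((\<Sum>b\<in>A'. c b * g' a b) - g' a a)"
    proof (rule Suc.hyps(1))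
      show "g' a b = g' b a" if "a \<in> A'" "b \<in> A'" for a b
        using Suc.prems(2)[of a b] Suc.prems(2)[of a i] Suc.prems(2)[of i b] that i(1) by (simp add: g'_def A'_def)
    qed (use A' in auto)
    then obtain c where c: "\<And>a. a \<in> A' \<Longrightarrow> even ((\<Sum>b\<in>A'. c b * g' a b) - g' a a)" by blast
    define t where "t = (\<Sum>k\<in>A'. c k * g i k)"
    \<comment> \<open>The coefficient of \<open>i\<close> is the one that satisfies row
      \<open>i\<close>; in the other rows it compensates for the elimination.\<close>
    define c' where "c' = c(i := 1 - t)"
    have sum: "(\<Sum>b\<in>A. c' b * g a b) = (1 - t) * g a i + (\<Sum>b\<in>A'. c b * g a b)" for a
    proof -
      have "(\<Sum>b\<in>A'. c' b * g a b) = (\<Sum>b\<in>A'. c b * g a b)"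
        using A'(4) by (intro sum.cong) (auto simp: c'_def)
      then show ?thesis using A' by (simp add: c'_def)
    qed
    have "even ((\<Sum>b\<in>A. c' b * g a b) - g a a)" if "a \<in> A" for a
    proof (cases "a = i")
      case True
      have "(1 - t) * g i i + t - g i i = t * (1 - g i i)" by (simp add: algebra_simps)
      then show ?thesis using True i(2) by (simp add: sum t_def[symmetric])
    next
      case False
      then have a: "a \<in> A'" using that by (simp add: A'_def)
      have "(\<Sum>b\<in>A'. c b * g' a b) = (\<Sum>b\<in>A'. c b * g a b) - g a i * t"
        by (simp add: g'_def t_def right_diff_distrib sum_subtractf sum_distrib_left mult_ac)
      moreover have "g i a = g a i" using Suc.prems(2) i(1) that by blast
      ultimately have "(1 - t) * g a i + (\<Sum>b\<in>A'. c b * g a b) - g a a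
          = ((\<Sum>b\<in>A'. c b * g' a b) - g' a a) + g a i * (1 - g a i)"
        by (simp add: g'_def algebra_simps)
      moreover have "even (g a i * (1 - g a i))" by auto
      ultimately show ?thesis using c[OF a] by (simp add: sum)
    qed
    then show ?thesis by blast
  qed
qed

definition odd_real :: "real \<Rightarrow> bool" where
  "odd_real r \<longleftrightarrow> (\<exists>k::int. odd k \<and> r = of_int k)"

lemma odd_real_add_even: "odd_real r \<Longrightarrow> k \<in> \<int> \<Longrightarrow> odd_real (r + 2 * k)"
  unfolding odd_real_def by (metis Ints_cases even_add even_mult_iff even_numeral of_int_add of_int_mult of_int_numeral)

lemma odd_real_Ints: "odd_real r \<Longrightarrow> r \<in> \<int>"
  by (auto simp: odd_real_def)

text \<open>The coefficients solve the Gram system modulo 2 with the diagonal as right-hand side.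
  Since the diagonal is odd, all inner products come out odd.\<close>

lemma characteristic_vector:
  fixes A :: "'a::euclidean_space set"
  assumes A: "finite A" and int: "\<And>a b. a \<in> A \<Longrightarrow> b \<in> A \<Longrightarrow> a \<bullet> b \<in> \<int>"
    and odd: "\<And>a. a \<in> A \<Longrightarrow> odd_real (a \<bullet> a)"
  shows "\<exists>c :: 'a \<Rightarrow> int. \<forall>a\<in>A. odd_real ((\<Sum>b\<in>A. of_int (c b) *\<^sub>R b) \<bullet> a)"
proof -
  define g where "g a b = \<lfloor>a \<bullet> b\<rfloor>" for a b :: 'a
  have g: "of_int (g a b) = a \<bullet> b" if "a \<in> A" "b \<in> A" for a b
    using int[OF that] by (auto simp: g_def elim: Ints_cases)
  obtain c where c: "\<forall>a\<in>A. even ((\<Sum>b\<in>A. c b * g a b) - g a a)"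
    using symmetric_diagonal_mod_2[OF A, of g] by (auto simp: g_def inner_commute)
  have "odd_real ((\<Sum>b\<in>A. of_int (c b) *\<^sub>R b) \<bullet> a)" if a: "a \<in> A" for a
  proof -
    obtain l where l: "odd l" "a \<bullet> a = of_int l" using odd[OF a] by (auto simp: odd_real_def)
    have "g a a = l" using g[OF a a] l by linarith
    then have "odd (\<Sum>b\<in>A. c b * g a b)" using c a l(1) by (metis diff_add_cancel even_add)
    moreover have "(\<Sum>b\<in>A. of_int (c b) *\<^sub>R b) \<bullet> a = of_int (\<Sum>b\<in>A. c b * g a b)"
    proof -
      have "(\<Sum>b\<in>A. of_int (c b) *\<^sub>R b) \<bullet> a = (\<Sum>b\<in>A. of_int (c b) * (b \<bullet> a))"
        by (simp add: inner_sum_left)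
      also have "\<dots> = (\<Sum>b\<in>A. of_int (c b) * of_int (g a b))"
        using g[OF a] by (intro sum.cong) (simp_all only: inner_commute)
      finally show ?thesis by simp
    qed
    ultimately show ?thesis by (auto simp: odd_real_def)
  qed
  then show ?thesis by blast
qed

lemma sum_single_scaleR:
  fixes A :: "'a::real_vector set"
  assumes "finite A" "a \<in> A"
  shows "(\<Sum>b\<in>A. of_int (if b = a then k else 0) *\<^sub>R b) = of_int k *\<^sub>R a"
proof -
  have "(\<Sum>b\<in>A. of_int (if b = a then k else 0) *\<^sub>R b) = (\<Sum>b\<in>A. if b = a then of_int k *\<^sub>R a else 0)"
    by (intro sum.cong) auto
  then show ?thesis using assms by simp
qed

text \<open>Adding or subtracting \<open>2 * a\<close> keeps all products odd, so a shortest
  characteristic vector in the span is no longer than \<open>x + 2 * a\<close> and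
  \<open>x - 2 * a\<close>; expanding these norms gives the bound.\<close>

lemma short_characteristic_vector:
  fixes A :: "'a::euclidean_space set"
  assumes A: "finite A" and int: "\<And>a b. a \<in> A \<Longrightarrow> b \<in> A \<Longrightarrow> a \<bullet> b \<in> \<int>"
    and odd: "\<And>a. a \<in> A \<Longrightarrow> odd_real (a \<bullet> a)"
  obtains x where "\<And>a. a \<in> A \<Longrightarrow> odd_real (x \<bullet> a) \<and> \<bar>x \<bullet> a\<bar> \<le> a \<bullet> a"
proof -
  define Y where "Y = {x. (\<exists>c :: 'a \<Rightarrow> int. x = (\<Sum>b\<in>A. of_int (c b) *\<^sub>R b)) \<and> (\<forall>a\<in>A. odd_real (x \<bullet> a))}"
  have ne: "Y \<noteq> {}" using characteristic_vector[OF A int odd] by (auto simp: Y_def)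
  have xx: "1 * (x \<bullet> x) \<in> \<int>" if x: "x \<in> Y" for x
  proof -
    obtain c :: "'a \<Rightarrow> int" where c: "x = (\<Sum>b\<in>A. of_int (c b) *\<^sub>R b)" using x by (auto simp: Y_def)
    have "x \<bullet> x = (\<Sum>b\<in>A. of_int (c b) * (x \<bullet> b))" by (subst (2) c) (simp add: inner_sum_right)
    moreover have "x \<bullet> b \<in> \<int>" if "b \<in> A" for b using x that odd_real_Ints by (auto simp: Y_def)
    ultimately show ?thesis by (auto intro!: Ints_sum Ints_mult)
  qed
  obtain x where x: "x \<in> Y" "\<And>y. y \<in> Y \<Longrightarrow> x \<bullet> x \<le> y \<bullet> y"
    using min_norm_exists[OF ne zero_less_one xx] by blast
  have shift: "x + (2 * of_int k) *\<^sub>R a \<in> Y" if a: "a \<in> A" for a and k :: int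
  proof -
    obtain c :: "'a \<Rightarrow> int" where c: "x = (\<Sum>b\<in>A. of_int (c b) *\<^sub>R b)" using x by (auto simp: Y_def)
    have "x + (2 * of_int k) *\<^sub>R a = (\<Sum>b\<in>A. of_int (c b + (if b = a then 2 * k else 0)) *\<^sub>R b)"
      using sum_single_scaleR[OF A a, of "2 * k"] by (simp add: c scaleR_add_left sum.distrib)
    moreover have "odd_real ((x + (2 * of_int k) *\<^sub>R a) \<bullet> b)" if b: "b \<in> A" for b
    proof -
      have "odd_real (x \<bullet> b + 2 * (of_int k * (a \<bullet> b)))"
        using x(1) b int[OF a b] by (intro odd_real_add_even Ints_mult) (auto simp: Y_def)
      then show ?thesis by (simp add: inner_add_left mult.assoc)
    qed
    ultimately show ?thesis unfolding Y_def
      by (intro CollectI conjI exI[of _ "\<lambda>b. c b + (if b = a then 2 * k else 0)"] ballI)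
  qed
  have "\<bar>x \<bullet> a\<bar> \<le> a \<bullet> a" if a: "a \<in> A" for a
  proof -
    have "x \<bullet> x \<le> (x + (2 * of_int 1) *\<^sub>R a) \<bullet> (x + (2 * of_int 1) *\<^sub>R a)"
      "x \<bullet> x \<le> (x + (2 * of_int (- 1)) *\<^sub>R a) \<bullet> (x + (2 * of_int (- 1)) *\<^sub>R a)"
      by (rule x(2)[OF shift[OF a]])+
    then show ?thesis by (simp add: inner_add_left inner_add_right inner_diff_left inner_diff_right inner_commute abs_le_iff)
  qed
  with x(1) show thesis by (intro that[of x]) (auto simp: Y_def)
qed

text \<open>The Gram matrix of two mutually far cliques must stay positive semidefinite.\<close>
lemma far_cliques_bound:
  fixes I J :: "'a::real_inner set"
  assumes I: "finite I" "card I = p" and J: "finite J" "card J = p" and p: "p > 0"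
    and diag: "\<And>a. a \<in> I \<union> J \<Longrightarrow> a \<bullet> a = n0"
    and in_I: "\<And>a b. a \<in> I \<Longrightarrow> b \<in> I \<Longrightarrow> a \<noteq> b \<Longrightarrow> a \<bullet> b \<le> \<alpha>"
    and in_J: "\<And>a b. a \<in> J \<Longrightarrow> b \<in> J \<Longrightarrow> a \<noteq> b \<Longrightarrow> a \<bullet> b \<le> \<alpha>"
    and cross: "\<And>a b. a \<in> I \<Longrightarrow> b \<in> J \<Longrightarrow> a \<bullet> b = \<beta>"
  shows "0 \<le> n0 + (real p - 1) * \<alpha> + real p * \<beta>"
proof -
  have inner: "(\<Sum>a\<in>K. a) \<bullet> (\<Sum>a\<in>K. a) \<le> real p * (n0 + (real p - 1) * \<alpha>)"
    if K: "finite K" "card K = p" "\<And>a. a \<in> K \<Longrightarrow> a \<bullet> a = n0"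
      "\<And>a b. a \<in> K \<Longrightarrow> b \<in> K \<Longrightarrow> a \<noteq> b \<Longrightarrow> a \<bullet> b \<le> \<alpha>" for K :: "'a set"
  proof -
    have "(\<Sum>b\<in>K. a \<bullet> b) \<le> n0 + (real p - 1) * \<alpha>" if a: "a \<in> K" for a
    proof -
      have "(\<Sum>b\<in>K - {a}. a \<bullet> b) \<le> (\<Sum>b\<in>K - {a}. \<alpha>)" using K(4) a by (intro sum_mono) auto
      also have "\<dots> = (real p - 1) * \<alpha>" using K(1,2) a p by (simp add: card_Diff_singleton of_nat_diff)
      finally show ?thesis using K(1,3) a by (simp add: sum.remove)
    qed
    then have "(\<Sum>a\<in>K. \<Sum>b\<in>K. a \<bullet> b) \<le> (\<Sum>a\<in>K. n0 + (real p - 1) * \<alpha>)" by (rule sum_mono)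
    moreover have "(\<Sum>a\<in>K. a) \<bullet> (\<Sum>a\<in>K. a) = (\<Sum>a\<in>K. \<Sum>b\<in>K. a \<bullet> b)"
      unfolding inner_sum_left by (simp only: inner_sum_right)
    ultimately show ?thesis using K(2) by simp
  qed
  have c: "(\<Sum>a\<in>I. a) \<bullet> (\<Sum>b\<in>J. b) = real p * (real p * \<beta>)"
    using cross I J by (simp add: inner_sum_left inner_sum_right)
  have "0 \<le> ((\<Sum>a\<in>I. a) + (\<Sum>a\<in>J. a)) \<bullet> ((\<Sum>a\<in>I. a) + (\<Sum>a\<in>J. a))" by simp
  also have "\<dots> = (\<Sum>a\<in>I. a) \<bullet> (\<Sum>a\<in>I. a) + (\<Sum>a\<in>J. a) \<bullet> (\<Sum>a\<in>J. a) + 2 * ((\<Sum>a\<in>I. a) \<bullet> (\<Sum>a\<in>J. a))"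
    by (simp add: inner_add_left inner_add_right inner_commute)
  also have "\<dots> \<le> real p * (n0 + (real p - 1) * \<alpha>) + real p * (n0 + (real p - 1) * \<alpha>) + 2 * (real p * (real p * \<beta>))"
    unfolding c using I J diag in_I in_J by (intro add_mono inner order_refl) auto
  also have "\<dots> = 2 * real p * (n0 + (real p - 1) * \<alpha> + real p * \<beta>)" by (simp add: algebra_simps)
  finally show ?thesis using p by (simp add: zero_le_mult_iff)
qed

text \<open>\<open>t^3 - t\<close> vanishes at -1, 0 and 1 and otherwise has the sign of
  \<open>t\<close>. If one value exceeds \<open>m\<close> in absolute value, the hypotheses on the
  spread give all summands the same sign; as they sum to 0, all of them vanish, which the large
  value contradicts.\<close>

lemma cubic_sum_bound:
  fixes s :: "'a \<Rightarrow> int"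
  assumes A: "finite A" and zero: "(\<Sum>a\<in>A. s a) = 0" "(\<Sum>a\<in>A. s a ^ 3) = 0" and m: "m \<ge> 1"
    and up: "\<And>a b. a \<in> A \<Longrightarrow> b \<in> A \<Longrightarrow> s a > m \<Longrightarrow> s b \<ge> -1"
    and down: "\<And>a b. a \<in> A \<Longrightarrow> b \<in> A \<Longrightarrow> s a < - m \<Longrightarrow> s b \<le> 1"
    and a: "a \<in> A"
  shows "\<bar>s a\<bar> \<le> m"
proof (rule ccontr)
  have cube: "t ^ 3 - t = t * ((t - 1) * (t + 1))" for t :: int
    by (simp add: power3_eq_cube algebra_simps)
  have zero': "(\<Sum>b\<in>A. s b ^ 3 - s b) = 0" using zero by (simp add: sum_subtractf)
  assume "\<not> \<bar>s a\<bar> \<le> m"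
  then consider "s a > m" | "s a < - m" by linarith
  then show False
  proof cases
    case 1
    have "0 \<le> s b ^ 3 - s b" if "b \<in> A" for b
    proof -
      from up[OF a that 1] consider "s b = -1" | "s b = 0" | "s b \<ge> 1" by linarith
      then show ?thesis unfolding cube by cases auto
    qed
    then have "\<forall>b\<in>A. s b ^ 3 - s b = 0" using sum_nonneg_eq_0_iff[OF A, of "\<lambda>b. s b ^ 3 - s b"] zero' by simp
    then have "s a ^ 3 - s a = 0" using a by blast
    then show False unfolding cube using 1 m by auto
  next
    case 2
    have "0 \<le> - (s b ^ 3 - s b)" if "b \<in> A" for b
    proof -
      from down[OF a that 2] consider "s b = 1" | "s b = 0" | "s b \<le> -1" by linarith
      then show ?thesis unfolding cube by cases (auto simp: mult_nonpos_nonneg mult_nonpos_nonpos)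
    qed
    moreover have "(\<Sum>b\<in>A. - (s b ^ 3 - s b)) = 0" using zero' by (simp only: sum_negf)
    ultimately have "\<forall>b\<in>A. - (s b ^ 3 - s b) = 0"
      using sum_nonneg_eq_0_iff[OF A, of "\<lambda>b. - (s b ^ 3 - s b)"] by blast
    then have "- (s a ^ 3 - s a) = 0" using a by blast
    then show False unfolding cube using 2 m by auto
  qed
qed

text \<open>In the sum of \<open>s^3 - s\<close> a value \<open>m\<close> contributes
  \<open>m^3 - m\<close>, a value \<open>- m\<close> the opposite, and all others 0.\<close>

lemma cubic_sum_card:
  fixes s :: "'a \<Rightarrow> int"
  assumes A: "finite A" and zero: "(\<Sum>a\<in>A. s a) = 0" "(\<Sum>a\<in>A. s a ^ 3) = 0" and m: "m \<ge> 2"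
    and val: "\<And>a. a \<in> A \<Longrightarrow> s a \<in> {m, - m, 1, -1, 0}"
  shows "card {a \<in> A. s a = m} = card {a \<in> A. s a = - m}"
proof -
  have "(\<Sum>a\<in>A. s a ^ 3 - s a) = (\<Sum>a\<in>A. (m ^ 3 - m) * ((if s a = m then 1 else 0) - (if s a = - m then 1 else 0)))"
    using val m by (intro sum.cong) fastforce+
  also have "\<dots> = (m ^ 3 - m) * (int (card {a \<in> A. s a = m}) - int (card {a \<in> A. s a = - m}))"
    using A by (simp add: sum_distrib_left[symmetric] sum_subtractf sum.If_cases Int_def)
  finally have "(m ^ 3 - m) * (int (card {a \<in> A. s a = m}) - int (card {a \<in> A. s a = - m})) = 0"
    using zero by (simp add: sum_subtractf)
  moreover have "m ^ 3 - m = m * ((m - 1) * (m + 1))" by (simp add: power3_eq_cube algebra_simps)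
  then have "m ^ 3 - m \<noteq> 0" using m by auto
  ultimately show ?thesis by simp
qed

section \<open>Cosets of combinations with a fixed coefficient sum\<close>

lemma combination_inner:
  fixes A :: "'a::euclidean_space set"
  assumes "\<And>a b. a \<in> A \<Longrightarrow> b \<in> A \<Longrightarrow> a \<bullet> b - \<theta> \<in> \<int>" "b \<in> A"
  shows "(\<Sum>a\<in>A. of_int (c a) *\<^sub>R a) \<bullet> b - of_int (\<Sum>a\<in>A. c a) * \<theta> \<in> \<int>"
proof -
  have "(\<Sum>a\<in>A. of_int (c a) *\<^sub>R a) \<bullet> b - of_int (\<Sum>a\<in>A. c a) * \<theta> = (\<Sum>a\<in>A. of_int (c a) * (a \<bullet> b - \<theta>))"
    by (simp add: inner_sum_left right_diff_distrib sum_subtractf sum_distrib_right)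
  also have "\<dots> \<in> \<int>" using assms by (intro Ints_sum Ints_mult) auto
  finally show ?thesis .
qed

lemma combination_norm:
  fixes A :: "'a::euclidean_space set"
  assumes A: "finite A" and gram: "\<And>a b. a \<in> A \<Longrightarrow> b \<in> A \<Longrightarrow> a \<bullet> b - \<theta> \<in> \<int>"
    and diag: "\<And>a. a \<in> A \<Longrightarrow> (a \<bullet> a - \<theta>) / 2 \<in> \<int>"
  defines "w \<equiv> \<lambda>c. \<Sum>a\<in>A. of_int (c a) *\<^sub>R a"
  shows "(w c \<bullet> w c - (of_int (\<Sum>a\<in>A. c a))\<^sup>2 * \<theta>) / 2 \<in> \<int>"
proof -
  have "w c \<bullet> w c = (\<Sum>a\<in>A. \<Sum>b\<in>A. of_int (c a) * of_int (c b) * (a \<bullet> b))"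
    unfolding w_def by (simp add: inner_sum_left inner_sum_right sum_distrib_left mult_ac) (simp add: inner_commute)
  moreover have "(of_int (\<Sum>a\<in>A. c a))\<^sup>2 * \<theta> = (\<Sum>a\<in>A. \<Sum>b\<in>A. of_int (c a) * of_int (c b) * \<theta>)"
    unfolding power2_eq_square of_int_sum by (subst sum_product) (simp add: sum_distrib_right)
  ultimately have "w c \<bullet> w c - (of_int (\<Sum>a\<in>A. c a))\<^sup>2 * \<theta>
      = (\<Sum>a\<in>A. \<Sum>b\<in>A. of_int (c a) * of_int (c b) * (a \<bullet> b - \<theta>))"
    by (simp only: right_diff_distrib sum_subtractf)
  moreover have "(\<Sum>a\<in>A. \<Sum>b\<in>A. of_int (c a) * of_int (c b) * (a \<bullet> b - \<theta>)) / 2 \<in> \<int>"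
    using gram diag A by (intro symmetric_double_sum_even) (auto simp: inner_commute)
  ultimately show ?thesis by simp
qed

lemma frame_span:
  fixes A :: "'a::euclidean_space set"
  assumes "\<And>x. (\<Sum>a\<in>A. (x \<bullet> a)\<^sup>2) = K * (x \<bullet> x)" "K > 0"
  shows "span A = UNIV"
proof (rule ccontr)
  assume "span A \<noteq> UNIV"
  then have "dim A < DIM('a)" using dim_subset_UNIV[of A] dim_eq_full[of A] by linarith
  then obtain x where x: "x \<noteq> 0" "\<forall>a\<in>span A. x \<bullet> a = 0"
    using orthogonal_to_subspace_exists[of A] unfolding orthogonal_def by metis
  then have "(\<Sum>a\<in>A. (x \<bullet> a)\<^sup>2) = 0" by (simp add: span_base)
  then show False using assms x(1) by simp
qed

text \<open>The coset consists of \<open>x0\<close> plus all combinations with coefficient sum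
  \<open>j\<close>. It is closed under adding \<open>b - a\<close>, so minimality bounds the spread
  of the products by half the squared distance. The phase is constant on it, because
  \<open>x0\<close> pairs integrally with the combinations and their norms are
  \<open>j^2 * \<theta>\<close> modulo 2.\<close>

lemma coset_minimum:
  fixes A :: "'a::euclidean_space set" and q :: nat and j :: int
  assumes A: "finite A" "a0 \<in> A"
    and gram: "\<And>a b. a \<in> A \<Longrightarrow> b \<in> A \<Longrightarrow> a \<bullet> b - \<theta> \<in> \<int>"
    and diag: "\<And>a. a \<in> A \<Longrightarrow> (a \<bullet> a - \<theta>) / 2 \<in> \<int>"
    and q: "q > 0" "of_nat q * \<theta> \<in> \<int>"
    and frame: "\<And>x. (\<Sum>a\<in>A. (x \<bullet> a)\<^sup>2) = K * (x \<bullet> x)" "K > 0"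
    and x0: "\<And>a. a \<in> A \<Longrightarrow> x0 \<bullet> a \<in> \<int>"
  obtains x where "\<And>a. a \<in> A \<Longrightarrow> x \<bullet> a - of_int j * \<theta> \<in> \<int>"
    "cis (pi * (x \<bullet> x)) = cis (pi * (x0 \<bullet> x0)) * cis (pi * ((of_int j)\<^sup>2 * \<theta>))"
    "\<And>a b. a \<in> A \<Longrightarrow> b \<in> A \<Longrightarrow> x \<bullet> a - x \<bullet> b \<le> (a \<bullet> a + b \<bullet> b) / 2 - a \<bullet> b"
proof -
  define w where "w c = (\<Sum>a\<in>A. of_int (c a) *\<^sub>R a)" for c :: "'a \<Rightarrow> int"
  define Y where "Y = {x. \<exists>c. x = x0 + w c \<and> (\<Sum>a\<in>A. c a) = j}"
  have Yint: "x \<bullet> b - of_int j * \<theta> \<in> \<int>" if "x \<in> Y" and b: "b \<in> A" for x b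
  proof -
    from that obtain c where c: "x = x0 + w c" "(\<Sum>a\<in>A. c a) = j" by (auto simp: Y_def)
    have "w c \<bullet> b - of_int j * \<theta> \<in> \<int>"
      unfolding w_def c(2)[symmetric] by (rule combination_inner[OF gram b])
    then have "x0 \<bullet> b + (w c \<bullet> b - of_int j * \<theta>) \<in> \<int>" using x0[OF b] by (rule Ints_add[rotated])
    then show ?thesis by (simp add: c inner_add_left add_diff_eq)
  qed
  have "x0 + w (\<lambda>a. if a = a0 then j else 0) \<in> Y" unfolding Y_def using A by auto
  then have ne: "Y \<noteq> {}" by blast
  \<comment> \<open>The frame identity writes the norm through squares of numbers with denominator
    \<open>q\<close>, so the norms in the coset are discrete.\<close>
  have kap: "(of_nat q)\<^sup>2 * K * (x \<bullet> x) \<in> \<int>" if x: "x \<in> Y" for x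
  proof -
    have "(of_nat q)\<^sup>2 * K * (x \<bullet> x) = (\<Sum>a\<in>A. (of_nat q * (x \<bullet> a))\<^sup>2)"
      by (simp only: power_mult_distrib sum_distrib_left[symmetric] frame(1) mult.assoc)
    also have "\<dots> \<in> \<int>"
    proof (intro Ints_sum Ints_power)
      fix a assume a: "a \<in> A"
      have "of_nat q * (x \<bullet> a - of_int j * \<theta>) + of_int j * (of_nat q * \<theta>) \<in> \<int>"
        by (rule Ints_add[OF Ints_mult[OF Ints_of_nat Yint[OF x a]] Ints_mult[OF Ints_of_int q(2)]])
      then show "of_nat q * (x \<bullet> a) \<in> \<int>" by (simp add: algebra_simps)
    qed
    finally show ?thesis .
  qed
  obtain x where x: "x \<in> Y" "\<And>y. y \<in> Y \<Longrightarrow> x \<bullet> x \<le> y \<bullet> y"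
    using min_norm_exists[OF ne _ kap] q(1) frame(2) by auto
  show thesis
  proof (rule that[of x])
    show "x \<bullet> a - of_int j * \<theta> \<in> \<int>" if "a \<in> A" for a using Yint[OF x(1) that] .
    obtain c where c: "x = x0 + w c" "(\<Sum>a\<in>A. c a) = j" using x(1) by (auto simp: Y_def)
    have "x0 \<bullet> w c \<in> \<int>" unfolding w_def inner_sum_right using x0 by (intro Ints_sum) (auto intro: Ints_mult)
    moreover have "(w c \<bullet> w c - (of_int j)\<^sup>2 * \<theta>) / 2 \<in> \<int>"
      unfolding w_def c(2)[symmetric] by (rule combination_norm[OF A(1) gram diag])
    ultimately have "x0 \<bullet> w c + (w c \<bullet> w c - (of_int j)\<^sup>2 * \<theta>) / 2 \<in> \<int>" by (rule Ints_add)
    moreover have "pi * (x \<bullet> x) = (pi * (x0 \<bullet> x0) + pi * ((of_int j)\<^sup>2 * \<theta>))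
        + 2 * pi * (x0 \<bullet> w c + (w c \<bullet> w c - (of_int j)\<^sup>2 * \<theta>) / 2)"
      by (simp add: c(1) inner_add_left inner_add_right inner_commute field_simps)
    ultimately show "cis (pi * (x \<bullet> x)) = cis (pi * (x0 \<bullet> x0)) * cis (pi * ((of_int j)\<^sup>2 * \<theta>))"
      by (simp only: cis_int_shift cis_mult)
    fix a b assume ab: "a \<in> A" "b \<in> A"
    define c' where "c' d = c d + ((if d = b then 1 else 0) + (if d = a then - 1 else 0))" for d
    have "w c' = w c + b - a"
    proof -
      have "w c' = w c + (\<Sum>d\<in>A. of_int (if d = b then 1 else 0) *\<^sub>R d) + (\<Sum>d\<in>A. of_int (if d = a then - 1 else 0) *\<^sub>R d)"
        by (simp only: w_def c'_def of_int_add scaleR_add_left sum.distrib add.assoc)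
      then show ?thesis unfolding sum_single_scaleR[OF A(1) ab(1)] sum_single_scaleR[OF A(1) ab(2)] by simp
    qed
    moreover have "(\<Sum>d\<in>A. c' d) = j"
      using c(2) ab A(1) by (simp add: c'_def sum.distrib)
    ultimately have "x + b - a \<in> Y" unfolding Y_def using c(1) by (auto intro!: exI[of _ c'])
    then have "x \<bullet> x \<le> (x + b - a) \<bullet> (x + b - a)" by (rule x(2))
    then have "2 * (x \<bullet> a - x \<bullet> b) \<le> a \<bullet> a + b \<bullet> b - 2 * (a \<bullet> b)"
      by (simp add: inner_add_left inner_add_right inner_diff_left inner_diff_right inner_commute algebra_simps)
    then show "x \<bullet> a - x \<bullet> b \<le> (a \<bullet> a + b \<bullet> b) / 2 - a \<bullet> b" by (simp add: field_simps)
  qed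
qed

section \<open>Codes whose point is forced by the phase of a Gauss sum\<close>

lemma int_square_between:
  fixes m k :: int
  assumes "k\<^sup>2 < m" "m < (k + 1)\<^sup>2" "k \<ge> 0"
  shows "y\<^sup>2 \<noteq> m"
proof
  assume y: "y\<^sup>2 = m"
  have "\<bar>k\<bar> < \<bar>y\<bar>" by (rule power2_less_imp_less) (use assms y in auto)
  moreover have "\<bar>y\<bar> < \<bar>k + 1\<bar>" by (rule power2_less_imp_less) (use assms y in auto)
  ultimately show False using assms(3) by linarith
qed

lemma card_eq_0_filter: "finite A \<Longrightarrow> card {a \<in> A. Q a} = 0 \<longleftrightarrow> (\<forall>a\<in>A. \<not> Q a)"
  by auto

text \<open>Without such an \<open>x\<close>, the shortest vector in the coset of any
  \<open>x0\<close> dual to the span is 0, so \<open>x0\<close> has even norm and the Gauss sum over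
  \<open>B\<close> just counts \<open>B\<close>. The glue factor \<open>1 + \<i>\<close> has phase
  \<open>pi / 4\<close>, whereas dimension 23 demands \<open>- pi / 4\<close>.\<close>

lemma point_for_23_552:
  fixes A :: "'a::euclidean_space set"
  assumes dim: "DIM('a) = 23" and A: "finite A" "card A = 552"
    and diag: "\<And>a. a \<in> A \<Longrightarrow> a \<bullet> a = 5 / 2"
    and gram: "\<And>a b. a \<in> A \<Longrightarrow> b \<in> A \<Longrightarrow> a \<noteq> b \<Longrightarrow> a \<bullet> b \<in> {1 / 2, - 1 / 2, - 5 / 2}"
    and m2: "\<And>x. (\<Sum>a\<in>A. (x \<bullet> a)\<^sup>2) = 60 * (x \<bullet> x)"
    and m4: "\<And>x. (\<Sum>a\<in>A. (x \<bullet> a) ^ 4) = 18 * (x \<bullet> x)\<^sup>2"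
  shows "\<exists>x. x \<noteq> 0 \<and> (\<forall>a\<in>A. x \<bullet> a \<in> {-1, 0, 1})"
proof (rule ccontr)
  assume no: "\<nexists>x. x \<noteq> 0 \<and> (\<forall>a\<in>A. x \<bullet> a \<in> {-1, 0, 1})"
  have g1: "a \<bullet> b - 1 / 2 \<in> \<int>" if "a \<in> A" "b \<in> A" for a b
  proof -
    have "a \<bullet> b - 1 / 2 \<in> {of_int 2, of_int 0, of_int (- 1), of_int (- 3)}"
      using gram[OF that] diag[OF that(1)] by (cases "a = b") auto
    then show ?thesis by (elim insertE emptyE) (simp_all only: Ints_of_int)
  qed
  have g2: "(a \<bullet> a - 1 / 2) / 2 \<in> \<int>" if "a \<in> A" for a unfolding diag[OF that] by simp
  obtain a0 where a0: "a0 \<in> A" using A by fastforce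
  \<comment> \<open>Otherwise all other products with \<open>a\<close> would be \<open>1 / 2\<close>
    or \<open>- 1 / 2\<close>, and the squares would sum to 144 instead of 150.\<close>
  have antipode: "- a \<in> A" if a: "a \<in> A" for a
  proof (rule ccontr)
    assume na: "- a \<notin> A"
    have "(a \<bullet> b)\<^sup>2 = 1 / 4" if b: "b \<in> A - {a}" for b
    proof -
      have "a \<bullet> b \<noteq> - 5 / 2"
      proof
        assume "a \<bullet> b = - 5 / 2"
        then have "(a + b) \<bullet> (a + b) = 0" using diag[OF a] diag[of b] b
          by (simp add: inner_add_left inner_add_right inner_commute)
        then have "b = - a" by (simp add: eq_neg_iff_add_eq_0 add.commute)
        then show False using b na by simp
      qed
      moreover have "a \<bullet> b \<in> {1 / 2, - 1 / 2, - 5 / 2}" using gram[OF a, of b] b by blast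
      ultimately consider "a \<bullet> b = 1 / 2" | "a \<bullet> b = - 1 / 2" by blast
      then show ?thesis by cases (simp_all only:, simp_all add: power2_eq_square)
    qed
    then have "(\<Sum>b\<in>A - {a}. (a \<bullet> b)\<^sup>2) = (\<Sum>b\<in>A - {a}. 1 / 4)" by (rule sum.cong[OF refl])
    then have "(\<Sum>b\<in>A. (a \<bullet> b)\<^sup>2) = (5 / 2)\<^sup>2 + 551 / 4"
      using A a unfolding sum.remove[OF A(1) a] diag[OF a] by simp
    then show False unfolding m2 diag[OF a] by (simp add: power2_eq_square)
  qed
  have trivial: "cis (pi * (x0 \<bullet> x0)) = 1" if x0: "\<And>a. a \<in> A \<Longrightarrow> x0 \<bullet> a \<in> \<int>" for x0
  proof -
    obtain x where x: "\<And>a. a \<in> A \<Longrightarrow> x \<bullet> a - of_int 0 * (1 / 2) \<in> \<int>"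
      "cis (pi * (x \<bullet> x)) = cis (pi * (x0 \<bullet> x0)) * cis (pi * ((of_int 0)\<^sup>2 * (1 / 2)))"
      "\<And>a b. a \<in> A \<Longrightarrow> b \<in> A \<Longrightarrow> x \<bullet> a - x \<bullet> b \<le> (a \<bullet> a + b \<bullet> b) / 2 - a \<bullet> b"
      using coset_minimum[OF A(1) a0 g1 g2 _ _ m2, of 2 x0 0] x0 by auto
    define z where "z a = \<lfloor>x \<bullet> a\<rfloor>" for a
    have z: "x \<bullet> a = of_int (z a)" if "a \<in> A" for a using x(1)[OF that] by (auto simp: z_def elim: Ints_cases)
    have range: "x \<bullet> a - x \<bullet> b \<le> 5 / 2 - a \<bullet> b" if "a \<in> A" "b \<in> A" for a b
      using x(3)[OF that] diag that by simp
    have z2: "z a \<le> 2" if "a \<in> A" for a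
    proof -
      have "2 * (x \<bullet> a) \<le> 5" using range[OF that antipode[OF that]] diag[OF that] by simp
      then show ?thesis unfolding z[OF that] by linarith
    qed
    have zneg: "z (- a) = - z a" if "a \<in> A" for a
      using z[OF that] z[OF antipode[OF that]] by simp
    have other: "z b \<le> 1" if ab: "a \<in> A" "b \<in> A" "z a = 2" "b \<noteq> a" "b \<noteq> - a" for a b
    proof -
      have "a \<noteq> - b" using ab(5) by auto
      then have "a \<bullet> (- b) \<in> {1 / 2, - 1 / 2, - 5 / 2}" using gram[OF ab(1) antipode[OF ab(2)]] by blast
      moreover have "a \<bullet> b \<in> {1 / 2, - 1 / 2, - 5 / 2}" using gram[OF ab(1,2)] ab(4) by blast
      ultimately have "- (1 / 2) \<le> a \<bullet> (- b)" by auto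
      then have "x \<bullet> a - x \<bullet> (- b) \<le> 3" using range[OF ab(1) antipode[OF ab(2)]] by simp
      then show ?thesis using z[OF ab(1)] z[OF ab(2)] ab(3) by simp
    qed
    \<comment> \<open>The values 2 and -2 could occur only at one antipodal pair, so the sums of
      fourth powers and of squares would differ by 24. The second and fourth moments then give
      \<open>(M - 100)^2 = 14800\<close>, which is not a square.\<close>
    have "\<forall>a\<in>A. z a \<noteq> 2"
    proof (rule ccontr)
      assume "\<not> (\<forall>a\<in>A. z a \<noteq> 2)"
      then obtain a where a: "a \<in> A" "z a = 2" by blast
      have small: "z b \<in> {-1, 0, 1}" if "b \<in> A" "b \<noteq> a" "b \<noteq> - a" for b
      proof -
        have "- b \<noteq> a" "- b \<noteq> - a" using that(2,3) by (metis minus_minus)+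
        then have "z (- b) \<le> 1" by (rule other[OF a(1) antipode[OF that(1)] a(2)])
        moreover have "z b \<le> 1" by (rule other[OF a(1) that(1) a(2) that(2,3)])
        ultimately show ?thesis using zneg[OF that(1)] by auto
      qed
      have "a \<noteq> - a" using a zneg[OF a(1)] by auto
      have "(\<Sum>b\<in>A. z b ^ 4 - z b ^ 2) = (\<Sum>b\<in>{a, - a}. z b ^ 4 - z b ^ 2)"
        using A(1) a(1) antipode[OF a(1)] small by (intro sum.mono_neutral_right) fastforce+
      also have "\<dots> = 24" using \<open>a \<noteq> - a\<close> a zneg[OF a(1)] by simp
      finally have zs: "(\<Sum>b\<in>A. z b ^ 4) - (\<Sum>b\<in>A. z b ^ 2) = 24" by (simp add: sum_subtractf)
      define M where "M = (\<Sum>b\<in>A. z b ^ 2)"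
      have "60 * (x \<bullet> x) = of_int M" using m2[of x] z by (simp add: M_def)
      then have X: "x \<bullet> x = of_int M / 60" by simp
      have "18 * (x \<bullet> x)\<^sup>2 = of_int (\<Sum>b\<in>A. z b ^ 4)" using m4[of x] z by simp
      moreover have "(\<Sum>b\<in>A. z b ^ 4) = 24 + M" using zs by (simp add: M_def)
      ultimately have "18 * (x \<bullet> x)\<^sup>2 = of_int (24 + M)" by (simp only:)
      then have "of_int (M\<^sup>2) = (of_int (200 * (24 + M)) :: real)" unfolding X by (simp add: power_divide)
      then have "M\<^sup>2 = 200 * (24 + M)" by (simp only: of_int_eq_iff)
      then have "(M - 100)\<^sup>2 = 14800" by (simp add: power2_diff)
      then show False using int_square_between[of 121 14800 "M - 100"] by simp
    qed
    then have z1: "z a \<le> 1" if "a \<in> A" for a using z2[OF that] that by force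
    have "z a \<in> {-1, 0, 1}" if "a \<in> A" for a
      using z1[OF that] z1[OF antipode[OF that]] zneg[OF that] by auto
    then have "x \<bullet> a \<in> {-1, 0, 1}" if "a \<in> A" for a unfolding z[OF that] using that by fastforce
    then have "x = 0" using no by blast
    then show ?thesis using x(2) by simp
  qed
  have cov: "\<exists>j<2. of_int i / of_nat 2 - of_nat j * (1 / 2) \<in> (\<int> :: real set)" for i :: int
  proof (intro exI[of _ "nat (i mod 2)"] conjI)
    define k where "k = i div 2"
    have "i = 2 * k + i mod 2" by (simp add: k_def)
    then have "real_of_int (i mod 2) = of_int i - 2 * of_int k" by linarith
    moreover have "real (nat (i mod 2)) = real_of_int (i mod 2)" by simp
    ultimately have "of_int i / of_nat 2 - of_nat (nat (i mod 2)) * (1 / 2) = (of_int k :: real)"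
      by (simp only:) (simp add: field_simps)
    then show "of_int i / of_nat 2 - of_nat (nat (i mod 2)) * (1 / 2) \<in> (\<int> :: real set)"
      by (simp only: Ints_of_int)
  qed auto
  have inj: "j = j'" if h: "j < 2" "j' < 2" "of_nat j * (1 / 2) - of_nat j' * (1 / 2) \<in> (\<int> :: real set)" for j j' :: nat
  proof -
    obtain i where "real j * (1 / 2) - real j' * (1 / 2) = of_int i" using h(3) by (elim Ints_cases)
    then have "real_of_int (int j - int j') = of_int (2 * i)" by simp
    then have "int j - int j' = 2 * i" by (simp only: of_int_eq_iff)
    then show ?thesis using h by presburger
  qed
  obtain B r where B: "\<And>x a. x \<in> B \<Longrightarrow> a \<in> A \<Longrightarrow> x \<bullet> a \<in> \<int>" "r > (0::real)"
    "(\<Sum>x\<in>B. cis (pi * (x \<bullet> x))) * (\<Sum>j<2. cis (pi * (real j)\<^sup>2 * (a0 \<bullet> a0))) = r *\<^sub>R cis (DIM('a) * pi / 4)"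
    by (rule glue_gauss_sum[OF A(1) frame_span[OF m2] a0 g1 g2, of 2]) (use cov inj in auto)
  have "cis (pi * 5 / 2) = \<i>"
    using cis_int_shift[of 1 "pi / 2"] by (simp add: cis_pi_half[unfolded complex_eq_iff] complex_eq_iff field_simps)
  then have "of_nat (card B) * (1 + \<i>) = r *\<^sub>R cis (23 * pi / 4)"
    using B(3) trivial[OF B(1)] diag[OF a0] by (simp add: dim numeral_2_eq_2)
  also have "cis (23 * pi / 4) = cis (- (pi / 4))"
    using cis_int_shift[of 3 "- (pi / 4)"] by (simp add: field_simps)
  finally have "Re (of_nat (card B) * (1 + \<i>)) = r * cos (pi / 4)" "Im (of_nat (card B) * (1 + \<i>)) = - r * sin (pi / 4)"
    by simp_all
  then have "real (card B) = - (r * (sqrt 2 / 2))" by (simp add: sin_45)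
  moreover have "r * (sqrt 2 / 2) > 0" using B(2) by simp
  ultimately show False by linarith
qed

text \<open>All products are \<open>2 / 3\<close> modulo 1, hence \<open>q = 3\<close>. Without such
  an \<open>x\<close> every \<open>x0\<close> dual to the span again has even norm; the glue factor
  \<open>1 + 2 * cis (2 * pi / 3)\<close> is \<open>\<i> * sqrt 3\<close>, whereas dimension 22
  demands the phase \<open>- pi / 2\<close>.\<close>

lemma point_for_22_891:
  fixes A :: "'a::euclidean_space set"
  assumes dim: "DIM('a) = 22" and A: "finite A" "card A = 891"
    and diag: "\<And>a. a \<in> A \<Longrightarrow> a \<bullet> a = 8 / 3"
    and gram: "\<And>a b. a \<in> A \<Longrightarrow> b \<in> A \<Longrightarrow> a \<noteq> b \<Longrightarrow> a \<bullet> b \<in> {2 / 3, - 1 / 3, - 4 / 3}"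
    and m1: "\<And>x. (\<Sum>a\<in>A. x \<bullet> a) = 0" and m3: "\<And>x. (\<Sum>a\<in>A. (x \<bullet> a) ^ 3) = 0"
    and m2: "\<And>x. (\<Sum>a\<in>A. (x \<bullet> a)\<^sup>2) = 108 * (x \<bullet> x)"
    and m4: "\<And>x. (\<Sum>a\<in>A. (x \<bullet> a) ^ 4) = 36 * (x \<bullet> x)\<^sup>2"
  shows "\<exists>x. x \<noteq> 0 \<and> (\<forall>a\<in>A. x \<bullet> a \<in> {-1, 0, 1})"
proof (rule ccontr)
  assume no: "\<nexists>x. x \<noteq> 0 \<and> (\<forall>a\<in>A. x \<bullet> a \<in> {-1, 0, 1})"
  have g1: "a \<bullet> b - 2 / 3 \<in> \<int>" if "a \<in> A" "b \<in> A" for a b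
  proof -
    have "a \<bullet> b - 2 / 3 \<in> {of_int 2, of_int 0, of_int (- 1), of_int (- 2)}"
      using gram[OF that] diag[OF that(1)] by (cases "a = b") auto
    then show ?thesis by (elim insertE emptyE) (simp_all only: Ints_of_int)
  qed
  have g2: "(a \<bullet> a - 2 / 3) / 2 \<in> \<int>" if "a \<in> A" for a unfolding diag[OF that] by simp
  obtain a0 where a0: "a0 \<in> A" using A by fastforce
  have trivial: "cis (pi * (x0 \<bullet> x0)) = 1" if x0: "\<And>a. a \<in> A \<Longrightarrow> x0 \<bullet> a \<in> \<int>" for x0
  proof -
    obtain x where x: "\<And>a. a \<in> A \<Longrightarrow> x \<bullet> a - of_int 0 * (2 / 3) \<in> \<int>"
      "cis (pi * (x \<bullet> x)) = cis (pi * (x0 \<bullet> x0)) * cis (pi * ((of_int 0)\<^sup>2 * (2 / 3)))"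
      "\<And>a b. a \<in> A \<Longrightarrow> b \<in> A \<Longrightarrow> x \<bullet> a - x \<bullet> b \<le> (a \<bullet> a + b \<bullet> b) / 2 - a \<bullet> b"
      using coset_minimum[OF A(1) a0 g1 g2 _ _ m2, of 3 x0 0] x0 by auto
    define z where "z a = \<lfloor>x \<bullet> a\<rfloor>" for a
    have z: "x \<bullet> a = of_int (z a)" if "a \<in> A" for a using x(1)[OF that] by (auto simp: z_def elim: Ints_cases)
    have range: "x \<bullet> a - x \<bullet> b \<le> 8 / 3 - a \<bullet> b" if "a \<in> A" "b \<in> A" for a b
      using x(3)[OF that] diag that by simp
    have z4: "z a - z b \<le> 4" if ab: "a \<in> A" "b \<in> A" for a b
    proof -
      have "- (4 / 3) \<le> a \<bullet> b" using gram[OF ab] diag[OF ab(1)] by (cases "a = b") auto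
      then show ?thesis using range[OF ab] z[OF ab(1)] z[OF ab(2)] by linarith
    qed
    have s1: "(\<Sum>a\<in>A. z a) = 0" using m1[of x] z by (simp flip: of_int_sum)
    have s3: "(\<Sum>a\<in>A. z a ^ 3) = 0" using m3[of x] z by (simp flip: of_int_sum of_int_power)
    have zb: "\<bar>z a\<bar> \<le> 2" if "a \<in> A" for a
      by (rule cubic_sum_bound[OF A(1) s1 s3 _ _ _ that]) (use z4 in force)+
    define p where "p = card {a \<in> A. z a = 2}"
    have val: "z a \<in> {2, - 2, 1, - 1, 0}" if "a \<in> A" for a using zb[OF that] by auto
    have p': "card {a \<in> A. z a = - 2} = p"
      unfolding p_def using cubic_sum_card[OF A(1) s1 s3, of 2] val by auto
    \<comment> \<open>Points with value 2 and points with value -2 have mutual product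
      \<open>- 4 / 3\<close>, and positivity leaves \<open>p \<le> 3\<close>. Then the second and
      fourth moments give \<open>(M - 162)^2 = 26244 + 7776 * p\<close>, no square for these
      \<open>p\<close>.\<close>
    have "p = 0"
    proof (rule ccontr)
      assume "p \<noteq> 0"
      have "0 \<le> 8 / 3 + (real p - 1) * (2 / 3) + real p * (- 4 / 3)"
      proof (rule far_cliques_bound)
        show "card {a \<in> A. z a = 2} = p" "card {a \<in> A. z a = - 2} = p" by (simp_all add: p_def p'[unfolded p_def])
        show "a \<bullet> b = - 4 / 3" if "a \<in> {a \<in> A. z a = 2}" "b \<in> {a \<in> A. z a = - 2}" for a b
        proof -
          have ab: "a \<in> A" "b \<in> A" "z a = 2" "z b = - 2" "a \<noteq> b" using that by auto
          have "a \<bullet> b \<le> - 4 / 3" using range[OF ab(1,2)] z[OF ab(1)] z[OF ab(2)] ab(3,4) by simp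
          then show ?thesis using gram[OF ab(1,2,5)] by auto
        qed
        show "a \<bullet> b \<le> 2 / 3" if "a \<in> {a \<in> A. z a = 2}" "b \<in> {a \<in> A. z a = 2}" "a \<noteq> b" for a b
          using gram[of a b] that by auto
        show "a \<bullet> b \<le> 2 / 3" if "a \<in> {a \<in> A. z a = - 2}" "b \<in> {a \<in> A. z a = - 2}" "a \<noteq> b" for a b
          using gram[of a b] that by auto
      qed (use A(1) diag \<open>p \<noteq> 0\<close> in auto)
      then have "real p \<le> 3" by (simp add: field_simps)
      then have p3: "p \<in> {1, 2, 3}" using \<open>p \<noteq> 0\<close> by auto
      define M where "M = (\<Sum>a\<in>A. z a ^ 2)"
      have "(\<Sum>a\<in>A. z a ^ 4 - z a ^ 2) = (\<Sum>a\<in>A. 12 * ((if z a = 2 then 1 else 0) + (if z a = - 2 then 1 else 0)))"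
        using val by (intro sum.cong) fastforce+
      also have "\<dots> = 24 * int p"
        using A(1) p' by (simp add: sum_distrib_left[symmetric] sum.distrib sum.If_cases Int_def p_def)
      finally have "(\<Sum>a\<in>A. z a ^ 4) = M + 24 * int p" by (simp add: sum_subtractf M_def)
      then have "36 * (x \<bullet> x)\<^sup>2 = of_int (M + 24 * int p)" using m4[of x] z by (simp flip: of_int_sum of_int_power)
      moreover have "108 * (x \<bullet> x) = of_int M" using m2[of x] z by (simp add: M_def)
      then have "x \<bullet> x = of_int M / 108" by simp
      ultimately have "of_int (M\<^sup>2) = (of_int (324 * (M + 24 * int p)) :: real)" by (simp add: power_divide)
      then have "M\<^sup>2 = 324 * (M + 24 * int p)" by (simp only: of_int_eq_iff)
      then have "(M - 162)\<^sup>2 = 26244 + 7776 * int p" by (simp add: power2_diff)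
      then show False
        using p3 int_square_between[of 184 34020 "M - 162"] int_square_between[of 204 41796 "M - 162"]
          int_square_between[of 222 49572 "M - 162"] by auto
    qed
    then have "\<forall>a\<in>A. z a \<noteq> 2" "\<forall>a\<in>A. z a \<noteq> - 2"
      using p' card_eq_0_filter[OF A(1), of "\<lambda>a. z a = 2"] card_eq_0_filter[OF A(1), of "\<lambda>a. z a = - 2"]
      by (simp_all only: p_def)
    then have "z a \<in> {-1, 0, 1}" if "a \<in> A" for a using val[OF that] that by auto
    then have "x \<bullet> a \<in> {-1, 0, 1}" if "a \<in> A" for a unfolding z[OF that] using that by fastforce
    then have "x = 0" using no by blast
    then show ?thesis using x(2) by simp
  qed
  have cov: "\<exists>j<3. of_int i / of_nat 3 - of_nat j * (2 / 3) \<in> (\<int> :: real set)" for i :: int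
  proof (intro exI[of _ "nat (2 * i mod 3)"] conjI)
    define k where "k = (2 * i) div 3"
    have "2 * i = 3 * k + 2 * i mod 3" by (simp add: k_def)
    then have "real_of_int (2 * i mod 3) = 2 * of_int i - 3 * of_int k" by linarith
    moreover have "real (nat (2 * i mod 3)) = real_of_int (2 * i mod 3)" by simp
    ultimately have "of_int i / of_nat 3 - of_nat (nat (2 * i mod 3)) * (2 / 3) = (of_int (2 * k - i) :: real)"
      by (simp only:) (simp add: field_simps)
    then show "of_int i / of_nat 3 - of_nat (nat (2 * i mod 3)) * (2 / 3) \<in> (\<int> :: real set)"
      by (simp only: Ints_of_int)
  qed auto
  have inj: "j = j'" if h: "j < 3" "j' < 3" "of_nat j * (2 / 3) - of_nat j' * (2 / 3) \<in> (\<int> :: real set)" for j j' :: nat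
  proof -
    obtain i where "real j * (2 / 3) - real j' * (2 / 3) = of_int i" using h(3) by (elim Ints_cases)
    then have "real_of_int (2 * int j - 2 * int j') = of_int (3 * i)" by simp
    then have "2 * int j - 2 * int j' = 3 * i" by (simp only: of_int_eq_iff)
    then show ?thesis using h by presburger
  qed
  obtain B r where B: "\<And>x a. x \<in> B \<Longrightarrow> a \<in> A \<Longrightarrow> x \<bullet> a \<in> \<int>" "r > (0::real)"
    "(\<Sum>x\<in>B. cis (pi * (x \<bullet> x))) * (\<Sum>j<3. cis (pi * (real j)\<^sup>2 * (a0 \<bullet> a0))) = r *\<^sub>R cis (DIM('a) * pi / 4)"
    by (rule glue_gauss_sum[OF A(1) frame_span[OF m2] a0 g1 g2, of 3]) (use cov inj in auto)
  have c1: "cis (pi * 8 / 3) = cis (2 * pi / 3)"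
    using cis_int_shift[of 1 "2 * pi / 3"] by (simp add: field_simps)
  have c2: "cis (pi * 32 / 3) = cis (2 * pi / 3)"
    using cis_int_shift[of 5 "2 * pi / 3"] by (simp add: field_simps)
  have "(\<Sum>j<3. cis (pi * (real j)\<^sup>2 * (8 / 3))) = 1 + cis (pi * 8 / 3) + cis (pi * 32 / 3)"
    by (simp add: numeral_3_eq_3 mult.commute)
  then have "of_nat (card B) * (1 + 2 * cis (2 * pi / 3)) = r *\<^sub>R cis (22 * pi / 4)"
    using B(3) trivial[OF B(1)] diag[OF a0] by (simp add: dim c1 c2 add.commute)
  moreover have "cis (22 * pi / 4) = cis (- (pi / 2))"
    using cis_int_shift[of 3 "- (pi / 2)"] by (simp add: field_simps)
  ultimately have "Im (of_nat (card B) * (1 + 2 * cis (2 * pi / 3))) = - r" by (simp add: sin_pi_half)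
  then have "real (card B) * sqrt 3 = - r" by (simp add: sin_120)
  moreover have "real (card B) * sqrt 3 \<ge> 0" by simp
  ultimately show False using B(2) by linarith
qed

text \<open>The coset of coefficient sum 2 is the one with half-integral products. If its shortest
  vector always shows a value beyond \<open>1 / 2\<close>, the possible norms
  \<open>(7 + p) / 3\<close> with \<open>1 \<le> p \<le> 4\<close> confine the phases of all vectors
  dual to the span to a closed half-plane. Milgram's formula in dimension 21 makes the sum over them
  a negative real number, outside it.\<close>

lemma point_for_21_112:
  fixes A :: "'a::euclidean_space set"
  assumes dim: "DIM('a) = 21" and A: "finite A" "card A = 112"
    and diag: "\<And>a. a \<in> A \<Longrightarrow> a \<bullet> a = 9 / 4"
    and gram: "\<And>a b. a \<in> A \<Longrightarrow> b \<in> A \<Longrightarrow> a \<noteq> b \<Longrightarrow> a \<bullet> b \<in> {1 / 4, - 3 / 4}"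
    and m1: "\<And>x. (\<Sum>a\<in>A. x \<bullet> a) = 0" and m3: "\<And>x. (\<Sum>a\<in>A. (x \<bullet> a) ^ 3) = 0"
    and m2: "\<And>x. (\<Sum>a\<in>A. (x \<bullet> a)\<^sup>2) = 12 * (x \<bullet> x)"
  shows "\<exists>x. \<forall>a\<in>A. x \<bullet> a \<in> {- 1 / 2, 1 / 2}"
proof (rule ccontr)
  assume no: "\<nexists>x. \<forall>a\<in>A. x \<bullet> a \<in> {- 1 / 2, 1 / 2}"
  have g1: "a \<bullet> b - 1 / 4 \<in> \<int>" if "a \<in> A" "b \<in> A" for a b
  proof -
    have "a \<bullet> b - 1 / 4 \<in> {of_int 2, of_int 0, of_int (- 1)}"
      using gram[OF that] diag[OF that(1)] by (cases "a = b") auto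
    then show ?thesis by (elim insertE emptyE) (simp_all only: Ints_of_int)
  qed
  have g2: "(a \<bullet> a - 1 / 4) / 2 \<in> \<int>" if "a \<in> A" for a unfolding diag[OF that] by simp
  obtain a0 where a0: "a0 \<in> A" using A by fastforce
  \<comment> \<open>The four possible phases are \<open>- pi / 3\<close>, \<open>0\<close>,
    \<open>pi / 3\<close> and \<open>2 * pi / 3\<close>. The linear form vanishes at the two extreme
    ones and is positive at the others.\<close>
  have phase: "Re (cis (pi * (x0 \<bullet> x0))) + Im (cis (pi * (x0 \<bullet> x0))) / sqrt 3 \<ge> 0"
    if x0: "\<And>a. a \<in> A \<Longrightarrow> x0 \<bullet> a \<in> \<int>" for x0
  proof -
    obtain x where x: "\<And>a. a \<in> A \<Longrightarrow> x \<bullet> a - of_int 2 * (1 / 4) \<in> \<int>"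
      "cis (pi * (x \<bullet> x)) = cis (pi * (x0 \<bullet> x0)) * cis (pi * ((of_int 2)\<^sup>2 * (1 / 4)))"
      "\<And>a b. a \<in> A \<Longrightarrow> b \<in> A \<Longrightarrow> x \<bullet> a - x \<bullet> b \<le> (a \<bullet> a + b \<bullet> b) / 2 - a \<bullet> b"
      using coset_minimum[OF A(1) a0 g1 g2 _ _ m2, of 4 x0 2] x0 by auto
    \<comment> \<open>Twice the half-integral product, an odd integer.\<close>
    define z where "z a = 2 * \<lfloor>x \<bullet> a - 1 / 2\<rfloor> + 1" for a
    have z: "x \<bullet> a = of_int (z a) / 2" if h: "a \<in> A" for a
    proof -
      have "x \<bullet> a - 1 / 2 \<in> \<int>" using x(1)[OF h] by simp
      then obtain k where "x \<bullet> a - 1 / 2 = of_int k" by (elim Ints_cases)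
      then show ?thesis by (simp add: z_def)
    qed
    have zodd: "odd (z a)" for a by (simp add: z_def)
    have range: "of_int (z a - z b) \<le> 2 * (9 / 4 - a \<bullet> b)" if "a \<in> A" "b \<in> A" for a b
      using x(3)[OF that] diag that z by simp
    have z6: "z a - z b \<le> 6" if ab: "a \<in> A" "b \<in> A" for a b
    proof -
      have "- (3 / 4) \<le> a \<bullet> b" using gram[OF ab] diag[OF ab(1)] by (cases "a = b") auto
      then have "2 * (9 / 4 - a \<bullet> b) \<le> 6" by (simp add: field_simps)
      then have "real_of_int (z a - z b) \<le> 6" using range[OF ab] by (rule order_trans[rotated])
      then show ?thesis by linarith
    qed
    have s1: "(\<Sum>a\<in>A. z a) = 0"
      using m1[of x] z by (simp add: sum_divide_distrib[symmetric] flip: of_int_sum)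
    have s3: "(\<Sum>a\<in>A. z a ^ 3) = 0"
      using m3[of x] z by (simp add: power_divide sum_divide_distrib[symmetric] flip: of_int_sum of_int_power)
    have zb: "\<bar>z a\<bar> \<le> 3" if "a \<in> A" for a
    proof (rule cubic_sum_bound[OF A(1) s1 s3 _ _ _ that])
      show "- 1 \<le> z c" if "b \<in> A" "c \<in> A" "3 < z b" for b c
      proof -
        have "z b \<noteq> 4" using zodd[of b] by auto
        then show ?thesis using z6[OF that(1,2)] that(3) by linarith
      qed
      show "z c \<le> 1" if "b \<in> A" "c \<in> A" "z b < - 3" for b c
      proof -
        have "z b \<noteq> - 4" using zodd[of b] by auto
        then show ?thesis using z6[OF that(2,1)] that(3) by linarith
      qed
    qed simp
    define p where "p = card {a \<in> A. z a = 3}"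
    have val: "z a \<in> {3, - 3, 1, - 1}" if "a \<in> A" for a
    proof -
      have "z a \<noteq> 2" "z a \<noteq> 0" "z a \<noteq> - 2" using zodd[of a] by auto
      then show ?thesis using zb[OF that] by auto
    qed
    have p': "card {a \<in> A. z a = - 3} = p"
      unfolding p_def using val by (intro cubic_sum_card[OF A(1) s1 s3, of 3, symmetric]) (simp, blast)
    have "p \<noteq> 0"
    proof
      assume "p = 0"
      then have "\<forall>a\<in>A. z a \<noteq> 3" "\<forall>a\<in>A. z a \<noteq> - 3"
        using p' card_eq_0_filter[OF A(1), of "\<lambda>a. z a = 3"] card_eq_0_filter[OF A(1), of "\<lambda>a. z a = - 3"]
        by (simp_all only: p_def)
      then have "z a \<in> {1, - 1}" if "a \<in> A" for a using val[OF that] that by auto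
      then have "x \<bullet> a \<in> {- 1 / 2, 1 / 2}" if "a \<in> A" for a unfolding z[OF that] using that by fastforce
      then show False using no by blast
    qed
    have "0 \<le> 9 / 4 + (real p - 1) * (1 / 4) + real p * (- 3 / 4)"
    proof (rule far_cliques_bound)
      show "card {a \<in> A. z a = 3} = p" "card {a \<in> A. z a = - 3} = p" by (simp_all add: p_def p'[unfolded p_def])
      show "a \<bullet> b = - 3 / 4" if "a \<in> {a \<in> A. z a = 3}" "b \<in> {a \<in> A. z a = - 3}" for a b
      proof -
        have ab: "a \<in> A" "b \<in> A" "z a = 3" "z b = - 3" "a \<noteq> b" using that by auto
        have "a \<bullet> b \<le> - 3 / 4" using range[OF ab(1,2)] ab(3,4) by simp
        then show ?thesis using gram[OF ab(1,2,5)] by auto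
      qed
      show "a \<bullet> b \<le> 1 / 4" if "a \<in> {a \<in> A. z a = 3}" "b \<in> {a \<in> A. z a = 3}" "a \<noteq> b" for a b
        using gram[of a b] that by auto
      show "a \<bullet> b \<le> 1 / 4" if "a \<in> {a \<in> A. z a = - 3}" "b \<in> {a \<in> A. z a = - 3}" "a \<noteq> b" for a b
        using gram[of a b] that by auto
    qed (use A(1) diag \<open>p \<noteq> 0\<close> in auto)
    then have "real p \<le> 4" by (simp add: field_simps)
    then have p4: "p \<in> {1, 2, 3, 4}" using \<open>p \<noteq> 0\<close> by auto
    have "(\<Sum>a\<in>A. z a ^ 2) = (\<Sum>a\<in>A. 1 + 8 * ((if z a = 3 then 1 else 0) + (if z a = - 3 then 1 else 0)))"
      using val by (intro sum.cong) fastforce+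
    also have "\<dots> = 112 + 16 * int p"
      using A p' by (simp add: sum_distrib_left[symmetric] sum.distrib sum.If_cases Int_def p_def)
    finally have "(\<Sum>a\<in>A. (of_int (z a) / 2)\<^sup>2 :: real) = of_int (112 + 16 * int p) / 4"
      by (simp add: power_divide sum_divide_distrib[symmetric] flip: of_int_sum of_int_power)
    then have "12 * (x \<bullet> x) = 28 + 4 * real p" using m2[of x] z by simp
    then have X: "x \<bullet> x = (7 + real p) / 3" by simp
    have "cis (pi * (x0 \<bullet> x0)) = - cis (pi * ((7 + real p) / 3))" using x(2) unfolding X by simp
    moreover consider "p = 1" | "p = 2" | "p = 3" | "p = 4" using p4 by auto
    then have "Re (- cis (pi * ((7 + real p) / 3))) + Im (- cis (pi * ((7 + real p) / 3))) / sqrt 3 \<ge> 0"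
    proof cases
      case 1
      have "cis (pi * ((7 + real p) / 3)) = cis (2 * pi / 3)"
        using cis_int_shift[of 1 "2 * pi / 3"] 1 by (simp add: field_simps)
      then show ?thesis by (simp add: cos_120 sin_120)
    next
      case 2
      have "cis (pi * ((7 + real p) / 3)) = cis pi"
        using cis_int_shift[of 1 "pi"] 2 by (simp add: field_simps)
      then show ?thesis by simp
    next
      case 3
      have "cis (pi * ((7 + real p) / 3)) = - cis (pi / 3)"
      proof -
        have "pi * ((7 + real p) / 3) = (pi / 3 + pi) + 2 * pi * 1" using 3 by (simp add: field_simps)
        then have "cis (pi * ((7 + real p) / 3)) = cis (pi / 3 + pi)" by (simp only: cis_int_shift[OF Ints_1])
        then show ?thesis by (simp only: cis_mult[symmetric]) simp
      qed
      then show ?thesis by (simp add: cos_60 sin_60)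
    next
      case 4
      have "cis (pi * ((7 + real p) / 3)) = cis (- (pi / 3))"
        using cis_int_shift[of 2 "- (pi / 3)"] 4 by (simp add: field_simps)
      then show ?thesis by (simp add: cos_60 sin_60)
    qed
    ultimately show ?thesis by (simp only:)
  qed
  have cov: "\<exists>j<4. of_int i / of_nat 4 - of_nat j * (1 / 4) \<in> (\<int> :: real set)" for i :: int
  proof (intro exI[of _ "nat (i mod 4)"] conjI)
    define k where "k = i div 4"
    have "i = 4 * k + i mod 4" by (simp add: k_def)
    then have "real_of_int (i mod 4) = of_int i - 4 * of_int k" by linarith
    moreover have "real (nat (i mod 4)) = real_of_int (i mod 4)" by simp
    ultimately have "of_int i / of_nat 4 - of_nat (nat (i mod 4)) * (1 / 4) = (of_int k :: real)"
      by (simp only:) (simp add: field_simps)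
    then show "of_int i / of_nat 4 - of_nat (nat (i mod 4)) * (1 / 4) \<in> (\<int> :: real set)"
      by (simp only: Ints_of_int)
  qed auto
  have inj: "j = j'" if h: "j < 4" "j' < 4" "of_nat j * (1 / 4) - of_nat j' * (1 / 4) \<in> (\<int> :: real set)" for j j' :: nat
  proof -
    obtain i where "real j * (1 / 4) - real j' * (1 / 4) = of_int i" using h(3) by (elim Ints_cases)
    then have "real_of_int (int j - int j') = of_int (4 * i)" by simp
    then have "int j - int j' = 4 * i" by (simp only: of_int_eq_iff)
    then show ?thesis using h by presburger
  qed
  obtain B r where B: "finite B" "\<And>x a. x \<in> B \<Longrightarrow> a \<in> A \<Longrightarrow> x \<bullet> a \<in> \<int>" "r > (0::real)"
    "(\<Sum>x\<in>B. cis (pi * (x \<bullet> x))) * (\<Sum>j<4. cis (pi * (real j)\<^sup>2 * (a0 \<bullet> a0))) = r *\<^sub>R cis (DIM('a) * pi / 4)"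
    by (rule glue_gauss_sum[OF A(1) frame_span[OF m2] a0 g1 g2, of 4]) (use cov inj in auto)
  define S where "S = (\<Sum>x\<in>B. cis (pi * (x \<bullet> x)))"
  have c1: "cis (pi * 9 / 4) = cis (pi / 4)"
    using cis_int_shift[of 1 "pi / 4"] by (simp add: field_simps)
  have c2: "cis (pi * 9) = - 1"
    using cis_int_shift[of 4 "pi"] by (simp add: field_simps)
  have c3: "cis (pi * 81 / 4) = cis (pi / 4)"
    using cis_int_shift[of 10 "pi / 4"] by (simp add: field_simps)
  have c4: "cis (21 * pi / 4) = - cis (pi / 4)"
  proof -
    have "21 * pi / 4 = (pi / 4 + pi) + 2 * pi * 2" by (simp add: field_simps)
    then have "cis (21 * pi / 4) = cis (pi / 4 + pi)" by (simp only: cis_int_shift[OF Ints_numeral])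
    then show ?thesis by (simp only: cis_mult[symmetric]) simp
  qed
  \<comment> \<open>The term of \<open>j = 2\<close> cancels that of \<open>j = 0\<close>, so the
    glue factor is \<open>2 * cis (pi / 4)\<close>.\<close>
  have "(\<Sum>j<4. cis (pi * (real j)\<^sup>2 * (9 / 4))) = 1 + cis (pi * 9 / 4) + cis (pi * 9) + cis (pi * 81 / 4)"
    by (simp add: eval_nat_numeral mult.commute)
  then have "S * (2 * cis (pi / 4)) = r *\<^sub>R (- cis (pi / 4))"
    using B(4) diag[OF a0] by (simp add: dim c1 c2 c3 c4 S_def)
  then have "S * 2 = - of_real r" by (simp add: scaleR_conv_of_real) (metis cis_neq_zero mult.commute mult.left_commute mult_cancel_left mult_minus_right)
  then have "Re S = - r / 2" "Im S = 0" by (auto simp: complex_eq_iff)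
  moreover have "Re S + Im S / sqrt 3 = (\<Sum>x\<in>B. Re (cis (pi * (x \<bullet> x))) + Im (cis (pi * (x \<bullet> x))) / sqrt 3)"
    by (simp only: S_def Re_sum Im_sum sum.distrib sum_divide_distrib)
  moreover have "\<dots> \<ge> 0" using phase B(2) by (intro sum_nonneg) blast
  ultimately show False using B(3) by simp
qed

text \<open>Gram matrices whose entries are all congruent modulo \<^term>\<open>q\<close>: the shortest characteristic vector
  has inner products at most 3, and the norm equation excludes 3.\<close>
lemma point_for_odd_two_distance_code:
  fixes A :: "'a::euclidean_space set" and q :: nat and n0 K :: real
  assumes A: "finite A" "A \<noteq> {}" and q: "q > 0"
    and diag: "\<And>a. a \<in> A \<Longrightarrow> a \<bullet> a = n0" and n0: "odd_real n0"
    and gram: "\<And>a b. a \<in> A \<Longrightarrow> b \<in> A \<Longrightarrow> a \<noteq> b \<Longrightarrow> a \<bullet> b \<in> {n0 - 2 * q, n0 - 3 * q}"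
    and m1: "\<And>x. (\<Sum>a\<in>A. x \<bullet> a) = 0" and m3: "\<And>x. (\<Sum>a\<in>A. (x \<bullet> a) ^ 3) = 0"
    and m2: "\<And>x. (\<Sum>a\<in>A. (x \<bullet> a)\<^sup>2) = K * (x \<bullet> x)" and K: "K > 0"
    and norms: "\<And>p :: nat. p > 0 \<Longrightarrow> 0 \<le> n0 + (real p - 1) * (n0 - 2 * q) + real p * (n0 - 3 * q) \<Longrightarrow>
      real q * ((real (card A) + 16 * real p) / K) \<notin> \<int>"
  shows "\<exists>x. \<forall>a\<in>A. x \<bullet> a \<in> {-1, 1}"
proof -
  have n0i: "n0 \<in> \<int>" using n0 by (rule odd_real_Ints)
  have int: "a \<bullet> b \<in> \<int>" if "a \<in> A" "b \<in> A" for a b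
  proof (cases "a = b")
    case False
    then have "a \<bullet> b = n0 - of_nat (2 * q) \<or> a \<bullet> b = n0 - of_nat (3 * q)" using gram[OF that] by auto
    then show ?thesis using n0i Ints_diff Ints_of_nat by metis
  qed (use n0i diag that in simp)
  \<comment> \<open>All products are congruent to \<open>n0\<close> modulo \<open>q\<close>, so the
    vectors \<open>(a - b) / q\<close> pair integrally with \<open>A\<close>.\<close>
  have mod: "(a - b) \<bullet> c / q \<in> \<int>" if "a \<in> A" "b \<in> A" "c \<in> A" for a b c
  proof -
    have "\<exists>k::int. d \<bullet> c = n0 - of_int k * q" if "d \<in> A" for d
    proof (cases "d = c")
      case True
      then show ?thesis using diag[OF that] by (intro exI[of _ 0]) simp
    next
      case False
      then show ?thesis using gram[OF that \<open>c \<in> A\<close>] by (auto intro: exI[of _ 2] exI[of _ 3])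
    qed
    then obtain k l :: int where "a \<bullet> c = n0 - of_int k * q" "b \<bullet> c = n0 - of_int l * q" using \<open>a \<in> A\<close> \<open>b \<in> A\<close> by blast
    then have "(a - b) \<bullet> c / q = of_int (l - k)" using q by (simp add: inner_diff_left field_simps)
    then show ?thesis by (simp only: Ints_of_int)
  qed
  \<comment> \<open>The span of \<open>A\<close> is refined by \<open>1 / q\<close> to contain these
    quotients; the norms of its vectors with integral products then have denominator at most
    \<open>q\<close>.\<close>
  define w where "w c = (\<Sum>b\<in>A. (of_int (c b) / of_nat q) *\<^sub>R b)" for c :: "'a \<Rightarrow> int"
  define Y where "Y = {x. (\<exists>c. x = w c) \<and> (\<forall>a\<in>A. odd_real (x \<bullet> a))}"
  obtain c0 :: "'a \<Rightarrow> int" where c0: "\<forall>a\<in>A. odd_real ((\<Sum>b\<in>A. of_int (c0 b) *\<^sub>R b) \<bullet> a)"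
    using characteristic_vector[OF A(1) int] n0 diag by auto
  have "(\<Sum>b\<in>A. of_int (c0 b) *\<^sub>R b) = w (\<lambda>b. int q * c0 b)" using q by (simp add: w_def)
  then have ne: "Y \<noteq> {}" using c0 unfolding Y_def by auto
  have qX: "real q * (x \<bullet> x) \<in> \<int>" if x: "x \<in> Y" for x
  proof -
    obtain c where c: "x = w c" using x by (auto simp: Y_def)
    have "x \<bullet> x = (\<Sum>b\<in>A. of_int (c b) / of_nat q * (x \<bullet> b))"
      by (subst (2) c) (simp add: w_def inner_sum_right)
    then have "real q * (x \<bullet> x) = (\<Sum>b\<in>A. of_int (c b) * (x \<bullet> b))" using q by (simp add: sum_distrib_left)
    moreover have "x \<bullet> b \<in> \<int>" if "b \<in> A" for b using x that odd_real_Ints by (auto simp: Y_def)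
    ultimately show ?thesis by (auto intro!: Ints_sum Ints_mult)
  qed
  obtain x where x: "x \<in> Y" "\<And>y. y \<in> Y \<Longrightarrow> x \<bullet> x \<le> y \<bullet> y"
    using min_norm_exists[OF ne _ qX] q by auto
  have xodd: "odd_real (x \<bullet> a)" if "a \<in> A" for a using x(1) that by (auto simp: Y_def)
  define z where "z a = \<lfloor>x \<bullet> a\<rfloor>" for a
  have z: "x \<bullet> a = of_int (z a)" "odd (z a)" if "a \<in> A" for a
    using xodd[OF that] by (auto simp: z_def odd_real_def)
  \<comment> \<open>Minimality under the move by \<open>(2 / q)\<close> times \<open>b - a\<close>,
    which keeps all products odd.\<close>
  have range: "of_int (z a - z b) \<le> 2 * (n0 - a \<bullet> b) / q" if ab: "a \<in> A" "b \<in> A" for a b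
  proof -
    obtain c where c: "x = w c" using x(1) by (auto simp: Y_def)
    let ?y = "x - (2 / q) *\<^sub>R (a - b)"
    define c' where "c' d = c d + ((if d = b then 2 else 0) + (if d = a then - 2 else 0))" for d
    have "w c' = (1 / q) *\<^sub>R (\<Sum>d\<in>A. of_int (c' d) *\<^sub>R d)" by (simp add: w_def scaleR_sum_right)
    also have "(\<Sum>d\<in>A. of_int (c' d) *\<^sub>R d) = (\<Sum>d\<in>A. of_int (c d) *\<^sub>R d)
        + (\<Sum>d\<in>A. of_int (if d = b then 2 else 0) *\<^sub>R d) + (\<Sum>d\<in>A. of_int (if d = a then - 2 else 0) *\<^sub>R d)"
      by (simp only: c'_def of_int_add scaleR_add_left sum.distrib add.assoc)
    also have "\<dots> = (\<Sum>d\<in>A. of_int (c d) *\<^sub>R d) + 2 *\<^sub>R b - 2 *\<^sub>R a"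
      unfolding sum_single_scaleR[OF A(1) ab(1)] sum_single_scaleR[OF A(1) ab(2)] by simp
    also have "(1 / q) *\<^sub>R \<dots> = ?y"
      by (simp add: c w_def scaleR_sum_right scaleR_add_right scaleR_diff_right)
    finally have "?y = w c'" ..
    moreover have "odd_real (?y \<bullet> d)" if d: "d \<in> A" for d
    proof -
      have "odd_real (x \<bullet> d + 2 * (- ((a - b) \<bullet> d / q)))"
        using xodd[OF d] Ints_minus[OF mod[OF ab d]] by (rule odd_real_add_even)
      then show ?thesis by (simp add: inner_diff_left[of x])
    qed
    ultimately have "?y \<in> Y" by (auto simp: Y_def)
    then have le: "x \<bullet> x \<le> ?y \<bullet> ?y" by (rule x(2))
    have "(a - b) \<bullet> (a - b) = 2 * (n0 - a \<bullet> b)"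
      using diag ab by (simp add: inner_diff_left inner_diff_right inner_commute)
    moreover have "(x - t *\<^sub>R d) \<bullet> (x - t *\<^sub>R d) = x \<bullet> x - 2 * t * (x \<bullet> d) + t * (t * (d \<bullet> d))" for t d
      by (simp add: inner_diff_left inner_diff_right inner_commute[of d x] algebra_simps)
    ultimately have "2 * (2 / q) * (x \<bullet> (a - b)) \<le> (2 / q) * ((2 / q) * (2 * (n0 - a \<bullet> b)))"
      using le by simp
    then have "(4 / q) * (x \<bullet> (a - b)) \<le> (4 / q) * (2 * (n0 - a \<bullet> b) / q)" by (simp add: mult_ac)
    then have "x \<bullet> (a - b) \<le> 2 * (n0 - a \<bullet> b) / q" by (rule mult_left_le_imp_le) (use q in simp)
    then have "x \<bullet> a - x \<bullet> b \<le> 2 * (n0 - a \<bullet> b) / q" by (simp only: inner_diff_right)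
    then show ?thesis using z(1) ab by simp
  qed
  have z6: "z a - z b \<le> 6" if ab: "a \<in> A" "b \<in> A" for a b
  proof -
    have "n0 - a \<bullet> b \<le> 3 * q" using gram[OF ab] diag[OF ab(1)] by (cases "a = b") auto
    then have "2 * (n0 - a \<bullet> b) / q \<le> 6" using q by (simp add: field_simps)
    then have "real_of_int (z a - z b) \<le> 6" using range[OF ab] by (rule order_trans[rotated])
    then show ?thesis by linarith
  qed
  have s1: "(\<Sum>a\<in>A. z a) = 0" using m1[of x] z by (simp flip: of_int_sum)
  have s3: "(\<Sum>a\<in>A. z a ^ 3) = 0" using m3[of x] z by (simp flip: of_int_sum of_int_power)
  have zb: "\<bar>z a\<bar> \<le> 3" if "a \<in> A" for a
  proof (rule cubic_sum_bound[OF A(1) s1 s3 _ _ _ that])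
    show "- 1 \<le> z c" if "b \<in> A" "c \<in> A" "3 < z b" for b c
    proof -
      have "z b \<noteq> 4" using z(2)[OF that(1)] by auto
      then show ?thesis using z6[OF that(1,2)] that(3) by linarith
    qed
    show "z c \<le> 1" if "b \<in> A" "c \<in> A" "z b < - 3" for b c
    proof -
      have "z b \<noteq> - 4" using z(2)[OF that(1)] by auto
      then show ?thesis using z6[OF that(2,1)] that(3) by linarith
    qed
  qed simp
  define p where "p = card {a \<in> A. z a = 3}"
  have val: "z a \<in> {3, - 3, 1, - 1}" if "a \<in> A" for a
  proof -
    have "z a \<noteq> 2" "z a \<noteq> 0" "z a \<noteq> - 2" using z(2)[OF that] by auto
    then show ?thesis using zb[OF that] by auto
  qed
  have p': "card {a \<in> A. z a = - 3} = p"
    unfolding p_def using val by (intro cubic_sum_card[OF A(1) s1 s3, of 3, symmetric]) (simp, blast)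
  \<comment> \<open>The norm of \<open>x\<close> as a function of \<open>p\<close>; by
    \<open>norms\<close> it has the wrong denominator unless \<open>p = 0\<close>.\<close>
  have "(\<Sum>a\<in>A. z a ^ 2) = (\<Sum>a\<in>A. 1 + 8 * ((if z a = 3 then 1 else 0) + (if z a = - 3 then 1 else 0)))"
    using val by (intro sum.cong) fastforce+
  also have "\<dots> = int (card A) + 16 * int p"
    using A p' by (simp add: sum_distrib_left[symmetric] sum.distrib sum.If_cases Int_def p_def)
  finally have "K * (x \<bullet> x) = card A + 16 * real p"
    using m2[of x] z(1) by (simp flip: of_int_sum of_int_power)
  then have "x \<bullet> x = (card A + 16 * real p) / K" using K by (simp add: field_simps)
  then have ints: "real q * ((real (card A) + 16 * real p) / K) \<in> \<int>" using qX[OF x(1)] by simp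
  have "p = 0"
  proof (rule ccontr)
    assume "p \<noteq> 0"
    have "0 \<le> n0 + (real p - 1) * (n0 - 2 * q) + real p * (n0 - 3 * q)"
    proof (rule far_cliques_bound)
      show "card {a \<in> A. z a = 3} = p" "card {a \<in> A. z a = - 3} = p" by (simp_all add: p_def p'[unfolded p_def])
      show "a \<bullet> b = n0 - 3 * q" if "a \<in> {a \<in> A. z a = 3}" "b \<in> {a \<in> A. z a = - 3}" for a b
      proof -
        have ab: "a \<in> A" "b \<in> A" "z a = 3" "z b = - 3" "a \<noteq> b" using that by auto
        have "6 \<le> 2 * (n0 - a \<bullet> b) / q" using range[OF ab(1,2)] ab(3,4) by simp
        then have "a \<bullet> b \<le> n0 - 3 * q" using q by (simp add: field_simps)
        then show ?thesis using gram[OF ab(1,2,5)] q by auto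
      qed
      show "a \<bullet> b \<le> n0 - 2 * q" if "a \<in> {a \<in> A. z a = 3}" "b \<in> {a \<in> A. z a = 3}" "a \<noteq> b" for a b
        using gram[of a b] that by auto
      show "a \<bullet> b \<le> n0 - 2 * q" if "a \<in> {a \<in> A. z a = - 3}" "b \<in> {a \<in> A. z a = - 3}" "a \<noteq> b" for a b
        using gram[of a b] that by auto
    qed (use A(1) diag \<open>p \<noteq> 0\<close> in auto)
    then show False using norms[of p] ints \<open>p \<noteq> 0\<close> by simp
  qed
  then have "\<forall>a\<in>A. z a \<noteq> 3" "\<forall>a\<in>A. z a \<noteq> - 3"
    using p' card_eq_0_filter[OF A(1), of "\<lambda>a. z a = 3"] card_eq_0_filter[OF A(1), of "\<lambda>a. z a = - 3"]
    by (simp_all only: p_def)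
  then have "z a \<in> {1, - 1}" if "a \<in> A" for a using val[OF that] that by auto
  then have "x \<bullet> a \<in> {-1, 1}" if "a \<in> A" for a unfolding z(1)[OF that] using that by fastforce
  then show ?thesis by blast
qed

section \<open>Sharp codes and their inner products\<close>

lemma sum_single_nonzero:
  fixes f :: "'a \<Rightarrow> real"
  assumes "finite C" "y0 \<in> C" "\<And>y. y \<in> C \<Longrightarrow> y \<noteq> y0 \<Longrightarrow> f y = 0"
  shows "(\<Sum>y\<in>C. f y) = f y0"
proof -
  have "(\<Sum>y\<in>C. f y) = (\<Sum>y\<in>{y0}. f y)"
    using assms by (intro sum.mono_neutral_right) auto
  then show ?thesis by simp
qed

locale sharp_config =
  fixes C :: "(real^'n) set" and n N \<tau> :: nat
  assumes dim: "CARD('n) = n" and n2: "n \<ge> 2" and sharp: "sharp_code N \<tau> C"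
begin

lemma design: "spherical_design \<tau> C" and cardC: "card C = N"
  using sharp by (auto simp: sharp_code_def)

lemma finC: "finite C" and neC: "C \<noteq> {}" and normC: "y \<in> C \<Longrightarrow> y \<bullet> y = 1"
  using design by (auto simp: spherical_design_def norm_eq_1)

lemma power_sum: "m \<le> \<tau> \<Longrightarrow> (\<Sum>y\<in>C. (x \<bullet> y) ^ m) = real N * (norm x ^ m * zonal_moment TYPE('n) m)"
  using design_power_sum[OF design] cardC by blast

lemma zonal_moments_n:
  "zonal_moment TYPE('n) 2 = 1 / real n" "zonal_moment TYPE('n) 4 = 3 / (real n * (real n + 2))"
  "zonal_moment TYPE('n) 6 = 15 / (real n * (real n + 2) * (real n + 4))"
  by (simp_all only: zonal_moment_2 zonal_moment_4 zonal_moment_6 dim of_nat_mult of_nat_add of_nat_numeral)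

lemma power_sum_1: "1 \<le> \<tau> \<Longrightarrow> (\<Sum>y\<in>C. x \<bullet> y) = 0"
  using power_sum[of 1 x] by (simp add: zonal_moment_odd)

lemma power_sum_2: "2 \<le> \<tau> \<Longrightarrow> (\<Sum>y\<in>C. (x \<bullet> y)\<^sup>2) = N / n * (x \<bullet> x)"
  using power_sum[of 2 x] dim by (simp add: zonal_moment_2 power2_norm_eq_inner)

lemma power_sum_3: "3 \<le> \<tau> \<Longrightarrow> (\<Sum>y\<in>C. (x \<bullet> y) ^ 3) = 0"
  using power_sum[of 3 x] by (simp add: zonal_moment_odd)

lemma power_sum_4: "4 \<le> \<tau> \<Longrightarrow> (\<Sum>y\<in>C. (x \<bullet> y) ^ 4) = 3 * N / (real n * (real n + 2)) * (x \<bullet> x)\<^sup>2"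
proof -
  have "norm x ^ 4 = (x \<bullet> x)\<^sup>2" by (simp add: power2_norm_eq_inner[symmetric] flip: power_mult)
  then show "4 \<le> \<tau> \<Longrightarrow> ?thesis" using power_sum[of 4 x] by (simp only: zonal_moments_n) simp
qed

lemma scaled_power_sum: "(\<Sum>a\<in>(*\<^sub>R) c ` C. (x \<bullet> a) ^ m) = c ^ m * (\<Sum>y\<in>C. (x \<bullet> y) ^ m)" if "c \<noteq> 0"
proof -
  have "(\<Sum>a\<in>(*\<^sub>R) c ` C. (x \<bullet> a) ^ m) = (\<Sum>y\<in>C. (x \<bullet> (c *\<^sub>R y)) ^ m)"
    using that by (intro sum.reindex_cong[of "(*\<^sub>R) c"]) (auto simp: inj_on_def)
  then show ?thesis by (simp add: power_mult_distrib sum_distrib_left)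
qed

definition inner_products where "inner_products = {x \<bullet> y | x y. x \<in> C \<and> y \<in> C \<and> x \<noteq> y}"

lemma card_inner_products: "card inner_products = (\<tau> + 1) div 2"
  using sharp by (simp add: sharp_code_def inner_products_def)

lemma finite_inner_products: "finite inner_products"
proof -
  have "inner_products \<subseteq> (\<lambda>(x, y). x \<bullet> y) ` (C \<times> C)" by (auto simp: inner_products_def)
  then show ?thesis using finC finite_subset by blast
qed

lemma mem_inner_products: "x \<in> C \<Longrightarrow> y \<in> C \<Longrightarrow> x \<noteq> y \<Longrightarrow> x \<bullet> y \<in> inner_products"
  by (auto simp: inner_products_def)

text \<open>Only \<open>y0\<close> itself has a product with \<open>y0\<close> outside the zeros of
  \<open>f\<close>, namely 1.\<close>

lemma annihilator_sum:
  assumes "y0 \<in> C" "\<And>t. t \<in> inner_products \<Longrightarrow> f t = 0"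
  shows "(\<Sum>y\<in>C. f (y0 \<bullet> y)) = (f 1 :: real)"
proof -
  have "(\<Sum>y\<in>C. f (y0 \<bullet> y)) = f (y0 \<bullet> y0)"
    using assms by (intro sum_single_nonzero[OF finC assms(1)]) (auto simp: mem_inner_products)
  then show ?thesis using normC[OF assms(1)] by simp
qed

lemma moment_eqs:
  assumes "y0 \<in> C"
  shows "(\<Sum>y\<in>C. (y0 \<bullet> y) ^ 0) = real N" "1 \<le> \<tau> \<Longrightarrow> (\<Sum>y\<in>C. (y0 \<bullet> y) ^ 1) = 0"
    "2 \<le> \<tau> \<Longrightarrow> (\<Sum>y\<in>C. (y0 \<bullet> y) ^ 2) = N / n" "3 \<le> \<tau> \<Longrightarrow> (\<Sum>y\<in>C. (y0 \<bullet> y) ^ 3) = 0"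
    "4 \<le> \<tau> \<Longrightarrow> (\<Sum>y\<in>C. (y0 \<bullet> y) ^ 4) = 3 * N / (real n * (real n + 2))"
    "5 \<le> \<tau> \<Longrightarrow> (\<Sum>y\<in>C. (y0 \<bullet> y) ^ 5) = 0"
    "6 \<le> \<tau> \<Longrightarrow> (\<Sum>y\<in>C. (y0 \<bullet> y) ^ 6) = 15 * N / (real n * (real n + 2) * (real n + 4))"
    "7 \<le> \<tau> \<Longrightarrow> (\<Sum>y\<in>C. (y0 \<bullet> y) ^ 7) = 0"
    "2 \<le> \<tau> \<Longrightarrow> (\<Sum>y\<in>C. (y0 \<bullet> y) * (y0 \<bullet> y)) = N / n"
    "3 \<le> \<tau> \<Longrightarrow> (\<Sum>y\<in>C. (y0 \<bullet> y) * ((y0 \<bullet> y) * (y0 \<bullet> y))) = 0"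
proof -
  have y0: "norm y0 = 1" using normC[OF assms] by (simp add: norm_eq_1)
  show "(\<Sum>y\<in>C. (y0 \<bullet> y) ^ 0) = real N" using cardC by simp
  show "1 \<le> \<tau> \<Longrightarrow> (\<Sum>y\<in>C. (y0 \<bullet> y) ^ 1) = 0" and c: "3 \<le> \<tau> \<Longrightarrow> (\<Sum>y\<in>C. (y0 \<bullet> y) ^ 3) = 0"
    and "5 \<le> \<tau> \<Longrightarrow> (\<Sum>y\<in>C. (y0 \<bullet> y) ^ 5) = 0" "7 \<le> \<tau> \<Longrightarrow> (\<Sum>y\<in>C. (y0 \<bullet> y) ^ 7) = 0"
    by (simp_all only: power_sum) (simp_all add: zonal_moment_odd)
  show "2 \<le> \<tau> \<Longrightarrow> (\<Sum>y\<in>C. (y0 \<bullet> y) ^ 2) = N / n"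
    "4 \<le> \<tau> \<Longrightarrow> (\<Sum>y\<in>C. (y0 \<bullet> y) ^ 4) = 3 * N / (real n * (real n + 2))"
    "6 \<le> \<tau> \<Longrightarrow> (\<Sum>y\<in>C. (y0 \<bullet> y) ^ 6) = 15 * N / (real n * (real n + 2) * (real n + 4))"
    by (simp_all only: power_sum zonal_moments_n y0 power_one) simp_all
  then show "2 \<le> \<tau> \<Longrightarrow> (\<Sum>y\<in>C. (y0 \<bullet> y) * (y0 \<bullet> y)) = N / n"
    by (simp only: power2_eq_square)
  show "3 \<le> \<tau> \<Longrightarrow> (\<Sum>y\<in>C. (y0 \<bullet> y) * ((y0 \<bullet> y) * (y0 \<bullet> y))) = 0"
    using c by (simp only: power3_eq_cube mult.assoc)
qed

text \<open>The annihilating polynomial of the inner products is determined by linear equations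
  in its coefficients.\<close>
lemma two_products_eqs:
  assumes "\<tau> = 3"
  obtains e1 e2 :: real where "\<forall>t\<in>inner_products. t\<^sup>2 - e1 * t + e2 = 0"
    "N / n + N * e2 = 1 - e1 + e2" "- e1 * (N / n) = 1 - e1 + e2"
proof -
  obtain a b where ab: "inner_products = {a, b}"
    using card_inner_products assms by (auto simp: card_2_iff)
  obtain y0 where y0: "y0 \<in> C" using neC by blast
  note M = moment_eqs[OF y0, unfolded assms, simplified]
  define e1 e2 where "e1 = a + b" and "e2 = a * b"
  have z: "t\<^sup>2 - e1 * t + e2 = 0" if "t \<in> inner_products" for t
    using that ab by (auto simp: e1_def e2_def power2_eq_square algebra_simps)
  have sum: "(\<Sum>y\<in>C. (y0 \<bullet> y) ^ (j + 2) - e1 * (y0 \<bullet> y) ^ (j + 1) + e2 * (y0 \<bullet> y) ^ j) = 1 - e1 + e2" for j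
  proof -
    have "t ^ (j + 2) - e1 * t ^ (j + 1) + e2 * t ^ j = t ^ j * (t\<^sup>2 - e1 * t + e2)" for t
      by (simp only: power_add power_one_right) (simp add: algebra_simps)
    then show ?thesis
      using annihilator_sum[OF y0, of "\<lambda>t. t ^ (j + 2) - e1 * t ^ (j + 1) + e2 * t ^ j"] z by simp
  qed
  show thesis
  proof (rule that[OF ballI[OF z]])
    show "N / n + N * e2 = 1 - e1 + e2"
      using sum[of 0] by (simp add: sum.distrib sum_subtractf sum_distrib_left[symmetric] M cardC mult.commute)
    show "- e1 * (N / n) = 1 - e1 + e2"
      using sum[of 1] by (simp add: sum.distrib sum_subtractf sum_distrib_left[symmetric] M)
  qed
qed

lemma three_products_eqs:
  assumes "\<tau> = 5"
  obtains e1 e2 e3 :: real where "\<forall>t\<in>inner_products. t ^ 3 - e1 * t\<^sup>2 + e2 * t - e3 = 0"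
    "- e1 * (N / n) - e3 * N = 1 - e1 + e2 - e3"
    "3 * N / (real n * (real n + 2)) + e2 * (N / n) = 1 - e1 + e2 - e3"
    "- e1 * (3 * N / (real n * (real n + 2))) - e3 * (N / n) = 1 - e1 + e2 - e3"
proof -
  have "card inner_products = 3" using card_inner_products assms by simp
  then obtain a b c where abc: "inner_products = {a, b, c}" by (auto simp: card_3_iff)
  obtain y0 where y0: "y0 \<in> C" using neC by blast
  note M = moment_eqs[OF y0, unfolded assms, simplified]
  define e1 e2 e3 where "e1 = a + b + c" and "e2 = a * b + a * c + b * c" and "e3 = a * b * c"
  have z: "t ^ 3 - e1 * t\<^sup>2 + e2 * t - e3 = 0" if "t \<in> inner_products" for t
    using that abc by (auto simp: e1_def e2_def e3_def power2_eq_square power3_eq_cube algebra_simps)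
  have sum: "(\<Sum>y\<in>C. (y0 \<bullet> y) ^ (j + 3) - e1 * (y0 \<bullet> y) ^ (j + 2) + e2 * (y0 \<bullet> y) ^ (j + 1) - e3 * (y0 \<bullet> y) ^ j)
      = 1 - e1 + e2 - e3" for j
  proof -
    have "t ^ (j + 3) - e1 * t ^ (j + 2) + e2 * t ^ (j + 1) - e3 * t ^ j = t ^ j * (t ^ 3 - e1 * t\<^sup>2 + e2 * t - e3)" for t
      by (simp only: power_add power_one_right) (simp add: algebra_simps)
    then show ?thesis
      using annihilator_sum[OF y0, of "\<lambda>t. t ^ (j + 3) - e1 * t ^ (j + 2) + e2 * t ^ (j + 1) - e3 * t ^ j"] z by simp
  qed
  show thesis
  proof (rule that[OF ballI[OF z]])
    show "- e1 * (N / n) - e3 * N = 1 - e1 + e2 - e3"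
      using sum[of 0] by (simp add: sum.distrib sum_subtractf sum_distrib_left[symmetric] M cardC mult.commute)
    show "3 * N / (real n * (real n + 2)) + e2 * (N / n) = 1 - e1 + e2 - e3"
      using sum[of 1] by (simp add: sum.distrib sum_subtractf sum_distrib_left[symmetric] M)
    show "- e1 * (3 * N / (real n * (real n + 2))) - e3 * (N / n) = 1 - e1 + e2 - e3"
      using sum[of 2] by (simp add: sum.distrib sum_subtractf sum_distrib_left[symmetric] M)
  qed
qed

lemma four_products_eqs:
  assumes "\<tau> = 7"
  obtains e1 e2 e3 e4 :: real where "\<forall>t\<in>inner_products. t ^ 4 - e1 * t ^ 3 + e2 * t\<^sup>2 - e3 * t + e4 = 0"
    "3 * N / (real n * (real n + 2)) + e2 * (N / n) + e4 * N = 1 - e1 + e2 - e3 + e4"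
    "- e1 * (3 * N / (real n * (real n + 2))) - e3 * (N / n) = 1 - e1 + e2 - e3 + e4"
    "15 * N / (real n * (real n + 2) * (real n + 4)) + e2 * (3 * N / (real n * (real n + 2))) + e4 * (N / n) = 1 - e1 + e2 - e3 + e4"
    "- e1 * (15 * N / (real n * (real n + 2) * (real n + 4))) - e3 * (3 * N / (real n * (real n + 2))) = 1 - e1 + e2 - e3 + e4"
proof -
  have c4: "card inner_products = 4" using card_inner_products assms by simp
  then obtain a where "a \<in> inner_products" by fastforce
  then have "card (inner_products - {a}) = 3" using c4 by simp
  then obtain b c d where "inner_products - {a} = {b, c, d}" by (auto simp: card_3_iff)
  then have abcd: "inner_products = {a, b, c, d}" using \<open>a \<in> inner_products\<close> by blast
  obtain y0 where y0: "y0 \<in> C" using neC by blast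
  note M = moment_eqs[OF y0, unfolded assms, simplified]
  define e1 e2 e3 e4 where "e1 = a + b + c + d" and "e2 = a * b + a * c + a * d + b * c + b * d + c * d"
    and "e3 = a * b * c + a * b * d + a * c * d + b * c * d" and "e4 = a * b * c * d"
  have z: "t ^ 4 - e1 * t ^ 3 + e2 * t\<^sup>2 - e3 * t + e4 = 0" if "t \<in> inner_products" for t
  proof -
    have "t ^ 4 - e1 * t ^ 3 + e2 * t\<^sup>2 - e3 * t + e4 = (t - a) * (t - b) * (t - c) * (t - d)"
      by (simp add: e1_def e2_def e3_def e4_def eval_nat_numeral algebra_simps)
    then show ?thesis using that abcd by auto
  qed
  have sum: "(\<Sum>y\<in>C. (y0 \<bullet> y) ^ (j + 4) - e1 * (y0 \<bullet> y) ^ (j + 3) + e2 * (y0 \<bullet> y) ^ (j + 2) - e3 * (y0 \<bullet> y) ^ (j + 1) + e4 * (y0 \<bullet> y) ^ j)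
      = 1 - e1 + e2 - e3 + e4" for j
  proof -
    have "t ^ (j + 4) - e1 * t ^ (j + 3) + e2 * t ^ (j + 2) - e3 * t ^ (j + 1) + e4 * t ^ j
        = t ^ j * (t ^ 4 - e1 * t ^ 3 + e2 * t\<^sup>2 - e3 * t + e4)" for t
      by (simp only: power_add power_one_right) (simp add: algebra_simps)
    then show ?thesis
      using annihilator_sum[OF y0, of "\<lambda>t. t ^ (j + 4) - e1 * t ^ (j + 3) + e2 * t ^ (j + 2) - e3 * t ^ (j + 1) + e4 * t ^ j"] z by simp
  qed
  show thesis
  proof (rule that[OF ballI[OF z]])
    show "3 * N / (real n * (real n + 2)) + e2 * (N / n) + e4 * N = 1 - e1 + e2 - e3 + e4"
      using sum[of 0] by (simp add: sum.distrib sum_subtractf sum_distrib_left[symmetric] M cardC mult.commute)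
    show "- e1 * (3 * N / (real n * (real n + 2))) - e3 * (N / n) = 1 - e1 + e2 - e3 + e4"
      using sum[of 1] by (simp add: sum.distrib sum_subtractf sum_distrib_left[symmetric] M)
    show "15 * N / (real n * (real n + 2) * (real n + 4)) + e2 * (3 * N / (real n * (real n + 2))) + e4 * (N / n) = 1 - e1 + e2 - e3 + e4"
      using sum[of 2] by (simp add: sum.distrib sum_subtractf sum_distrib_left[symmetric] M)
    show "- e1 * (15 * N / (real n * (real n + 2) * (real n + 4))) - e3 * (3 * N / (real n * (real n + 2))) = 1 - e1 + e2 - e3 + e4"
      using sum[of 3] by (simp add: sum.distrib sum_subtractf sum_distrib_left[symmetric] M)
  qed
qed

lemma card_image_scaled:
  assumes V: "finite V" "card V \<le> k" and "c \<noteq> 0" and sub: "\<And>a. a \<in> (*\<^sub>R) c ` C \<Longrightarrow> x \<bullet> a \<in> V"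
  shows "card ((\<bullet>) x ` C) \<le> k"
proof -
  have "(\<bullet>) x ` C \<subseteq> (\<lambda>v. v / c) ` V"
  proof
    fix t assume "t \<in> (\<bullet>) x ` C"
    then obtain y where y: "y \<in> C" "t = x \<bullet> y" by blast
    have "x \<bullet> (c *\<^sub>R y) \<in> V" using y by (intro sub) auto
    then show "t \<in> (\<lambda>v. v / c) ` V" using y assms(3) by (auto intro!: image_eqI[of _ _ "c * (x \<bullet> y)"])
  qed
  then have "card ((\<bullet>) x ` C) \<le> card ((\<lambda>v. v / c) ` V)" using V by (intro card_mono) auto
  also have "\<dots> \<le> card V" using V by (intro card_image_le) auto
  finally show ?thesis using V by simp
qed

end

lemma dvd_if_div_Ints:
  assumes "real m / real k \<in> \<int>" "k > 0"
  shows "k dvd m"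
proof -
  obtain z where "real m / real k = of_int z" using assms(1) by (rule Ints_cases)
  then have "of_int (int m) = (of_int (z * int k) :: real)" using assms(2) by (simp add: field_simps)
  then have "int m = z * int k" by (simp only: of_int_eq_iff)
  then show ?thesis by (metis dvd_triv_right int_dvd_int_iff)
qed

text \<open>Scaling the points by \<open>sqrt s\<close> multiplies all products by \<open>s\<close>,
  so the rational numbers \<open>s\<close> that make a Gram matrix integral or constant modulo 1 are
  reached even when \<open>sqrt s\<close> is irrational.\<close>

lemma (in sharp_config) scaled_code:
  assumes s: "s > 0"
  defines "A \<equiv> (*\<^sub>R) (sqrt s) ` C"
  shows "finite A" "card A = N" "A \<noteq> {}" "a \<in> A \<Longrightarrow> a \<bullet> a = s"
    "a \<in> A \<Longrightarrow> b \<in> A \<Longrightarrow> a \<noteq> b \<Longrightarrow> a \<bullet> b \<in> (*) s ` inner_products"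
    "1 \<le> \<tau> \<Longrightarrow> (\<Sum>a\<in>A. x \<bullet> a) = 0" "3 \<le> \<tau> \<Longrightarrow> (\<Sum>a\<in>A. (x \<bullet> a) ^ 3) = 0"
    "2 \<le> \<tau> \<Longrightarrow> (\<Sum>a\<in>A. (x \<bullet> a)\<^sup>2) = s * (N / n) * (x \<bullet> x)"
    "4 \<le> \<tau> \<Longrightarrow> (\<Sum>a\<in>A. (x \<bullet> a) ^ 4) = (s * s) * (3 * N / (real n * (real n + 2))) * (x \<bullet> x)\<^sup>2"
proof -
  have q: "sqrt s \<noteq> 0" using s by simp
  have qq: "sqrt s * sqrt s = s" using s by simp
  have q4: "sqrt s ^ 4 = s * s"
  proof -
    have "sqrt s ^ 4 = ((sqrt s)\<^sup>2)\<^sup>2" by (simp only: power_mult[symmetric]) simp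
    then show ?thesis using s by (simp add: power2_eq_square)
  qed
  show "finite A" "A \<noteq> {}" using finC neC by (auto simp: A_def)
  have "inj_on ((*\<^sub>R) (sqrt s)) C" using q by (auto simp: inj_on_def)
  then show "card A = N" using cardC by (simp add: A_def card_image)
  show "a \<in> A \<Longrightarrow> a \<bullet> a = s" using normC qq by (auto simp: A_def)
  show "a \<in> A \<Longrightarrow> b \<in> A \<Longrightarrow> a \<noteq> b \<Longrightarrow> a \<bullet> b \<in> (*) s ` inner_products"
  proof -
    assume "a \<in> A" "b \<in> A" "a \<noteq> b"
    then obtain u v where uv: "u \<in> C" "v \<in> C" "u \<noteq> v" "a = sqrt s *\<^sub>R u" "b = sqrt s *\<^sub>R v"
      by (auto simp: A_def)
    have "a \<bullet> b = s * (u \<bullet> v)" using qq by (simp add: uv mult.assoc[symmetric])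
    then show ?thesis using mem_inner_products[OF uv(1-3)] by blast
  qed
  show "1 \<le> \<tau> \<Longrightarrow> (\<Sum>a\<in>A. x \<bullet> a) = 0"
    using scaled_power_sum[OF q, of x 1] power_sum_1[of x] by (simp add: A_def)
  show "3 \<le> \<tau> \<Longrightarrow> (\<Sum>a\<in>A. (x \<bullet> a) ^ 3) = 0"
    unfolding A_def scaled_power_sum[OF q] by (simp only: power_sum_3 mult_zero_right)
  show "2 \<le> \<tau> \<Longrightarrow> (\<Sum>a\<in>A. (x \<bullet> a)\<^sup>2) = s * (N / n) * (x \<bullet> x)"
    unfolding A_def scaled_power_sum[OF q] using s by (simp only: power_sum_2) simp
  show "4 \<le> \<tau> \<Longrightarrow> (\<Sum>a\<in>A. (x \<bullet> a) ^ 4) = (s * s) * (3 * N / (real n * (real n + 2))) * (x \<bullet> x)\<^sup>2"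
    unfolding A_def scaled_power_sum[OF q] by (simp only: power_sum_4 q4 mult.assoc)
qed

lemma (in sharp_config) card_values_scaled:
  assumes s: "s > 0" and V: "finite V" "card V \<le> k" and sub: "\<forall>a\<in>(*\<^sub>R) (sqrt s) ` C. x \<bullet> a \<in> V"
  shows "card ((\<bullet>) x ` C) \<le> k"
  using s sub by (intro card_image_scaled[OF V, of "sqrt s"]) auto

lemma (in sharp_config) nonzero_if_values_nonzero:
  assumes "0 \<notin> V" "\<forall>a\<in>(*\<^sub>R) c ` C. x \<bullet> a \<in> V"
  shows "x \<noteq> 0"
  using assms neC by auto

text \<open>The hypothesis is purely numerical: the moment equations must determine the elementary
  symmetric functions of the products. For concrete parameters they form a linear system.\<close>

lemma (in sharp_config) inner_products_subset_2:
  assumes "\<tau> = 3" and "\<And>e1 e2 :: real. N / n + N * e2 = 1 - e1 + e2 \<Longrightarrow> - e1 * (N / n) = 1 - e1 + e2 \<Longrightarrow>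
    e1 = a + b \<and> e2 = a * b"
  shows "inner_products \<subseteq> {a, b}"
proof -
  obtain e1 e2 :: real where e: "\<forall>t\<in>inner_products. t\<^sup>2 - e1 * t + e2 = 0"
      "N / n + N * e2 = 1 - e1 + e2" "- e1 * (N / n) = 1 - e1 + e2"
    by (rule two_products_eqs[OF assms(1)])
  have "(t - a) * (t - b) = t\<^sup>2 - e1 * t + e2" for t
    using assms(2)[OF e(2,3)] by (simp add: power2_eq_square algebra_simps)
  then have "(t - a) * (t - b) = 0" if "t \<in> inner_products" for t
    using bspec[OF e(1) that] by simp
  then show ?thesis by fastforce
qed

lemma (in sharp_config) inner_products_subset_3:
  assumes "\<tau> = 5" and "\<And>e1 e2 e3 :: real. - e1 * (N / n) - e3 * N = 1 - e1 + e2 - e3 \<Longrightarrow>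
    3 * N / (real n * (real n + 2)) + e2 * (N / n) = 1 - e1 + e2 - e3 \<Longrightarrow>
    - e1 * (3 * N / (real n * (real n + 2))) - e3 * (N / n) = 1 - e1 + e2 - e3 \<Longrightarrow>
    e1 = a + b + c \<and> e2 = a * b + a * c + b * c \<and> e3 = a * b * c"
  shows "inner_products \<subseteq> {a, b, c}"
proof -
  obtain e1 e2 e3 :: real where e: "\<forall>t\<in>inner_products. t ^ 3 - e1 * t\<^sup>2 + e2 * t - e3 = 0"
    "- e1 * (N / n) - e3 * N = 1 - e1 + e2 - e3"
    "3 * N / (real n * (real n + 2)) + e2 * (N / n) = 1 - e1 + e2 - e3"
    "- e1 * (3 * N / (real n * (real n + 2))) - e3 * (N / n) = 1 - e1 + e2 - e3"
    by (rule three_products_eqs[OF assms(1)])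
  have "(t - a) * (t - b) * (t - c) = t ^ 3 - e1 * t\<^sup>2 + e2 * t - e3" for t
    using assms(2)[OF e(2-4)] by (simp add: power2_eq_square power3_eq_cube algebra_simps)
  then have "(t - a) * (t - b) * (t - c) = 0" if "t \<in> inner_products" for t
    using bspec[OF e(1) that] by simp
  then show ?thesis by fastforce
qed

lemma (in sharp_config) inner_products_subset_4:
  assumes "\<tau> = 7" and "\<And>e1 e2 e3 e4 :: real. 3 * N / (real n * (real n + 2)) + e2 * (N / n) + e4 * N = 1 - e1 + e2 - e3 + e4 \<Longrightarrow>
    - e1 * (3 * N / (real n * (real n + 2))) - e3 * (N / n) = 1 - e1 + e2 - e3 + e4 \<Longrightarrow>
    15 * N / (real n * (real n + 2) * (real n + 4)) + e2 * (3 * N / (real n * (real n + 2))) + e4 * (N / n) = 1 - e1 + e2 - e3 + e4 \<Longrightarrow>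
    - e1 * (15 * N / (real n * (real n + 2) * (real n + 4))) - e3 * (3 * N / (real n * (real n + 2))) = 1 - e1 + e2 - e3 + e4 \<Longrightarrow>
    e1 = a + b + c + d \<and> e2 = a * b + a * c + a * d + b * c + b * d + c * d \<and>
    e3 = a * b * c + a * b * d + a * c * d + b * c * d \<and> e4 = a * b * c * d"
  shows "inner_products \<subseteq> {a, b, c, d}"
proof -
  obtain e1 e2 e3 e4 :: real where e: "\<forall>t\<in>inner_products. t ^ 4 - e1 * t ^ 3 + e2 * t\<^sup>2 - e3 * t + e4 = 0"
    "3 * N / (real n * (real n + 2)) + e2 * (N / n) + e4 * N = 1 - e1 + e2 - e3 + e4"
    "- e1 * (3 * N / (real n * (real n + 2))) - e3 * (N / n) = 1 - e1 + e2 - e3 + e4"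
    "15 * N / (real n * (real n + 2) * (real n + 4)) + e2 * (3 * N / (real n * (real n + 2))) + e4 * (N / n) = 1 - e1 + e2 - e3 + e4"
    "- e1 * (15 * N / (real n * (real n + 2) * (real n + 4))) - e3 * (3 * N / (real n * (real n + 2))) = 1 - e1 + e2 - e3 + e4"
    by (rule four_products_eqs[OF assms(1)])
  have "(t - a) * (t - b) * (t - c) * (t - d) = t ^ 4 - e1 * t ^ 3 + e2 * t\<^sup>2 - e3 * t + e4" for t
    using assms(2)[OF e(2-5)] by (simp add: eval_nat_numeral algebra_simps)
  then have "(t - a) * (t - b) * (t - c) * (t - d) = 0" if "t \<in> inner_products" for t
    using bspec[OF e(1) that] by simp
  then show ?thesis by fastforce
qed

section \<open>Points with few inner products, code by code\<close>

lemma (in sharp_config) point_21_112: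
  assumes "n = 21" "N = 112" "\<tau> = 3"
  shows "\<exists>x. x \<noteq> 0 \<and> card ((\<bullet>) x ` C) \<le> 2"
proof -
  \<comment> \<open>At norm \<open>9 / 4\<close> the products \<open>1 / 9\<close> and
    \<open>- 1 / 3\<close> become \<open>1 / 4\<close> and \<open>- 3 / 4\<close>, congruent to the
    norm modulo 1. The scales \<open>8 / 3\<close> and \<open>5 / 2\<close> for 891 and 552 points
    have the same effect.\<close>
  let ?A = "(*\<^sub>R) (sqrt (9 / 4)) ` C"
  have s: "(9 / 4 :: real) > 0" by simp
  note S = scaled_code[OF s]
  have ip: "inner_products \<subseteq> {1 / 9, - 1 / 3}"
    by (rule inner_products_subset_2[OF assms(3)]) (simp add: assms, linarith?)
  have "\<exists>x. \<forall>a\<in>?A. x \<bullet> a \<in> {- 1 / 2, 1 / 2}"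
  proof (rule point_for_21_112)
    fix a b assume "a \<in> ?A" "b \<in> ?A" "a \<noteq> b"
    then have "a \<bullet> b \<in> (*) (9 / 4) ` inner_products" by (rule S)
    then show "a \<bullet> b \<in> {1 / 4, - 3 / 4}" using ip by auto
  qed (use S assms dim in simp_all)
  then obtain x where x: "\<forall>a\<in>?A. x \<bullet> a \<in> {- 1 / 2, 1 / 2}" by blast
  have "x \<noteq> 0" using x by (rule nonzero_if_values_nonzero[rotated]) simp
  moreover have "card ((\<bullet>) x ` C) \<le> 2" using x by (rule card_values_scaled[OF s, rotated 2]) simp_all
  ultimately show ?thesis by blast
qed

lemma (in sharp_config) point_22_891:
  assumes "n = 22" "N = 891" "\<tau> = 5"
  shows "\<exists>x. x \<noteq> 0 \<and> card ((\<bullet>) x ` C) \<le> 3"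
proof -
  let ?A = "(*\<^sub>R) (sqrt (8 / 3)) ` C"
  have s: "(8 / 3 :: real) > 0" by simp
  note S = scaled_code[OF s]
  have ip: "inner_products \<subseteq> {- 1 / 2, - 1 / 8, 1 / 4}"
    by (rule inner_products_subset_3[OF assms(3)]) (simp add: assms, linarith?)
  have "\<exists>x. x \<noteq> 0 \<and> (\<forall>a\<in>?A. x \<bullet> a \<in> {-1, 0, 1})"
  proof (rule point_for_22_891)
    fix a b assume "a \<in> ?A" "b \<in> ?A" "a \<noteq> b"
    then have "a \<bullet> b \<in> (*) (8 / 3) ` inner_products" by (rule S)
    then show "a \<bullet> b \<in> {2 / 3, - 1 / 3, - 4 / 3}" using ip by auto
  qed (use S assms dim in simp_all)
  then obtain x where x: "x \<noteq> 0" "\<forall>a\<in>?A. x \<bullet> a \<in> {-1, 0, 1}" by blast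
  have "card ((\<bullet>) x ` C) \<le> 3" using x(2) by (rule card_values_scaled[OF s, rotated 2]) simp_all
  then show ?thesis using x(1) by blast
qed

lemma (in sharp_config) point_23_552:
  assumes "n = 23" "N = 552" "\<tau> = 5"
  shows "\<exists>x. x \<noteq> 0 \<and> card ((\<bullet>) x ` C) \<le> 3"
proof -
  let ?A = "(*\<^sub>R) (sqrt (5 / 2)) ` C"
  have s: "(5 / 2 :: real) > 0" by simp
  note S = scaled_code[OF s]
  have ip: "inner_products \<subseteq> {- 1, 1 / 5, - 1 / 5}"
    by (rule inner_products_subset_3[OF assms(3)]) (simp add: assms, linarith?)
  have "\<exists>x. x \<noteq> 0 \<and> (\<forall>a\<in>?A. x \<bullet> a \<in> {-1, 0, 1})"
  proof (rule point_for_23_552)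
    fix a b assume "a \<in> ?A" "b \<in> ?A" "a \<noteq> b"
    then have "a \<bullet> b \<in> (*) (5 / 2) ` inner_products" by (rule S)
    then show "a \<bullet> b \<in> {1 / 2, - 1 / 2, - 5 / 2}" using ip by auto
  qed (use S assms dim in simp_all)
  then obtain x where x: "x \<noteq> 0" "\<forall>a\<in>?A. x \<bullet> a \<in> {-1, 0, 1}" by blast
  have "card ((\<bullet>) x ` C) \<le> 3" using x(2) by (rule card_values_scaled[OF s, rotated 2]) simp_all
  then show ?thesis using x(1) by blast
qed

lemma (in sharp_config) point_21_162:
  assumes "n = 21" "N = 162" "\<tau> = 3"
  shows "\<exists>x. x \<noteq> 0 \<and> card ((\<bullet>) x ` C) \<le> 2"
proof -
  let ?A = "(*\<^sub>R) (sqrt 7) ` C"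
  have s: "(7 :: real) > 0" by simp
  note S = scaled_code[OF s]
  have ip: "inner_products \<subseteq> {1 / 7, - 2 / 7}"
    by (rule inner_products_subset_2[OF assms(3)]) (simp add: assms, linarith?)
  have "\<exists>x. \<forall>a\<in>?A. x \<bullet> a \<in> {-1, 1}"
  proof (rule point_for_odd_two_distance_code[where q = 3 and ?n0.0 = 7 and K = 54])
    fix a b assume "a \<in> ?A" "b \<in> ?A" "a \<noteq> b"
    then have "a \<bullet> b \<in> (*) 7 ` inner_products" by (rule S)
    then show "a \<bullet> b \<in> {7 - real (2 * 3), 7 - real (3 * 3)}" using ip by auto
  next
    show "odd_real 7" unfolding odd_real_def by (rule exI[of _ 7]) simp
  next
    \<comment> \<open>Positivity allows \<open>p\<close> up to 6, but 54 divides
      \<open>3 * (162 + 16 * p)\<close> only if 9 divides \<open>p\<close>.\<close>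
    fix p :: nat assume p: "p > 0" "0 \<le> 7 + (real p - 1) * (7 - real (2 * 3)) + real p * (7 - real (3 * 3))"
    then have "real p < 7" by (simp add: algebra_simps)
    then have "p < 7" by simp
    then have "p = 1 \<or> p = 2 \<or> p = 3 \<or> p = 4 \<or> p = 5 \<or> p = 6" using p(1) by arith
    then have h: "\<not> 54 dvd 3 * (162 + 16 * p)" by (elim disjE) simp_all
    have eq: "real 3 * ((real (card ?A) + 16 * real p) / 54) = real (3 * (162 + 16 * p)) / real 54"
      using S(2) assms by simp
    show "real 3 * ((real (card ?A) + 16 * real p) / 54) \<notin> \<int>"
      unfolding eq using h dvd_if_div_Ints[of "3 * (162 + 16 * p)" 54, OF _ zero_less_numeral] by blast
  qed (use S assms dim in simp_all)
  then obtain x where x: "\<forall>a\<in>?A. x \<bullet> a \<in> {-1, 1}" by blast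
  have "x \<noteq> 0" using x by (rule nonzero_if_values_nonzero[rotated]) simp
  moreover have "card ((\<bullet>) x ` C) \<le> 2" using x by (rule card_values_scaled[OF s, rotated 2]) simp_all
  ultimately show ?thesis by blast
qed

lemma (in sharp_config) point_22_100:
  assumes "n = 22" "N = 100" "\<tau> = 3"
  shows "\<exists>x. x \<noteq> 0 \<and> card ((\<bullet>) x ` C) \<le> 2"
proof -
  let ?A = "(*\<^sub>R) (sqrt 11) ` C"
  have s: "(11 :: real) > 0" by simp
  note S = scaled_code[OF s]
  have ip: "inner_products \<subseteq> {1 / 11, - 4 / 11}"
    by (rule inner_products_subset_2[OF assms(3)]) (simp add: assms, linarith?)
  have "\<exists>x. \<forall>a\<in>?A. x \<bullet> a \<in> {-1, 1}"
  proof (rule point_for_odd_two_distance_code[where q = 5 and ?n0.0 = 11 and K = 50])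
    fix a b assume "a \<in> ?A" "b \<in> ?A" "a \<noteq> b"
    then have "a \<bullet> b \<in> (*) 11 ` inner_products" by (rule S)
    then show "a \<bullet> b \<in> {11 - real (2 * 5), 11 - real (3 * 5)}" using ip by auto
  next
    show "odd_real 11" unfolding odd_real_def by (rule exI[of _ 11]) simp
  next
    \<comment> \<open>Positivity allows \<open>p\<close> up to 3, but 50 divides
      \<open>5 * (100 + 16 * p)\<close> only if 5 divides \<open>p\<close>.\<close>
    fix p :: nat assume p: "p > 0" "0 \<le> 11 + (real p - 1) * (11 - real (2 * 5)) + real p * (11 - real (3 * 5))"
    then have "real p < 4" by (simp add: algebra_simps)
    then have "p < 4" by simp
    then have "p = 1 \<or> p = 2 \<or> p = 3" using p(1) by arith
    then have h: "\<not> 50 dvd 5 * (100 + 16 * p)" by (elim disjE) simp_all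
    have eq: "real 5 * ((real (card ?A) + 16 * real p) / 50) = real (5 * (100 + 16 * p)) / real 50"
      using S(2) assms by simp
    show "real 5 * ((real (card ?A) + 16 * real p) / 50) \<notin> \<int>"
      unfolding eq using h dvd_if_div_Ints[of "5 * (100 + 16 * p)" 50, OF _ zero_less_numeral] by blast
  qed (use S assms dim in simp_all)
  then obtain x where x: "\<forall>a\<in>?A. x \<bullet> a \<in> {-1, 1}" by blast
  have "x \<noteq> 0" using x by (rule nonzero_if_values_nonzero[rotated]) simp
  moreover have "card ((\<bullet>) x ` C) \<le> 2" using x by (rule card_values_scaled[OF s, rotated 2]) simp_all
  ultimately show ?thesis by blast
qed

lemma (in sharp_config) sum_C_eq_0: "1 \<le> \<tau> \<Longrightarrow> (\<Sum>y\<in>C. y) = 0"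
proof -
  assume t: "1 \<le> \<tau>"
  have "(\<Sum>y\<in>C. y) \<bullet> (\<Sum>y\<in>C. y) = 0"
    using power_sum_1[OF t, of "\<Sum>y\<in>C. y"] by (simp add: inner_sum_right)
  then show ?thesis by simp
qed

text \<open>The points sum to 0, so one of them lies in the span of the others. At most
  \<open>n\<close> points thus span a proper subspace, and a vector orthogonal to it has 0 as its
  only inner product.\<close>

lemma (in sharp_config) point_orthogonal:
  assumes t: "\<tau> = 1" and N: "N \<le> n"
  shows "\<exists>x. x \<noteq> 0 \<and> card ((\<bullet>) x ` C) \<le> 1"
proof -
  obtain y0 where y0: "y0 \<in> C" using neC by blast
  let ?B = "C - {y0}"
  have "y0 + (\<Sum>y\<in>?B. y) = 0" using sum_C_eq_0 t sum.remove[OF finC y0, of "\<lambda>y. y"] by simp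
  then have "y0 = - (\<Sum>y\<in>?B. y)" by (rule eq_neg_iff_add_eq_0[THEN iffD2])
  moreover have "- (\<Sum>y\<in>?B. y) \<in> span ?B" by (intro span_neg span_sum span_base)
  ultimately have "y0 \<in> span ?B" by (rule ssubst)
  then have sub: "C \<subseteq> span ?B" using span_superset[of ?B] by blast
  have "card ?B = N - 1" using finC y0 cardC by simp
  moreover have "N > 0" using cardC finC neC card_gt_0_iff by blast
  ultimately have "card ?B < DIM(real^'n)" using N dim by simp
  then have "dim ?B < DIM(real^'n)" using dim_le_card'[of ?B] finC by simp
  then have "\<exists>x. x \<noteq> 0 \<and> (\<forall>y\<in>span ?B. orthogonal x y)"
    by (rule orthogonal_to_subspace_exists) blast
  then obtain x where x: "x \<noteq> 0" "\<forall>y\<in>span ?B. orthogonal x y" by blast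
  have "(\<bullet>) x ` C \<subseteq> {0}" using x(2) sub by (auto simp: orthogonal_def)
  then have "card ((\<bullet>) x ` C) \<le> card {0 :: real}" by (intro card_mono) auto
  then show ?thesis using x(1) by auto
qed

text \<open>Seen from the antipode, \<open>y0\<close> has product -1 and the other points have the
  \<open>k\<close> negated products of the code, matching the Gauss--Radau count
  \<open>k + 1\<close>.\<close>

lemma (in sharp_config) point_even:
  assumes "\<tau> = 2 * k" "y0 \<in> C"
  shows "- y0 \<noteq> 0" "card ((\<bullet>) (- y0) ` C) \<le> k + 1" "- norm (- y0) \<in> (\<bullet>) (- y0) ` C"
proof -
  have n1: "norm y0 = 1" and i1: "y0 \<bullet> y0 = 1" using normC[OF assms(2)] by (simp_all add: norm_eq_1)
  show "- y0 \<noteq> 0" using n1 by auto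
  show "- norm (- y0) \<in> (\<bullet>) (- y0) ` C" using assms(2) n1 i1 by (auto intro!: image_eqI[of _ _ y0])
  have "(\<bullet>) (- y0) ` C \<subseteq> insert (- 1) (uminus ` inner_products)"
    using i1 mem_inner_products[OF assms(2)] by force
  then have "card ((\<bullet>) (- y0) ` C) \<le> card (insert (- 1) (uminus ` inner_products))"
    using finite_inner_products by (intro card_mono) auto
  also have "\<dots> \<le> Suc (card (uminus ` inner_products))" using finite_inner_products by (simp add: card_insert_if)
  also have "\<dots> \<le> Suc (card inner_products)" using finite_inner_products by (simp add: card_image_le)
  finally show "card ((\<bullet>) (- y0) ` C) \<le> k + 1" using card_inner_products assms(1) by simp
qed

text \<open>The products are 0 and -1, so the code is integral with norm 1, and a short
  characteristic vector has products that are odd and at most 1 in absolute value.\<close>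

lemma (in sharp_config) point_cross_polytope:
  assumes "N = 2 * n" "\<tau> = 3"
  shows "\<exists>x. x \<noteq> 0 \<and> card ((\<bullet>) x ` C) \<le> 2"
proof -
  have ip: "inner_products \<subseteq> {0, - 1}"
  proof (rule inner_products_subset_2[OF assms(2)])
    fix e1 e2 :: real
    assume e: "N / n + N * e2 = 1 - e1 + e2" "- e1 * (N / n) = 1 - e1 + e2"
    have nn: "real N / real n = 2" "real N = 2 * real n" using assms(1) n2 by auto
    have "e1 = - 1 - e2" using e(2) unfolding nn(1) by simp
    then have "2 + 2 * real n * e2 = 1 - (- 1 - e2) + e2" using e(1) unfolding nn(1) unfolding nn(2) by simp
    then have "e2 * (2 * real n - 2) = 0" by algebra
    then have "e2 = 0" using n2 by simp
    then show "e1 = 0 + - 1 \<and> e2 = 0 * - 1" using \<open>e1 = - 1 - e2\<close> by simp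
  qed
  have g: "a \<bullet> b \<in> {1, 0, - 1}" if "a \<in> C" "b \<in> C" for a b
    using normC[OF that(1)] mem_inner_products[OF that] ip by (cases "a = b") auto
  have int: "a \<bullet> b \<in> \<int>" if "a \<in> C" "b \<in> C" for a b using g[OF that] by auto
  have odd: "odd_real (a \<bullet> a)" if "a \<in> C" for a
    unfolding odd_real_def using normC[OF that] by (intro exI[of _ 1]) simp
  obtain x where x: "\<And>a. a \<in> C \<Longrightarrow> odd_real (x \<bullet> a) \<and> \<bar>x \<bullet> a\<bar> \<le> a \<bullet> a"
    using short_characteristic_vector[OF finC int odd] by blast
  have v: "x \<bullet> a \<in> {1, - 1}" if a: "a \<in> C" for a
  proof -
    obtain z :: int where z: "odd z" "x \<bullet> a = of_int z" using x[OF a] by (auto simp: odd_real_def)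
    have "\<bar>x \<bullet> a\<bar> \<le> 1" using x[OF a] normC[OF a] by simp
    then have "\<bar>z\<bar> \<le> 1" using z(2) by linarith
    then have "z = 1 \<or> z = - 1" using z(1) by presburger
    then show ?thesis using z(2) by auto
  qed
  have "(\<bullet>) x ` C \<subseteq> {1, - 1}" using v by blast
  then have "card ((\<bullet>) x ` C) \<le> card {1, - 1 :: real}" by (intro card_mono) auto
  moreover have "x \<noteq> 0" using v neC by auto
  ultimately show ?thesis by auto
qed

text \<open>At norm 3 all products are integers, and a short characteristic vector has odd products
  of absolute value at most 3: just the four values allowed.\<close>

lemma (in sharp_config) point_23_4600:
  assumes "n = 23" "N = 4600" "\<tau> = 7"
  shows "\<exists>x. x \<noteq> 0 \<and> card ((\<bullet>) x ` C) \<le> 4"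
proof -
  let ?A = "(*\<^sub>R) (sqrt 3) ` C"
  have s: "(3 :: real) > 0" by simp
  note S = scaled_code[OF s]
  have ip: "inner_products \<subseteq> {- 1, 0, 1 / 3, - 1 / 3}"
    by (rule inner_products_subset_4[OF assms(3)]) (simp add: assms, linarith?)
  have g: "a \<bullet> b \<in> {3, - 3, 0, 1, - 1}" if "a \<in> ?A" "b \<in> ?A" for a b
  proof (cases "a = b")
    case True
    then show ?thesis using S(4)[OF that(1)] by simp
  next
    case False
    then have "a \<bullet> b \<in> (*) 3 ` inner_products" using that by (intro S)
    then show ?thesis using ip by auto
  qed
  have int: "a \<bullet> b \<in> \<int>" if "a \<in> ?A" "b \<in> ?A" for a b using g[OF that] by auto
  have odd: "odd_real (a \<bullet> a)" if "a \<in> ?A" for a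
    unfolding odd_real_def using S(4)[OF that] by (intro exI[of _ 3]) simp
  obtain x where x: "\<And>a. a \<in> ?A \<Longrightarrow> odd_real (x \<bullet> a) \<and> \<bar>x \<bullet> a\<bar> \<le> a \<bullet> a"
    using short_characteristic_vector[OF S(1) int odd] by blast
  have v: "\<forall>a\<in>?A. x \<bullet> a \<in> {1, - 1, 3, - 3}"
  proof
    fix a assume a: "a \<in> ?A"
    obtain z :: int where z: "odd z" "x \<bullet> a = of_int z" using x[OF a] by (auto simp: odd_real_def)
    have "\<bar>x \<bullet> a\<bar> \<le> 3" using x[OF a] S(4)[OF a] by simp
    then have "\<bar>z\<bar> \<le> 3" using z(2) by linarith
    then have "z = 1 \<or> z = - 1 \<or> z = 3 \<or> z = - 3" using z(1) by presburger
    then show "x \<bullet> a \<in> {1, - 1, 3, - 3}" using z(2) by auto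
  qed
  have "x \<noteq> 0" using v by (rule nonzero_if_values_nonzero[rotated]) simp
  moreover have "card ((\<bullet>) x ` C) \<le> 4" using v by (rule card_values_scaled[OF s, rotated 2]) simp_all
  ultimately show ?thesis by blast
qed

lemma (in sharp_config) exists_negative_inner_product:
  assumes "1 \<le> \<tau>" "y0 \<in> C"
  obtains y where "y \<in> C" "y0 \<bullet> y < 0"
proof -
  have "\<exists>y\<in>C. y0 \<bullet> y < 0"
  proof (rule ccontr)
    assume "\<not> ?thesis"
    then have "0 \<le> y0 \<bullet> y" if "y \<in> C" for y using that by (simp add: not_less)
    then have "y0 \<bullet> y0 \<le> (\<Sum>y\<in>C. y0 \<bullet> y)" using finC assms(2) by (intro member_le_sum) blast+
    then show False using power_sum_1[OF assms(1), of y0] normC[OF assms(2)] by simp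
  qed
  then show thesis using that by blast
qed

text \<open>Choose two points with product \<open>- 3 / 5\<close>. No third point can have this
  product with both, since the sum of the three would have negative norm; hence the sum of the two
  sees only two values.\<close>

lemma (in sharp_config) point_5_16:
  assumes "n = 5" "N = 16" "\<tau> = 3"
  shows "\<exists>x. x \<noteq> 0 \<and> card ((\<bullet>) x ` C) \<le> 2"
proof -
  have ip: "inner_products \<subseteq> {1 / 5, - 3 / 5}"
    by (rule inner_products_subset_2[OF assms(3)]) (simp add: assms, linarith?)
  obtain y0 where y0: "y0 \<in> C" using neC by blast
  obtain y1 where y1: "y1 \<in> C" "y0 \<bullet> y1 < 0"
    by (rule exists_negative_inner_product[OF _ y0]) (use assms in simp)
  have sq0: "y0 \<bullet> y0 = 1" using normC y0 by auto
  then have "y1 \<noteq> y0" using y1(2) by auto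
  have y01: "y0 \<bullet> y1 = - 3 / 5" using mem_inner_products[OF y0 y1(1)] y1 \<open>y1 \<noteq> y0\<close> ip by auto
  have sq: "y0 \<bullet> y0 = 1" "y1 \<bullet> y1 = 1" using normC y0 y1 by auto
  have v: "(y0 + y1) \<bullet> y \<in> {2 / 5, - 2 / 5}" if y: "y \<in> C" for y
  proof (cases "y = y0 \<or> y = y1")
    case True
    have "(y0 + y1) \<bullet> y0 = 2 / 5" "(y0 + y1) \<bullet> y1 = 2 / 5"
      using y01 sq by (simp_all add: inner_add_left inner_commute[of y1 y0])
    then show ?thesis using True by blast
  next
    case False
    have "y0 \<bullet> y \<in> {1 / 5, - 3 / 5}" "y1 \<bullet> y \<in> {1 / 5, - 3 / 5}"
      using mem_inner_products[OF y0 y] mem_inner_products[OF y1(1) y] False ip by auto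
    moreover have "0 \<le> (y0 + y1 + y) \<bullet> (y0 + y1 + y)" by simp
    then have "0 \<le> 3 + 2 * (- 3 / 5 + y0 \<bullet> y + y1 \<bullet> y)"
      using normC[OF y] sq y01 by (simp add: inner_add_left inner_add_right inner_commute[of y y0] inner_commute[of y y1] inner_commute[of y1 y0])
    ultimately show ?thesis by (auto simp: inner_add_left)
  qed
  have "(\<bullet>) (y0 + y1) ` C \<subseteq> {2 / 5, - 2 / 5}" using v by blast
  then have "card ((\<bullet>) (y0 + y1) ` C) \<le> card {2 / 5, - 2 / 5 :: real}" by (intro card_mono) auto
  moreover have "y0 + y1 \<noteq> 0" using v[OF y0] by auto
  ultimately show ?thesis by (intro exI[of _ "y0 + y1"]) auto
qed

text \<open>Choose two points with product \<open>1 / 3\<close>. Apart from them and their antipodes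
  every point has product \<open>1 / 3\<close> or \<open>- 1 / 3\<close> with each, so their
  difference sees only 0 and \<open>2 / 3\<close> up to sign.\<close>

lemma (in sharp_config) point_7_56:
  assumes "n = 7" "N = 56" "\<tau> = 5"
  shows "\<exists>x. x \<noteq> 0 \<and> card ((\<bullet>) x ` C) \<le> 3"
proof -
  have ip: "inner_products \<subseteq> {- 1, 1 / 3, - 1 / 3}"
    by (rule inner_products_subset_3[OF assms(3)]) (simp add: assms, linarith?)
  obtain y0 where y0: "y0 \<in> C" using neC by blast
  have y0sq: "y0 \<bullet> y0 = 1" using normC y0 by auto
  have opp: "y = - y0" if "y \<in> C" "y0 \<bullet> y = - 1" for y
  proof -
    have "(y + y0) \<bullet> (y + y0) = 0"
      using that y0sq normC[OF that(1)] by (simp add: inner_add_left inner_add_right inner_commute[of y y0])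
    then have "y + y0 = 0" by simp
    then show ?thesis by (simp add: eq_neg_iff_add_eq_0)
  qed
  \<comment> \<open>Otherwise \<open>y0\<close> alone has product above \<open>- 1 / 3\<close>, and
    the sum of \<open>y0 \<bullet> y + 1 / 3\<close> would be at most \<open>4 / 3\<close>, whereas
    it is \<open>56 / 3\<close>.\<close>
  have "\<exists>y\<in>C. y0 \<bullet> y = 1 / 3"
  proof (rule ccontr)
    assume no: "\<not> ?thesis"
    have cases: "y0 \<bullet> y \<in> {- 1, - 1 / 3}" if "y \<in> C" "y \<noteq> y0" for y
      using mem_inner_products[OF y0 that(1)] that no ip by auto
    have "(\<Sum>y\<in>C. (y0 \<bullet> y) + 1 / 3) \<le> (\<Sum>y\<in>C. if y = y0 then 4 / 3 else 0)"
    proof (rule sum_mono)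
      fix y assume "y \<in> C"
      then show "(y0 \<bullet> y) + 1 / 3 \<le> (if y = y0 then 4 / 3 else 0)"
        using cases[of y] y0sq by auto
    qed
    then show False using finC y0 cardC assms power_sum_1[of y0] by (simp add: sum.distrib)
  qed
  then obtain y1 where y1: "y1 \<in> C" "y0 \<bullet> y1 = 1 / 3" by blast
  have y1sq: "y1 \<bullet> y1 = 1" using normC y1 by auto
  have opp1: "y = - y1" if "y \<in> C" "y1 \<bullet> y = - 1" for y
  proof -
    have "(y + y1) \<bullet> (y + y1) = 0"
      using that y1sq normC[OF that(1)] by (simp add: inner_add_left inner_add_right inner_commute[of y y1])
    then have "y + y1 = 0" by simp
    then show ?thesis by (simp add: eq_neg_iff_add_eq_0)
  qed
  have v: "(y0 - y1) \<bullet> y \<in> {2 / 3, 0, - 2 / 3}" if y: "y \<in> C" for y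
  proof (cases "y = y0 \<or> y = y1 \<or> y = - y0 \<or> y = - y1")
    case True
    have "(y0 - y1) \<bullet> y0 = 2 / 3" "(y0 - y1) \<bullet> y1 = - 2 / 3"
      "(y0 - y1) \<bullet> (- y0) = - 2 / 3" "(y0 - y1) \<bullet> (- y1) = 2 / 3"
      using y1(2) y0sq y1sq by (simp_all add: inner_diff_left inner_commute[of y1 y0])
    then show ?thesis using True by blast
  next
    case False
    have "y0 \<bullet> y \<in> {1 / 3, - 1 / 3}" "y1 \<bullet> y \<in> {1 / 3, - 1 / 3}"
      using mem_inner_products[OF y0 y] mem_inner_products[OF y1(1) y] False ip opp[OF y] opp1[OF y] by auto
    then show ?thesis by (auto simp: inner_diff_left)
  qed
  have "(\<bullet>) (y0 - y1) ` C \<subseteq> {2 / 3, 0, - 2 / 3}" using v by blast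
  then have "card ((\<bullet>) (y0 - y1) ` C) \<le> card {2 / 3, 0, - 2 / 3 :: real}" by (intro card_mono) auto
  moreover have "y0 - y1 \<noteq> 0" using y1 y0sq by auto
  ultimately show ?thesis by (intro exI[of _ "y0 - y1"]) auto
qed

section \<open>Regular polygons with an even number of vertices\<close>

lemma card_Re_roots_minus_1:
  assumes m: "m > 0"
  shows "finite {b :: complex. b ^ (2 * m) = - 1}" "card (Re ` {b :: complex. b ^ (2 * m) = - 1}) \<le> m"
proof -
  let ?R = "{b :: complex. b ^ (2 * m) = - 1}"
  define P where "P = {b \<in> ?R. Im b > 0}"
  have cR: "card ?R = 2 * m" by (rule card_nth_roots) (use m in auto)
  then show fR: "finite ?R" using m card_gt_0_iff by force
  have fP: "finite P" using fR by (simp add: P_def)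
  have cnj_R: "cnj b \<in> ?R" if "b \<in> ?R" for b
  proof -
    have "cnj b ^ (2 * m) = cnj (- 1)" using that by (simp only: mem_Collect_eq complex_cnj_power[symmetric])
    then show ?thesis by simp
  qed
  have "card P + card (cnj ` P) = card (P \<union> cnj ` P)"
    using fP by (intro card_Un_disjoint[symmetric]) (auto simp: P_def)
  also have "\<dots> \<le> card ?R" using fR cnj_R by (intro card_mono) (auto simp: P_def)
  finally have "2 * card P \<le> 2 * m"
    using cR card_image[of cnj P] by (simp add: inj_on_def)
  \<comment> \<open>No root is real, since even powers of reals are nonnegative, and conjugate roots
    share their real part.\<close>
  have "Re ` ?R \<subseteq> Re ` P"
  proof
    fix t assume "t \<in> Re ` ?R"
    then obtain b where b: "b \<in> ?R" "t = Re b" by blast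
    consider "Im b > 0" | "Im b < 0" | "Im b = 0" by linarith
    then show "t \<in> Re ` P"
    proof cases
      case 1
      then show ?thesis using b by (auto simp: P_def)
    next
      case 2
      then have "cnj b \<in> P" using cnj_R[OF b(1)] by (simp add: P_def)
      then show ?thesis using b(2) by (intro image_eqI[of _ _ "cnj b"]) auto
    next
      case 3
      then have "b = of_real (Re b)" by (simp add: complex_eq_iff)
      then have "of_real (Re b ^ (2 * m)) = (of_real (- 1) :: complex)" using b(1) by simp
      then have "Re b ^ (2 * m) = - 1" by (simp only: of_real_eq_iff)
      moreover have "Re b ^ (2 * m) \<ge> 0" by (simp add: power_mult)
      ultimately show ?thesis by simp
    qed
  qed
  then have "card (Re ` ?R) \<le> card (Re ` P)" using fP by (intro card_mono) auto
  also have "\<dots> \<le> card P" using fP by (rule card_image_le)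
  finally show "card (Re ` ?R) \<le> m" using \<open>2 * card P \<le> 2 * m\<close> by simp
qed

lemma poly_eq_if_eq_on_reals:
  fixes p q :: "complex poly"
  assumes "\<And>w :: real. poly p (of_real w) = poly q (of_real w)"
  shows "p = q"
proof (rule ccontr)
  assume "p \<noteq> q"
  then have "finite {x. poly (p - q) x = 0}" by (intro poly_roots_finite) simp
  moreover have "range complex_of_real \<subseteq> {x. poly (p - q) x = 0}" using assms by auto
  ultimately have "finite (range complex_of_real)" using finite_subset by blast
  then have "finite (UNIV :: real set)" by (rule finite_imageD) (auto simp: inj_on_def)
  then show False by (simp add: infinite_UNIV_char_0)
qed

text \<open>The columns of the character table \<open>(a y ^ l)\<close> are orthogonal, hence so are its rows.\<close>
lemma power_eq_1_if_power_sums_vanish: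
  fixes a :: "'a \<Rightarrow> complex"
  assumes C: "finite C" "card C = N" and norm1: "\<And>y. y \<in> C \<Longrightarrow> norm (a y) = 1"
    and sums: "\<And>l. 0 < l \<Longrightarrow> l < N \<Longrightarrow> (\<Sum>y\<in>C. a y ^ l) = 0" and y0: "y0 \<in> C" "a y0 = 1" and y: "y \<in> C"
  shows "a y ^ N = 1"
proof (cases "y = y0")
  case True
  then show ?thesis using y0 by simp
next
  case False
  \<comment> \<open>The row sums of the table. By column orthogonality their squared norms sum to
    \<open>N^2\<close>, which the row of \<open>y0\<close> alone exhausts. The other row sums
    vanish, and \<open>a y ^ N - 1\<close> is \<open>a y - 1\<close> times a row sum.\<close>
  define q where "q y = (\<Sum>l<N. a y ^ l)" for y
  have aa: "a y * cnj (a y) = 1" if "y \<in> C" for y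
    using norm1[OF that] by (simp add: complex_norm_square[symmetric])
  have gt: "(\<Sum>y\<in>C. a y ^ l * cnj (a y) ^ m) = 0" if "m < l" "l < N" for l m
  proof -
    have "a y ^ l * cnj (a y) ^ m = a y ^ (l - m)" if "y \<in> C" for y
    proof -
      have "a y ^ l = a y ^ (l - m) * a y ^ m" using \<open>m < l\<close> by (simp flip: power_add)
      then show ?thesis using aa[OF that] by (simp add: mult.assoc flip: power_mult_distrib)
    qed
    then show ?thesis using sums[of "l - m"] that by simp
  qed
  have orth: "(\<Sum>y\<in>C. a y ^ l * cnj (a y) ^ m) = (if l = m then of_nat N else 0)" if lm: "l < N" "m < N" for l m
  proof -
    consider "l = m" | "m < l" | "l < m" by linarith
    then show ?thesis
    proof cases
      case 1
      then show ?thesis using aa C by (simp flip: power_mult_distrib)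
    next
      case 2
      then show ?thesis using gt lm by simp
    next
      case 3
      have "(\<Sum>y\<in>C. a y ^ l * cnj (a y) ^ m) = cnj (\<Sum>y\<in>C. a y ^ m * cnj (a y) ^ l)"
        by (simp add: mult.commute)
      then show ?thesis using gt[of l m] lm 3 by simp
    qed
  qed
  have "(\<Sum>y\<in>C. q y * cnj (q y)) = (\<Sum>y\<in>C. \<Sum>l<N. \<Sum>m<N. a y ^ l * cnj (a y) ^ m)"
    by (simp add: q_def sum_product)
  also have "\<dots> = (\<Sum>l<N. \<Sum>y\<in>C. \<Sum>m<N. a y ^ l * cnj (a y) ^ m)" by (rule sum.swap)
  also have "\<dots> = (\<Sum>l<N. \<Sum>m<N. \<Sum>y\<in>C. a y ^ l * cnj (a y) ^ m)" by (intro sum.cong refl sum.swap)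
  also have "\<dots> = (\<Sum>l<N. \<Sum>m<N. if l = m then of_nat N else 0)" by (intro sum.cong refl) (simp add: orth)
  also have "\<dots> = of_nat N * of_nat N" by simp
  finally have "(\<Sum>y\<in>C. complex_of_real ((norm (q y))\<^sup>2)) = of_nat N * of_nat N"
    by (simp only: complex_norm_square)
  then have "complex_of_real (\<Sum>y\<in>C. (norm (q y))\<^sup>2) = of_real ((real N)\<^sup>2)"
    by (simp add: power2_eq_square)
  then have tot: "(\<Sum>y\<in>C. (norm (q y))\<^sup>2) = (real N)\<^sup>2" by (simp only: of_real_eq_iff)
  have "(\<Sum>y\<in>C. (norm (q y))\<^sup>2) = (norm (q y0))\<^sup>2 + (\<Sum>y\<in>C - {y0}. (norm (q y))\<^sup>2)"
    using C(1) y0(1) by (rule sum.remove)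
  moreover have "norm (q y0) = real N" using y0(2) by (simp add: q_def)
  ultimately have "(\<Sum>y\<in>C - {y0}. (norm (q y))\<^sup>2) = 0" using tot by simp
  then have "\<forall>y\<in>C - {y0}. (norm (q y))\<^sup>2 = 0" using C(1) by (subst (asm) sum_nonneg_eq_0_iff) auto
  then have "q y = 0" using y False by simp
  then show ?thesis using power_diff_1_eq[of "a y" N] by (simp add: q_def)
qed

text \<open>In complex coordinates the moments show that the code is a regular polygon; the point is
  half a step away from a vertex, so it sees the vertices in mirror pairs.\<close>

lemma (in sharp_config) point_circle:
  assumes n: "n = 2" and N: "N = 2 * m" and t: "\<tau> = 2 * m - 1" and m: "m \<ge> 1"
  shows "\<exists>x. x \<noteq> 0 \<and> card ((\<bullet>) x ` C) \<le> m"
proof -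
  obtain i j :: 'n where ij: "UNIV = {i, j}" "i \<noteq> j" using dim n by (auto simp: card_2_iff)
  have inner: "x \<bullet> y = x $ i * y $ i + x $ j * y $ j" for x y :: "real^'n"
    unfolding inner_vec_def ij(1) using ij(2) by simp
  define z where "z y = Complex (y $ i) (y $ j)" for y :: "real^'n"
  have sums: "(\<Sum>y\<in>C. z y ^ l) = 0" if l: "0 < l" "l < N" for l
  proof -
    \<comment> \<open>The power sum in the direction with coordinates 1 and \<open>w\<close> is a
      polynomial in \<open>w\<close>. By the design property it equals \<open>q\<close> for real
      \<open>w\<close>, hence also at \<open>w = \<i>\<close>, where \<open>1 + w^2\<close>
      vanishes.\<close>
    define p where "p = (\<Sum>y\<in>C. [:complex_of_real (y $ i), complex_of_real (y $ j):] ^ l)"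
    define q :: "complex poly" where "q = (if even l then smult (of_real (real N * zonal_moment TYPE('n) l)) ([:1, 0, 1:] ^ (l div 2)) else 0)"
    have "p = q"
    proof (rule poly_eq_if_eq_on_reals)
      fix w :: real
      define x where "x = (\<chi> k. if k = i then 1 else w)"
      have x: "x $ i = 1" "x $ j = w" using ij(2) by (auto simp: x_def)
      have "poly p (of_real w) = of_real (\<Sum>y\<in>C. (x \<bullet> y) ^ l)"
        by (simp add: p_def poly_sum inner x mult.commute)
      also have "(\<Sum>y\<in>C. (x \<bullet> y) ^ l) = real N * (norm x ^ l * zonal_moment TYPE('n) l)"
        using l N t by (intro power_sum) simp
      also have "of_real \<dots> = poly q (of_real w)"
      proof (cases "even l")
        case True
        then obtain r where r: "l = 2 * r" by blast
        have "norm x ^ l = (1 + w\<^sup>2) ^ r"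
          unfolding r power_mult power2_norm_eq_inner by (simp add: inner x power2_eq_square)
        then show ?thesis by (simp add: q_def r power2_eq_square algebra_simps)
      next
        case False
        then show ?thesis by (simp add: q_def zonal_moment_odd)
      qed
      finally show "poly p (of_real w) = poly q (of_real w)" .
    qed
    moreover have "poly q \<i> = 0" using l by (auto simp: q_def elim!: evenE)
    moreover have "poly p \<i> = (\<Sum>y\<in>C. z y ^ l)"
      by (simp add: p_def poly_sum z_def Complex_eq mult.commute)
    ultimately show ?thesis by simp
  qed
  obtain y0 where y0: "y0 \<in> C" using neC by blast
  have norm_z: "norm (z y) = 1" if "y \<in> C" for y
    using normC[OF that] by (simp add: z_def inner complex_norm power2_eq_square)
  define a where "a y = z y * cnj (z y0)" for y
  have a: "a y ^ N = 1" if "y \<in> C" for y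
  proof (rule power_eq_1_if_power_sums_vanish[OF finC cardC _ _ y0 _ that])
    show "norm (a y) = 1" if "y \<in> C" for y using norm_z that y0 by (simp add: a_def norm_mult)
    show "(\<Sum>y\<in>C. a y ^ l) = 0" if "0 < l" "l < N" for l
      using sums[OF that] by (simp add: a_def power_mult_distrib flip: sum_distrib_right)
    show "a y0 = 1" using norm_z[OF y0] by (simp add: a_def complex_norm_square[symmetric])
  qed
  \<comment> \<open>Half a step of the polygon, so that its \<open>N\<close>-th power is -1.\<close>
  define \<zeta> where "\<zeta> = cis (pi / N)"
  have "real N * (pi / N) = pi" using m N by simp
  then have \<zeta>: "\<zeta> ^ N = - 1" unfolding \<zeta>_def Complex.DeMoivre by (simp only: cis_pi)
  define w where "w = z y0 * \<zeta>"
  define x :: "real^'n" where "x = (\<chi> k. if k = i then Re w else Im w)"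
  have xij: "x $ i = Re w" "x $ j = Im w" using ij(2) by (auto simp: x_def)
  have "norm w = 1" using norm_z[OF y0] by (simp add: w_def \<zeta>_def norm_mult)
  then have "Re w \<noteq> 0 \<or> Im w \<noteq> 0" by (auto simp: cmod_def)
  then have "x \<noteq> 0" using xij by auto
  have vals: "x \<bullet> y \<in> Re ` {b. b ^ (2 * m) = - 1}" if "y \<in> C" for y
  proof (rule image_eqI)
    show "x \<bullet> y = Re (\<zeta> * cnj (a y))"
      by (simp add: inner xij w_def a_def z_def algebra_simps)
    have "(\<zeta> * cnj (a y)) ^ N = - cnj (a y ^ N)" using \<zeta> by (simp add: power_mult_distrib)
    then have "(\<zeta> * cnj (a y)) ^ N = - 1" unfolding a[OF that] by simp
    then show "\<zeta> * cnj (a y) \<in> {b. b ^ (2 * m) = - 1}" unfolding N by simp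
  qed
  have m0: "m > 0" using m by simp
  have "(\<bullet>) x ` C \<subseteq> Re ` {b. b ^ (2 * m) = - 1}" using vals by blast
  then have "card ((\<bullet>) x ` C) \<le> card (Re ` {b. b ^ (2 * m) = - 1})"
    using card_Re_roots_minus_1(1)[OF m0] by (intro card_mono) auto
  then show ?thesis using card_Re_roots_minus_1(2)[OF m0] \<open>x \<noteq> 0\<close> by (intro exI[of _ x]) simp
qed

theorem theorem3p1:
  fixes n N \<tau> :: nat and C :: "(real^'n) set"
  assumes dim: "CARD('n) = n"
    and triple:
      "(\<exists>m\<ge>1. n = 2 \<and> N = 2*m \<and> \<tau> = 2*m - 1) \<or>
       (\<exists>m\<ge>1. n = 2 \<and> N = 2*m + 1 \<and> \<tau> = 2*m) \<or>
       (2 \<le> N \<and> N \<le> n \<and> \<tau> = 1) \<or>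
       (n \<ge> 2 \<and> N = n + 1 \<and> \<tau> = 2) \<or>
       (n \<ge> 2 \<and> N = 2*n \<and> \<tau> = 3) \<or>
       (n, N, \<tau>) = (5, 16, 3) \<or> (n, N, \<tau>) = (6, 27, 4) \<or> (n, N, \<tau>) = (7, 56, 5) \<or>
       (n, N, \<tau>) = (21, 112, 3) \<or> (n, N, \<tau>) = (21, 162, 3) \<or> (n, N, \<tau>) = (22, 100, 3) \<or>
       (n, N, \<tau>) = (22, 275, 4) \<or> (n, N, \<tau>) = (22, 891, 5) \<or> (n, N, \<tau>) = (23, 552, 5) \<or>
       (n, N, \<tau>) = (23, 4600, 7)"
    and sharp: "sharp_code N \<tau> C"
  shows "\<exists>xt \<in> sphere (0::real^'n) 1.
     (\<lambda>y. xt \<bullet> y) ` C = sharp_nodes n \<tau> \<and>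
     (\<forall>a \<in> sharp_nodes n \<tau>. real (card {y \<in> C. xt \<bullet> y = a}) = real N * sharp_weight n \<tau> a) \<and>
     (\<forall>h :: real \<Rightarrow> ereal.
        ((\<forall>t\<in>{-1..1}. 0 \<le> h t) \<and> continuous_on {-1..1} h \<and> (\<forall>t\<in>{-1<..<1}. h t \<noteq> \<infinity>) \<and>
         (\<exists>D :: nat \<Rightarrow> real \<Rightarrow> real.
            (\<forall>t\<in>{-1<..<1}. D 0 t = real_of_ereal (h t)) \<and>
            (\<forall>m\<le>\<tau>. \<forall>t\<in>{-1<..<1}. (D m has_real_derivative D (Suc m) t) (at t)) \<and>
            (\<forall>t\<in>{-1<..<1}. 0 \<le> D (Suc \<tau>) t)))
        \<longrightarrow> (INF x \<in> sphere (0::real^'n) 1. \<Sum>y\<in>C. h (x \<bullet> y))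
               = (\<Sum>a \<in> sharp_nodes n \<tau>. ereal (real N * sharp_weight n \<tau> a) * h a)
          \<and> (\<Sum>y\<in>C. h (xt \<bullet> y))
               = (\<Sum>a \<in> sharp_nodes n \<tau>. ereal (real N * sharp_weight n \<tau> a) * h a))"
proof -
  have n2: "n \<ge> 2" using triple by auto
  interpret sharp_config C n N \<tau> using dim n2 sharp by unfold_locales
  \<comment> \<open>Odd \<tau> is the case \<open>e = 0\<close> with \<open>k\<close> inner
    products; even \<tau> is the case \<open>e = 1\<close> with \<open>k + 1\<close>, one of them
    -1.\<close>
  have odd_case: ?thesis if x: "\<exists>x. x \<noteq> 0 \<and> card ((\<bullet>) x ` C) \<le> k" and k: "\<tau> + 1 = 2 * k" "k > 0" for k
  proof -
    obtain x where x: "x \<noteq> 0" "card ((\<bullet>) x ` C) \<le> k" using x by blast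
    show ?thesis
      by (rule universal_minimum_of_few_inner_products[OF design x(1) dim n2 cardC, of k 0]) (use x k in simp_all)
  qed
  have even_case: ?thesis if k: "\<tau> = 2 * k" "k > 0" for k
  proof -
    obtain y0 where y0: "y0 \<in> C" using neC by blast
    note P = point_even[OF k(1) y0]
    show ?thesis
      by (rule universal_minimum_of_few_inner_products[OF design P(1) dim n2 cardC _ _ k(2) P(2,3)]) (use k in simp_all)
  qed
  from triple show ?thesis
  proof (elim disjE exE conjE)
    fix m assume "m \<ge> 1" "n = 2" "N = 2 * m" "\<tau> = 2 * m - 1"
    then show ?thesis by (intro odd_case[of m] point_circle) simp_all
  next
    fix m assume "m \<ge> 1" "\<tau> = 2 * m"
    then show ?thesis by (intro even_case[of m]) simp_all
  next
    assume "N \<le> n" "\<tau> = 1"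
    then show ?thesis by (intro odd_case[of 1] point_orthogonal) simp_all
  next
    assume "\<tau> = 2"
    then show ?thesis by (intro even_case[of 1]) simp_all
  next
    assume "N = 2 * n" "\<tau> = 3"
    then show ?thesis by (intro odd_case[of 2] point_cross_polytope) simp_all
  next
    assume "(n, N, \<tau>) = (5, 16, 3)"
    then show ?thesis by (intro odd_case[of 2] point_5_16) simp_all
  next
    assume "(n, N, \<tau>) = (6, 27, 4)"
    then show ?thesis by (intro even_case[of 2]) simp_all
  next
    assume "(n, N, \<tau>) = (7, 56, 5)"
    then show ?thesis by (intro odd_case[of 3] point_7_56) simp_all
  next
    assume "(n, N, \<tau>) = (21, 112, 3)"
    then show ?thesis by (intro odd_case[of 2] point_21_112) simp_all
  next
    assume "(n, N, \<tau>) = (21, 162, 3)"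
    then show ?thesis by (intro odd_case[of 2] point_21_162) simp_all
  next
    assume "(n, N, \<tau>) = (22, 100, 3)"
    then show ?thesis by (intro odd_case[of 2] point_22_100) simp_all
  next
    assume "(n, N, \<tau>) = (22, 275, 4)"
    then show ?thesis by (intro even_case[of 2]) simp_all
  next
    assume "(n, N, \<tau>) = (22, 891, 5)"
    then show ?thesis by (intro odd_case[of 3] point_22_891) simp_all
  next
    assume "(n, N, \<tau>) = (23, 552, 5)"
    then show ?thesis by (intro odd_case[of 3] point_23_552) simp_all
  next
    assume "(n, N, \<tau>) = (23, 4600, 7)"
    then show ?thesis by (intro odd_case[of 4] point_23_4600) simp_all
  qed
qed

end
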